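(* Let $s\geq 1/2$, $1\leq p\leq\infty$, and suppose $p'(s+1/4)>1$, where $p'$ is the conjugate exponent of $p$. Let $W$ be the solution map, defined for smooth initial data, of the modified mKdV equation $$\partial_t u+\partial_x^3u+\Big(u^2-\frac{1}{2\pi}\int_{\mathbb{T}}u^2(x,t)\,dx\Big)\partial_x u=0,\qquad u(\cdot,0)=u_0,$$ for real-valued $u$ on $\mathbb{T}\times\mathbb{R}$. Then for every $R>0$ there exists $T>0$ such that $W$ extends to a uniformly continuous map from the ball $B(0,R)=\{u_0\in\mathcal{F}L^{s,p}(\mathbb{T}):\|u_0\|_{\mathcal{F}L^{s,p}}<R\}$ to $C([0,T],\mathcal{F}L^{s,p}(\mathbb{T}))$.
   Context: $\mathbb{T}=\mathbb{R}/2\pi\mathbb{Z}$, $\hat f(n)$ denotes the $n$-th Fourier coefficient of $f\in\mathcal{D}'(\mathbb{T})$, and $\langle n\rangle=(1+|n|^2)^{1/2}$. For $s\in\mathbb{R}$, $1\le p\le\infty$, $\mathcal{F}L^{s,p}(\mathbb{T})=\{f\in\mathcal{D}'(\mathbb{T}):\|f\|_{\mathcal{F}L^{s,p}}:=\|\langle\cdot\rangle^s\hat f(\cdot)\|_{\ell^p(\mathbb{Z})}<\infty\}$. *)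

theory Defs
  imports "HOL-Analysis.Analysis"
begin

definition jbr :: "int \<Rightarrow> real" where
  "jbr n = sqrt (1 + (real_of_int n)\<^sup>2)"

(* Fourier coefficients of a 2pi-periodic function on R (identified with a function on T) *)
definition fcoef :: "(real \<Rightarrow> real) \<Rightarrow> int \<Rightarrow> complex" where
  "fcoef f n = integral {0..2*pi} (\<lambda>x. complex_of_real (f x) * exp (- \<i> * of_int n * of_real x))
                 / complex_of_real (2*pi)"

(* Elements of FL^{s,p}(T) are represented by their Fourier coefficient sequences
   Z -> C.  Real-valued distributions: c(-n) = conj (c n). *)
definition real_coeffs :: "(int \<Rightarrow> complex) \<Rightarrow> bool" where
  "real_coeffs c \<longleftrightarrow> (\<forall>n. c (- n) = cnj (c n))"

definition in_FL :: "real \<Rightarrow> ereal \<Rightarrow> (int \<Rightarrow> complex) \<Rightarrow> bool" where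
  "in_FL s p c \<longleftrightarrow>
     (if p = \<infinity> then bdd_above (range (\<lambda>n. jbr n powr s * cmod (c n)))
      else (\<lambda>n. (jbr n powr s * cmod (c n)) powr real_of_ereal p) summable_on UNIV)"

definition FL_norm :: "real \<Rightarrow> ereal \<Rightarrow> (int \<Rightarrow> complex) \<Rightarrow> real" where
  "FL_norm s p c =
     (if p = \<infinity> then (SUP n. jbr n powr s * cmod (c n))
      else (\<Sum>\<^sub>\<infinity>n. (jbr n powr s * cmod (c n)) powr real_of_ereal p) powr (1 / real_of_ereal p))"

definition FLr :: "real \<Rightarrow> ereal \<Rightarrow> (int \<Rightarrow> complex) set" where
  "FLr s p = {c. real_coeffs c \<and> in_FL s p c}"

definition conj_exp :: "ereal \<Rightarrow> ereal" where
  "conj_exp p = (if p = 1 then \<infinity> else if p = \<infinity> then 1 else p / (p - 1))"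

fun Ck :: "nat \<Rightarrow> ('a::real_normed_vector \<Rightarrow> real) \<Rightarrow> bool" where
  "Ck 0 f = continuous_on UNIV f"
| "Ck (Suc k) f = ((\<forall>z. f differentiable (at z)) \<and> (\<forall>v. Ck k (\<lambda>z. frechet_derivative f (at z) v)))"

definition smooth :: "('a::real_normed_vector \<Rightarrow> real) \<Rightarrow> bool" where
  "smooth f \<longleftrightarrow> (\<forall>k. Ck k f)"

definition smooth_data :: "(real \<Rightarrow> real) \<Rightarrow> bool" where
  "smooth_data u0 \<longleftrightarrow> smooth u0 \<and> (\<forall>x. u0 (x + 2*pi) = u0 x)"

definition mmkdv_smooth_solution :: "(real \<Rightarrow> real \<Rightarrow> real) \<Rightarrow> bool" where
  "mmkdv_smooth_solution u \<longleftrightarrow>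
     smooth (\<lambda>(x, t). u x t) \<and> (\<forall>x t. u (x + 2*pi) t = u x t) \<and>
     (\<forall>x t. deriv (\<lambda>\<tau>. u x \<tau>) t + (deriv ^^ 3) (\<lambda>y. u y t) x
            + ((u x t)\<^sup>2 - integral {0..2*pi} (\<lambda>y. (u y t)\<^sup>2) / (2*pi)) * deriv (\<lambda>y. u y t) x = 0)"

end

theory Submission
  imports Defs
begin

text \<open>Removing the linear flow, the Fourier coefficients of a solution satisfy an integral equation whose
  nonresonant terms carry the phase \<open>h t\<close> with \<open>h = -3 (n1 + n2) (n2 + n3) (n3 + n1)\<close>. The time integral of
  \<open>exp (\<i> h t) g t\<close> with \<open>g\<close> Hoelder continuous of exponent \<open>1/2\<close> is again Hoelder continuous of exponent \<open>1/2\<close>,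
  with a gain of \<open>\<bar>h\<bar>^(-1/2)\<close> and a small factor for short times. So it is possible to work with sequences of
  Hoelder-1/2 functions of time, without Bourgain spaces. The gain compensates the derivative: by Hoelder's inequality
  everything reduces to the uniform summability, in the exponent dual to \<open>p\<close>, of
  \<open>\<bar>n\<bar> jbr n ^ s \<bar>h\<bar>^(-1/2) (jbr n1 jbr n2 jbr n3)^(-s)\<close> over \<open>n1 + n2 + n3 = n\<close>, and this kernel is bounded by
  \<open>(jbr u jbr v)^(-s-1/4)\<close> for a suitable pair \<open>u, v\<close> of independent linear combinations of the frequencies. Picard
  iteration then gives solutions depending in a Lipschitz way on the data. Smooth solutions satisfy the same
  integral equation, hence coincide with the constructed ones.\<close>

section \<open>Norm bounds in sequence spaces\<close>

text \<open>The Hoelder exponent 1/2 is a balance. If \<open>g\<close> has exponent \<alpha>, the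
  half-period comparison bounds the integral over a length \<delta> by about \<delta>
  |h|^(-\<alpha>) + |h|^(-1). For this to be Hoelder of the same exponent the gain can only be
  |h|^(-min(\<alpha>, 1 - \<alpha>)), which is best at \<alpha> = 1/2. The interaction (n, n, -n)
  does not oscillate at all, so its derivative has to be absorbed by two of its weights, which is
  possible because s \<ge> 1/2.

  Restoring the linear flow multiplies every coefficient by a number of modulus 1, so Lipschitz
  bounds at a fixed time carry over to the solution. Continuity in time does not: the phases n^3 t
  are not equicontinuous in n, and one has to approximate by finitely many frequencies. For p =
  \<infinity> this fails for general data. As only some uniformly continuous extension of W is asked
  for, the data are there first mapped, in a Lipschitz way, to sequences with vanishing tails; the
  map fixes smooth data.

  A smooth solution has no a priori bound in terms of R on the whole time interval, so its
  identification with the constructed one needs uniqueness in balls of arbitrary radius.\<close>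

text \<open>The \<open>\<ell>^p\<close> norm of a nonnegative family is at most \<open>C\<close>. Finite partial sums are used because \<open>infsum\<close>
  is \<open>0\<close> on families that are not summable.\<close>

definition lp_le :: "ereal \<Rightarrow> ('i \<Rightarrow> real) \<Rightarrow> real \<Rightarrow> bool" where
  "lp_le p A C \<longleftrightarrow> 0 \<le> C \<and> (\<forall>i. 0 \<le> A i) \<and>
     (if p = \<infinity> then \<forall>i. A i \<le> C
      else \<forall>F. finite F \<longrightarrow> (\<Sum>i\<in>F. A i powr real_of_ereal p) \<le> C powr real_of_ereal p)"

lemma lp_le_nonneg: "lp_le p A C \<Longrightarrow> 0 \<le> A i" and lp_le_bound_nonneg: "lp_le p A C \<Longrightarrow> 0 \<le> C"
  by (auto simp: lp_le_def)

lemma ereal_exponent_cases: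
  fixes p :: ereal
  assumes "1 \<le> p"
  obtains "p = \<infinity>" | P where "p = ereal P" "1 \<le> P"
  using assms by (cases p) auto

lemma lp_le_infinity: "lp_le \<infinity> A C \<longleftrightarrow> 0 \<le> C \<and> (\<forall>i. 0 \<le> A i \<and> A i \<le> C)"
  by (auto simp: lp_le_def)

lemma lp_le_real:
  "lp_le (ereal P) A C \<longleftrightarrow> 0 \<le> C \<and> (\<forall>i. 0 \<le> A i) \<and> (\<forall>F. finite F \<longrightarrow> (\<Sum>i\<in>F. A i powr P) \<le> C powr P)"
  by (auto simp: lp_le_def)

lemma lp_le_pointwise:
  assumes "1 \<le> p" "lp_le p A C"
  shows "A i \<le> C"
  using assms(1)
proof (cases rule: ereal_exponent_cases)
  case 1
  then show ?thesis using assms by (simp add: lp_le_def)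
next
  case (2 P)
  have "A i powr P \<le> C powr P"
    using assms(2) 2 finite.emptyI by (auto simp: lp_le_real dest: spec[of _ "{i}"])
  then show ?thesis
    using assms(2) 2 by (meson lp_le_def lp_le_nonneg linorder_not_le powr_less_mono2 order_less_le_trans zero_less_one)
qed

lemma lp_le_mono:
  assumes "1 \<le> p" "lp_le p B D" "\<And>i. 0 \<le> A i" "\<And>i. A i \<le> B i" "D \<le> C"
  shows "lp_le p A C"
  using assms(1)
proof (cases rule: ereal_exponent_cases)
  case 1
  then show ?thesis using assms by (auto simp: lp_le_infinity) (meson order_trans)
next
  case (2 P)
  show ?thesis unfolding 2 lp_le_real
  proof (intro conjI allI impI)
    show "0 \<le> C" using assms lp_le_bound_nonneg by force
    fix F :: "'a set" assume "finite F"
    have "(\<Sum>i\<in>F. A i powr P) \<le> (\<Sum>i\<in>F. B i powr P)"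
      using assms 2 by (intro sum_mono powr_mono2) auto
    also have "\<dots> \<le> D powr P" using assms 2 \<open>finite F\<close> by (auto simp: lp_le_real)
    also have "\<dots> \<le> C powr P" using assms 2 by (intro powr_mono2) (auto simp: lp_le_def)
    finally show "(\<Sum>i\<in>F. A i powr P) \<le> C powr P" .
  qed (use assms in auto)
qed

lemma lp_le_zero: "1 \<le> p \<Longrightarrow> 0 \<le> C \<Longrightarrow> lp_le p (\<lambda>_. 0) C"
  by (auto simp: lp_le_def)

lemma lp_le_scale:
  assumes "1 \<le> p" "lp_le p A C" "0 \<le> c"
  shows "lp_le p (\<lambda>i. c * A i) (c * C)"
  using assms(1)
proof (cases rule: ereal_exponent_cases)
  case 1
  then show ?thesis using assms by (auto simp: lp_le_infinity intro: mult_left_mono)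
next
  case (2 P)
  show ?thesis using assms(2,3) unfolding 2 lp_le_real
    by (auto simp: powr_mult sum_distrib_left[symmetric] intro!: mult_left_mono)
qed

text \<open>Convexity is used on the open half-line \<open>{0<..}\<close>; when \<open>a\<close> or
  \<open>b\<close> is 0 the claim reduces to \<open>w powr P \<le> w\<close> for weights
  \<open>w\<close> in the unit interval.\<close>

lemma powr_convex_comb:
  fixes a b u v P :: real
  assumes "0 \<le> a" "0 \<le> b" "0 \<le> u" "0 \<le> v" "u + v = 1" "1 \<le> P"
  shows "(u * a + v * b) powr P \<le> u * a powr P + v * b powr P"
proof -
  have *: "(w * c) powr P \<le> w * c powr P" if "0 \<le> w" "w \<le> 1" "0 \<le> c" for w c
  proof -
    have "w powr P \<le> w"
      using that assms(6) powr_mono'[of 1 P w] by simp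
    then show ?thesis using that by (simp add: powr_mult mult_right_mono)
  qed
  consider "a = 0" | "b = 0" | "a > 0" "b > 0" using assms by linarith
  then show ?thesis
  proof cases
    case 3
    have "convex_on {0<..} (\<lambda>x. x powr P)" using powr_convex assms by blast
    have u: "u = 1 - v" using assms by simp
    show ?thesis unfolding u using convex_onD[OF \<open>convex_on {0<..} (\<lambda>x. x powr P)\<close>, of v a b] 3 assms(3-5) by simp
  qed (use assms *[of v b] *[of u a] in auto)
qed

text \<open>Minkowski's inequality from convexity alone: the sum is \<open>C + D\<close> times a
  convex combination, with weights \<open>C / (C + D)\<close> and \<open>D / (C + D)\<close>, of the
  normalised families \<open>A i / C\<close> and \<open>B i / D\<close>. A zero bound forces a zero
  family and is treated apart.\<close>

lemma lp_le_add:
  assumes "1 \<le> p" "lp_le p A C" "lp_le p B D"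
  shows "lp_le p (\<lambda>i. A i + B i) (C + D)"
  using assms(1)
proof (cases rule: ereal_exponent_cases)
  case 1
  then show ?thesis using assms by (auto simp: lp_le_infinity intro: add_mono)
next
  case (2 P)
  note nn = lp_le_nonneg[OF assms(2)] lp_le_nonneg[OF assms(3)] lp_le_bound_nonneg[OF assms(2)] lp_le_bound_nonneg[OF assms(3)]
  consider "C = 0" | "D = 0" | "C > 0" "D > 0" using nn by linarith
  then show ?thesis
  proof cases
    case 1
    then have "A i = 0" for i using lp_le_pointwise[OF assms(1,2)] nn by (metis order_antisym)
    with 1 assms show ?thesis by simp
  next
    case 2
    then have "B i = 0" for i using lp_le_pointwise[OF assms(1,3)] nn by (metis order_antisym)
    with 2 assms show ?thesis by simp
  next
    case 3
    show ?thesis unfolding 2 lp_le_real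
    proof (intro conjI allI impI)
      fix F :: "'a set" assume F: "finite F"
      define u v where "u = C / (C + D)" and "v = D / (C + D)"
      let ?u = u and ?v = v
      have uv: "?u + ?v = 1" "0 \<le> ?u" "0 \<le> ?v" using 3 by (auto simp: u_def v_def add_divide_distrib[symmetric])
      have eq: "A i + B i = (C + D) * (?u * (A i / C) + ?v * (B i / D))" for i
      proof -
        have "?u * (A i / C) = A i / (C + D)" "?v * (B i / D) = B i / (C + D)" using 3 by (auto simp: u_def v_def)
        moreover have "C + D \<noteq> 0" using 3 by linarith
        ultimately show ?thesis by (simp only: distrib_left) simp
      qed
      have "(\<Sum>i\<in>F. (A i + B i) powr P) = (\<Sum>i\<in>F. (C + D) powr P * (?u * (A i / C) + ?v * (B i / D)) powr P)"
        using 3 nn by (subst eq) (auto simp: powr_mult)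
      also have "\<dots> \<le> (\<Sum>i\<in>F. (C + D) powr P * (?u * (A i / C) powr P + ?v * (B i / D) powr P))"
        using 3 2 nn uv by (intro sum_mono mult_left_mono powr_convex_comb) auto
      also have "\<dots> = (C + D) powr P * (?u * ((\<Sum>i\<in>F. A i powr P) / C powr P) + ?v * ((\<Sum>i\<in>F. B i powr P) / D powr P))"
        using 3 nn by (simp add: powr_divide sum_distrib_left[symmetric] sum.distrib sum_divide_distrib[symmetric])
      also have "\<dots> \<le> (C + D) powr P * (?u * 1 + ?v * 1)"
        using assms(2,3) F 3 uv unfolding 2 lp_le_real
        by (intro mult_left_mono add_mono) auto
      finally show "(\<Sum>i\<in>F. (A i + B i) powr P) \<le> (C + D) powr P" using uv by simp
    qed (use nn in auto)
  qed
qed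

lemma lp_le_sum:
  assumes "1 \<le> p" "finite S" "\<And>k. k \<in> S \<Longrightarrow> lp_le p (A k) (C k)"
  shows "lp_le p (\<lambda>i. \<Sum>k\<in>S. A k i) (\<Sum>k\<in>S. C k)"
  using assms(2,3)
proof (induction S)
  case empty
  then show ?case using lp_le_zero[OF assms(1), of 0] by simp
next
  case (insert x S)
  then show ?case using lp_le_add[OF assms(1), of "A x" "C x"] by simp
qed

text \<open>A form of Fatou's lemma: only finite partial sums occur in \<open>lp_le\<close>, so
  pointwise convergence suffices. It turns bounds for finite sums of families into bounds for series
  of families.\<close>

lemma lp_le_limit:
  assumes "1 \<le> p" "F \<noteq> bot" "\<And>i. ((\<lambda>k. A k i) \<longlongrightarrow> B i) F"
    and ev: "eventually (\<lambda>k. lp_le p (A k) (C k)) F" and lim: "(C \<longlongrightarrow> D) F"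
  shows "lp_le p B D"
proof -
  have D: "0 \<le> D"
    by (rule tendsto_lowerbound[OF lim _ assms(2)], rule eventually_mono[OF ev]) (simp add: lp_le_def)
  have B: "0 \<le> B i" for i
    by (rule tendsto_lowerbound[OF assms(3) _ assms(2)], rule eventually_mono[OF ev]) (simp add: lp_le_def)
  show ?thesis using assms(1)
  proof (cases rule: ereal_exponent_cases)
    case 1
    have "B i \<le> D" for i
      by (rule tendsto_le[OF assms(2) lim assms(3)]) (use ev 1 in \<open>auto elim!: eventually_mono simp: lp_le_infinity\<close>)
    then show ?thesis using 1 B D by (simp add: lp_le_infinity)
  next
    case (2 P)
    have *: "(\<Sum>i\<in>S. B i powr P) \<le> D powr P" if "finite S" for S
    proof (rule tendsto_le[OF assms(2)])
      show "((\<lambda>k. C k powr P) \<longlongrightarrow> D powr P) F"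
        by (rule tendsto_powr'[OF lim]) (use ev 2 in \<open>auto elim!: eventually_mono simp: lp_le_real\<close>)
      show "((\<lambda>k. \<Sum>i\<in>S. A k i powr P) \<longlongrightarrow> (\<Sum>i\<in>S. B i powr P)) F"
        by (intro tendsto_sum tendsto_powr'[OF assms(3)]) (use ev 2 in \<open>auto elim!: eventually_mono simp: lp_le_real\<close>)
      show "\<forall>\<^sub>F k in F. (\<Sum>i\<in>S. A k i powr P) \<le> C k powr P"
        using ev by eventually_elim (use 2 that in \<open>auto simp: lp_le_real\<close>)
    qed
    then show ?thesis using 2 B D by (simp add: lp_le_real)
  qed
qed

lemma lp_le_bound_limit:
  assumes "1 \<le> p" "\<And>k::nat. lp_le p A (C k)" "C \<longlonglongrightarrow> D"
  shows "lp_le p A D"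
  by (rule lp_le_limit[OF assms(1), of sequentially "\<lambda>_. A" A C D]) (use assms in auto)

text \<open>For \<open>1 < p < \<infinity>\<close> this is Young's inequality applied termwise to
  the families divided by their bounds. At the two end exponents one family is simply bounded by its
  supremum.\<close>

lemma holder_lp_le:
  assumes "1 \<le> p" "lp_le (conj_exp p) K \<kappa>" "lp_le p X C" "finite F"
  shows "(\<Sum>i\<in>F. K i * X i) \<le> \<kappa> * C"
proof -
  note nn = lp_le_nonneg[OF assms(2)] lp_le_nonneg[OF assms(3)] lp_le_bound_nonneg[OF assms(2)] lp_le_bound_nonneg[OF assms(3)]
  consider "p = \<infinity>" | "p = 1" | P where "p = ereal P" "1 < P"
    using assms(1) by (cases p) (auto simp: one_ereal_def less_le)
  then show ?thesis
  proof cases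
    case 1
    then have K: "(\<Sum>i\<in>F. K i) \<le> \<kappa>"
      using assms(2,4) nn by (simp add: conj_exp_def one_ereal_def lp_le_real)
    have "(\<Sum>i\<in>F. K i * X i) \<le> (\<Sum>i\<in>F. K i * C)"
      using 1 assms(3) nn by (intro sum_mono mult_left_mono) (auto simp: lp_le_infinity)
    also have "\<dots> \<le> \<kappa> * C" using K nn by (simp add: sum_distrib_right[symmetric] mult_right_mono)
    finally show ?thesis .
  next
    case 2
    then have X: "(\<Sum>i\<in>F. X i) \<le> C"
      using assms(3,4) nn by (simp add: one_ereal_def lp_le_real)
    have "(\<Sum>i\<in>F. K i * X i) \<le> (\<Sum>i\<in>F. \<kappa> * X i)"
      using 2 assms(2) nn by (intro sum_mono mult_right_mono) (auto simp: conj_exp_def lp_le_infinity)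
    also have "\<dots> \<le> \<kappa> * C" using X nn by (simp add: sum_distrib_left[symmetric] mult_left_mono)
    finally show ?thesis .
  next
    case 3
    define Q where "Q = P / (P - 1)"
    have Q: "conj_exp p = ereal Q" "1 < Q" "1 / Q + 1 / P = 1"
      using 3 by (auto simp: conj_exp_def Q_def one_ereal_def field_simps)
    have q1: "1 \<le> conj_exp p" using Q by simp
    consider "\<kappa> = 0" | "C = 0" | "\<kappa> > 0" "C > 0" using nn by linarith
    then show ?thesis
    proof cases
      case 1
      then have "K i = 0" for i using lp_le_pointwise[OF q1 assms(2)] nn by (metis order_antisym)
      with 1 show ?thesis by simp
    next
      case 2
      then have "X i = 0" for i using lp_le_pointwise[OF assms(1,3)] nn by (metis order_antisym)
      with 2 show ?thesis by simp
    next
      case pos: 3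
      have "(\<Sum>i\<in>F. K i * X i) = \<kappa> * C * (\<Sum>i\<in>F. (K i / \<kappa>) * (X i / C))"
        using pos by (simp add: sum_distrib_left)
      also have "\<dots> \<le> \<kappa> * C * (\<Sum>i\<in>F. (K i / \<kappa>) powr Q / Q + (X i / C) powr P / P)"
        using pos nn 3 Q by (intro mult_left_mono sum_mono Youngs_inequality) auto
      also have "(\<Sum>i\<in>F. (K i / \<kappa>) powr Q / Q + (X i / C) powr P / P)
          = ((\<Sum>i\<in>F. K i powr Q) / \<kappa> powr Q) / Q + ((\<Sum>i\<in>F. X i powr P) / C powr P) / P"
        using pos nn by (simp add: powr_divide sum.distrib sum_divide_distrib)
      also have "\<dots> \<le> 1 / Q + 1 / P"
        using assms(2,3,4) pos 3 Q by (intro add_mono divide_right_mono) (auto simp: lp_le_real)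
      finally show ?thesis using Q pos by (simp add: mult_left_mono)
    qed
  qed
qed

lemma lp_le_inj:
  assumes "lp_le p A C" "inj \<phi>"
  shows "lp_le p (\<lambda>i. A (\<phi> i)) C"
  unfolding lp_le_def
proof (intro conjI allI)
  show "if p = \<infinity> then \<forall>i. A (\<phi> i) \<le> C
    else \<forall>F. finite F \<longrightarrow> (\<Sum>i\<in>F. A (\<phi> i) powr real_of_ereal p) \<le> C powr real_of_ereal p"
  proof (cases "p = \<infinity>")
    case False
    have "(\<Sum>i\<in>F. A (\<phi> i) powr real_of_ereal p) \<le> C powr real_of_ereal p" if "finite F" for F
    proof -
      have "(\<Sum>i\<in>F. A (\<phi> i) powr real_of_ereal p) = (\<Sum>i\<in>\<phi> ` F. A i powr real_of_ereal p)"
        using assms(2) by (subst sum.reindex) (auto intro: inj_on_subset)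
      also have "\<dots> \<le> C powr real_of_ereal p" using assms(1) False that by (simp add: lp_le_def)
      finally show ?thesis .
    qed
    then show ?thesis using False by simp
  qed (use assms in \<open>simp add: lp_le_def\<close>)
qed (use assms in \<open>auto simp: lp_le_def\<close>)

lemma sum_product_le:
  fixes f :: "'i \<Rightarrow> real" and g :: "'j \<Rightarrow> real"
  assumes "finite F" "\<And>i. 0 \<le> f i" "\<And>j. 0 \<le> g j"
    and "\<And>S. finite S \<Longrightarrow> sum f S \<le> a" "\<And>S. finite S \<Longrightarrow> sum g S \<le> b"
  shows "(\<Sum>(i,j)\<in>F. f i * g j) \<le> a * b"
proof -
  \<comment> \<open>Enlarging \<open>F\<close> to the product of its two projections makes the
    double sum factorise.\<close>
  have "(\<Sum>(i,j)\<in>F. f i * g j) \<le> (\<Sum>(i,j)\<in>fst ` F \<times> snd ` F. f i * g j)"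
    using assms by (intro sum_mono2) (auto simp: rev_image_eqI)
  also have "\<dots> = sum f (fst ` F) * sum g (snd ` F)"
    by (simp add: sum_product sum.cartesian_product)
  also have "\<dots> \<le> a * b"
    using assms assms(4)[of "{}"] by (intro mult_mono) (auto intro: sum_nonneg)
  finally show ?thesis .
qed

lemma lp_le_prod:
  assumes "1 \<le> p" "lp_le p A C" "lp_le p B D"
  shows "lp_le p (\<lambda>(i,j). A i * B j) (C * D)"
  using assms(1)
proof (cases rule: ereal_exponent_cases)
  case 1
  then show ?thesis using assms by (auto simp: lp_le_infinity intro!: mult_mono)
next
  case (2 P)
  note nn = lp_le_nonneg[OF assms(2)] lp_le_nonneg[OF assms(3)] lp_le_bound_nonneg[OF assms(2)] lp_le_bound_nonneg[OF assms(3)]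
  have "(\<Sum>ij\<in>F. (case ij of (i,j) \<Rightarrow> A i * B j) powr P) \<le> (C * D) powr P" if "finite F" for F
  proof -
    have "(\<Sum>ij\<in>F. (case ij of (i,j) \<Rightarrow> A i * B j) powr P) = (\<Sum>(i,j)\<in>F. A i powr P * B j powr P)"
      using nn by (intro sum.cong) (auto simp: powr_mult)
    also have "\<dots> \<le> C powr P * D powr P"
      using that assms 2 by (intro sum_product_le) (auto simp: lp_le_real)
    finally show ?thesis using nn by (simp add: powr_mult)
  qed
  then show ?thesis using nn unfolding 2 lp_le_real by auto
qed

lemma conj_exp_ge_1: "1 \<le> p \<Longrightarrow> 1 \<le> conj_exp p"
  by (cases p) (auto simp: conj_exp_def one_ereal_def field_simps)

section \<open>The interaction kernel\<close>

lemma jbr_ge_1: "1 \<le> jbr n" and jbr_pos: "0 < jbr n" and abs_le_jbr: "\<bar>real_of_int n\<bar> \<le> jbr n"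
  by (auto simp: jbr_def real_le_rsqrt real_sqrt_gt_zero add_pos_nonneg)

lemma jbr_minus [simp]: "jbr (- n) = jbr n"
  by (simp add: jbr_def)

lemma jbr_mono: "\<bar>m\<bar> \<le> \<bar>n\<bar> \<Longrightarrow> jbr m \<le> jbr n"
  unfolding jbr_def by (simp add: abs_le_square_iff) (metis abs_le_square_iff of_int_abs of_int_le_iff)

lemma jbr_le_twice: "n \<noteq> 0 \<Longrightarrow> jbr n \<le> 2 * \<bar>real_of_int n\<bar>"
proof -
  assume "n \<noteq> 0"
  then have "1 \<le> \<bar>n\<bar>" by linarith
  then have "1 \<le> \<bar>real_of_int n\<bar>" by linarith
  then have "1 \<le> (real_of_int n)\<^sup>2" using one_le_power[of "\<bar>real_of_int n\<bar>" 2] by simp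
  then show ?thesis unfolding jbr_def by (intro real_le_lsqrt) (auto simp: power_mult_distrib)
qed

lemma jbr_add: "\<bar>m\<bar> \<le> \<bar>n\<bar> \<Longrightarrow> jbr (m + n) \<le> 2 * jbr n"
proof -
  assume "\<bar>m\<bar> \<le> \<bar>n\<bar>"
  then have "\<bar>m + n\<bar> \<le> \<bar>2 * n\<bar>" by linarith
  then have "jbr (m + n) \<le> jbr (2 * n)" by (rule jbr_mono)
  also have "\<dots> \<le> 2 * jbr n"
    unfolding jbr_def by (intro real_le_lsqrt) (auto simp: power_mult_distrib)
  finally show ?thesis .
qed

lemma summable_jbr:
  assumes "\<tau> > 1"
  obtains c where "c \<ge> 0" "\<And>F. finite F \<Longrightarrow> (\<Sum>u\<in>F. jbr u powr - \<tau>) \<le> c"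
proof -
  define g where "g n = jbr (int n) powr - \<tau>" for n
  have sm: "summable g"
  proof (rule summable_comparison_test')
    show "summable (\<lambda>n. real n powr - \<tau>)" using assms by (subst summable_real_powr_iff) simp
    fix n :: nat assume "1 \<le> n"
    then show "norm (g n) \<le> real n powr - \<tau>"
      using abs_le_jbr[of "int n"] assms by (simp add: g_def powr_mono2')
  qed
  have half: "(\<Sum>u\<in>F. g (nat \<bar>u\<bar>)) \<le> suminf g" if "finite F" "inj_on (\<lambda>u. nat \<bar>u\<bar>) F" for F :: "int set"
    using that sum_le_suminf[OF sm, of "(\<lambda>u. nat \<bar>u\<bar>) ` F"]
    by (simp add: sum.reindex g_def)
  have geq: "jbr u powr - \<tau> = g (nat \<bar>u\<bar>)" for u
    by (cases "u \<ge> 0") (auto simp: g_def)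
  show ?thesis
  proof (rule that[of "2 * suminf g"])
    show "0 \<le> 2 * suminf g" using sm by (auto intro!: suminf_nonneg simp: g_def)
    fix F :: "int set" assume F: "finite F"
    \<comment> \<open>The map from \<open>u\<close> to its modulus is injective on each half-line,
      hence one copy of the series for each half.\<close>
    have "(\<Sum>u\<in>F. jbr u powr - \<tau>) = (\<Sum>u\<in>F \<inter> {0..}. g (nat \<bar>u\<bar>)) + (\<Sum>u\<in>F - {0..}. g (nat \<bar>u\<bar>))"
      using F by (simp only: geq sum.Int_Diff)
    also have "\<dots> \<le> suminf g + suminf g"
      using F by (intro add_mono half) (auto simp: inj_on_def)
    finally show "(\<Sum>u\<in>F. jbr u powr - \<tau>) \<le> 2 * suminf g" by simp
  qed
qed

lemma lp_le_jbr:
  assumes "1 \<le> q" "q * ereal \<sigma> > 1" "0 \<le> \<sigma>"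
  obtains c where "lp_le q (\<lambda>u. jbr u powr - \<sigma>) c"
  using assms(1)
proof (cases rule: ereal_exponent_cases)
  case 1
  have "jbr u powr - \<sigma> \<le> 1" for u
    using powr_mono[of "- \<sigma>" 0 "jbr u"] assms(3) jbr_ge_1[of u] jbr_pos[of u] by simp
  then have "lp_le q (\<lambda>u. jbr u powr - \<sigma>) 1"
    using 1 by (auto simp: lp_le_infinity)
  then show ?thesis using that by blast
next
  case (2 Q)
  then have "Q * \<sigma> > 1" using assms by (simp add: one_ereal_def)
  then obtain c where c: "c \<ge> 0" "\<And>F. finite F \<Longrightarrow> (\<Sum>u\<in>F. jbr u powr - (Q * \<sigma>)) \<le> c"
    using summable_jbr by blast
  have "lp_le q (\<lambda>u. jbr u powr - \<sigma>) (c powr (1 / Q))"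
    using c 2 by (auto simp: lp_le_real powr_powr mult.commute)
  then show ?thesis using that by blast
qed

text \<open>The kernel below is bounded by a constant times \<open>(jbr u * jbr v) powr - (s + 1/4)\<close>, which is summable
  in the exponent dual to \<open>p\<close> exactly under the hypothesis of the theorem. The bound is the product of the power
  \<open>1/2\<close> of the second inequality, with \<open>W\<close> replaced by \<open>sqrt (jbr u * jbr v)\<close>, and the power \<open>s - 1/2\<close> of
  the first.\<close>

definition dominating :: "int \<Rightarrow> real \<Rightarrow> real \<Rightarrow> int \<Rightarrow> int \<Rightarrow> bool" where
  "dominating n h N u v \<longleftrightarrow>
     \<bar>real_of_int n\<bar> * (jbr u * jbr v) \<le> 1200 * N \<and>
     (\<exists>W\<ge>0. jbr u * jbr v \<le> W\<^sup>2 \<and> \<bar>real_of_int n\<bar> ^ 3 * (jbr u * jbr v) * W \<le> 1200 * (h * N))"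

lemma dominating_separated:
  fixes n1 n2 n3 :: int
  defines "n \<equiv> n1 + n2 + n3"
  assumes "\<bar>n2\<bar> \<le> \<bar>n1\<bar>" "\<bar>n3\<bar> \<le> \<bar>n2\<bar>" "n2 + n3 \<noteq> 0"
    and "\<bar>n\<bar> \<le> 10 * \<bar>n1 + n2\<bar>" "\<bar>n\<bar> \<le> 10 * \<bar>n1 + n3\<bar>"
  shows "dominating n \<bar>real_of_int ((n1 + n2) * (n2 + n3) * (n1 + n3))\<bar> (jbr n1 * jbr n2 * jbr n3) (n2 + n3) n3"
proof -
  let ?x = "\<bar>real_of_int (n1 + n2)\<bar>" and ?y = "\<bar>real_of_int (n2 + n3)\<bar>" and ?z = "\<bar>real_of_int (n1 + n3)\<bar>"
  let ?n = "\<bar>real_of_int n\<bar>"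
  have U: "jbr (n2 + n3) \<le> 2 * jbr n2" using jbr_add[of n3 n2] assms by (simp add: add.commute)
  have Uy: "jbr (n2 + n3) \<le> 2 * ?y" using jbr_le_twice assms by blast
  have V: "jbr n3 \<le> jbr n2" using assms jbr_mono by blast
  have "\<bar>n\<bar> \<le> 3 * \<bar>n1\<bar>" using assms by linarith
  then have n: "?n \<le> 3 * jbr n1" using abs_le_jbr[of n1] by linarith
  have nx: "?n \<le> 10 * ?x" "?n \<le> 10 * ?z" using assms by linarith+
  have pos: "0 \<le> jbr m" for m using jbr_pos less_imp_le by blast
  have 1: "?n * (jbr (n2 + n3) * jbr n3) \<le> (3 * jbr n1) * (2 * jbr n2 * jbr n3)"
    using n U pos by (intro mult_mono) auto
  have 2: "jbr (n2 + n3) * jbr n3 \<le> (2 * jbr n2) * (2 * jbr n2)"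
    using U V pos[of n2] pos[of n3] by (intro mult_mono) auto
  have "?n ^ 3 * (jbr (n2 + n3) * jbr n3) * (2 * jbr n2) = (?n * ?n * ?n) * (jbr (n2 + n3) * jbr n3) * (2 * jbr n2)"
    by (simp add: power3_eq_cube)
  \<comment> \<open>The constants collected here, 10 * 10 * 3 * 2 * 2, are the origin of the 1200 in
    \<open>dominating\<close>.\<close>
  also have "\<dots> \<le> (10 * ?x * (10 * ?z) * (3 * jbr n1)) * (2 * ?y * jbr n3) * (2 * jbr n2)"
    using n nx Uy pos by (intro mult_mono mult_nonneg_nonneg) auto
  also have "\<dots> = 1200 * (\<bar>real_of_int ((n1 + n2) * (n2 + n3) * (n1 + n3))\<bar> * (jbr n1 * jbr n2 * jbr n3))"
    by (simp add: abs_mult)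
  finally have 3: "?n ^ 3 * (jbr (n2 + n3) * jbr n3) * (2 * jbr n2) \<le> \<dots>" .
  have "0 \<le> jbr n1 * jbr n2 * jbr n3" using pos by simp
  then show ?thesis unfolding dominating_def
    using 1 2 3 pos[of n2] by (intro conjI exI[of _ "2 * jbr n2"]) (auto simp: power2_eq_square)
qed

text \<open>All three frequencies are at least of the size of n, so each weight pays for one power
  of |n|. The resonance is then free to pay for the pair: its two smaller factors become
  \<open>u\<close> and \<open>v\<close>, and the largest, \<open>m3\<close>, becomes
  \<open>W\<close>.\<close>

lemma dominating_comparable:
  fixes n1 n2 n3 :: int
  defines "n \<equiv> n1 + n2 + n3"
  assumes m: "m1 = n - n1" "m2 = n - n2" "m3 = n - n3" and nz: "m1 \<noteq> 0" "m2 \<noteq> 0" "m3 \<noteq> 0"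
    and big: "4 * \<bar>n\<bar> \<le> 5 * \<bar>n1\<bar>" "4 * \<bar>n\<bar> \<le> 5 * \<bar>n2\<bar>" "4 * \<bar>n\<bar> \<le> 5 * \<bar>n3\<bar>"
    and max: "\<bar>m1\<bar> \<le> \<bar>m3\<bar>" "\<bar>m2\<bar> \<le> \<bar>m3\<bar>"
  shows "dominating n \<bar>real_of_int (m1 * m2 * m3)\<bar> (jbr n1 * jbr n2 * jbr n3) m1 m2"
proof -
  let ?x = "\<bar>real_of_int m1\<bar>" and ?y = "\<bar>real_of_int m2\<bar>" and ?z = "\<bar>real_of_int m3\<bar>"
  let ?n = "\<bar>real_of_int n\<bar>"
  have pos: "0 \<le> jbr m" for m using jbr_pos less_imp_le by blast
  have N: "?n \<le> 5/4 * jbr n1" "?n \<le> 5/4 * jbr n2" "?n \<le> 5/4 * jbr n3"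
    using big abs_le_jbr[of n1] abs_le_jbr[of n2] abs_le_jbr[of n3] by linarith+
  have U: "jbr m1 \<le> 2 * ?x" "jbr m2 \<le> 2 * ?y" using nz jbr_le_twice by blast+
  have X: "?x \<le> 9/4 * jbr n1" "?y \<le> 9/4 * jbr n2"
    using N abs_le_jbr[of n1] abs_le_jbr[of n2] unfolding m by linarith+
  have "?n * (jbr m1 * jbr m2) \<le> (5/4 * jbr n3) * ((9/2 * jbr n1) * (9/2 * jbr n2))"
    using N X U pos by (intro mult_mono) auto
  also have "\<dots> = 405/16 * (jbr n1 * jbr n2 * jbr n3)" by simp
  also have "\<dots> \<le> 1200 * (jbr n1 * jbr n2 * jbr n3)" using pos by (intro mult_right_mono) auto
  finally have 1: "?n * (jbr m1 * jbr m2) \<le> \<dots>" .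
  have 2: "jbr m1 * jbr m2 \<le> (2 * ?z) * (2 * ?z)"
    using U max pos by (intro mult_mono) auto
  have "?n ^ 3 * (jbr m1 * jbr m2) * (2 * ?z) = (?n * ?n * ?n) * (jbr m1 * jbr m2) * (2 * ?z)"
    by (simp add: power3_eq_cube)
  also have "\<dots> \<le> ((5/4 * jbr n1) * (5/4 * jbr n2) * (5/4 * jbr n3)) * ((2 * ?x) * (2 * ?y)) * (2 * ?z)"
    using N U pos by (intro mult_mono mult_nonneg_nonneg) auto
  also have "\<dots> = 125/8 * (\<bar>real_of_int (m1 * m2 * m3)\<bar> * (jbr n1 * jbr n2 * jbr n3))"
    by (simp add: abs_mult)
  also have "\<dots> \<le> 1200 * (\<bar>real_of_int (m1 * m2 * m3)\<bar> * (jbr n1 * jbr n2 * jbr n3))"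
    using pos by (intro mult_right_mono) auto
  finally have 3: "?n ^ 3 * (jbr m1 * jbr m2) * (2 * ?z) \<le> \<dots>" .
  have "0 \<le> jbr n1 * jbr n2 * jbr n3" using pos by simp
  then show ?thesis unfolding dominating_def
    using 1 2 3 by (intro conjI exI[of _ "2 * ?z"]) (auto simp: power2_eq_square)
qed

text \<open>Every pair \<open>(u, v)\<close> that the case analysis can produce: a sum of two
  frequencies together with one of these two, or two such sums. For fixed \<open>n\<close> each map
  is injective in \<open>(j, k)\<close>, so a summable family in \<open>(u, v)\<close> stays
  summable, with the same bound, in \<open>(j, k)\<close>.\<close>

definition kernel_maps :: "int \<Rightarrow> (int \<times> int \<Rightarrow> int \<times> int) list" where
  "kernel_maps n = [\<lambda>(j,k). (j + k, j), \<lambda>(j,k). (j + k, k), \<lambda>(j,k). (n - j, k), \<lambda>(j,k). (n - j, n - j - k),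
     \<lambda>(j,k). (n - k, j), \<lambda>(j,k). (n - k, n - j - k),
     \<lambda>(j,k). (j + k, n - j), \<lambda>(j,k). (j + k, n - k), \<lambda>(j,k). (n - j, n - k)]"

lemma max3_cases:
  fixes a b c :: "'a::linorder"
  obtains "b \<le> a" "c \<le> a" | "a \<le> b" "c \<le> b" | "a \<le> c" "b \<le> c"
  by (metis linear order_trans)

lemma dominating_commute: "dominating n h N u v = dominating n h N v u"
  by (simp add: dominating_def mult.commute)

text \<open>If the pair sum \<open>n1 + n2\<close> is below |n|/10, then \<open>n3\<close> has
  modulus at least 9|n|/10, so has \<open>n1\<close> by maximality, and \<open>n2\<close> differs
  from \<open>- n1\<close> by less than |n|/10: all three have modulus at least 4|n|/5. The same
  holds with \<open>n2\<close> and \<open>n3\<close> exchanged. In the remaining case both sums are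
  large and \<open>dominating_separated\<close> applies.\<close>

lemma dominating_max:
  fixes n1 n2 n3 :: int
  defines "n \<equiv> n1 + n2 + n3"
  assumes nz: "n1 + n2 \<noteq> 0" "n2 + n3 \<noteq> 0" "n1 + n3 \<noteq> 0"
    and max: "\<bar>n2\<bar> \<le> \<bar>n1\<bar>" "\<bar>n3\<bar> \<le> \<bar>n1\<bar>"
  defines "h \<equiv> \<bar>real_of_int ((n1 + n2) * (n2 + n3) * (n1 + n3))\<bar>" and "N \<equiv> jbr n1 * jbr n2 * jbr n3"
  shows "dominating n h N (n2 + n3) n3 \<or> dominating n h N (n2 + n3) n2 \<or>
    dominating n h N (n1 + n2) (n2 + n3) \<or> dominating n h N (n1 + n2) (n1 + n3) \<or> dominating n h N (n2 + n3) (n1 + n3)"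
proof (cases "\<bar>n\<bar> \<le> 10 * \<bar>n1 + n2\<bar> \<and> \<bar>n\<bar> \<le> 10 * \<bar>n1 + n3\<bar>")
  case True
  show ?thesis
  proof (cases "\<bar>n3\<bar> \<le> \<bar>n2\<bar>")
    case T: True
    then have "dominating n h N (n2 + n3) n3"
      unfolding n_def h_def N_def using True max nz by (intro dominating_separated) (auto simp: n_def)
    then show ?thesis by simp
  next
    case False
    have "dominating (n1 + n3 + n2) \<bar>real_of_int ((n1 + n3) * (n3 + n2) * (n1 + n2))\<bar> (jbr n1 * jbr n3 * jbr n2) (n3 + n2) n2"
      using True max nz False by (intro dominating_separated) (auto simp: n_def algebra_simps)
    then have "dominating n h N (n2 + n3) n2"
      by (simp add: n_def h_def N_def algebra_simps)
    then show ?thesis by simp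
  qed
next
  case False
  then have big: "4 * \<bar>n\<bar> \<le> 5 * \<bar>n1\<bar>" "4 * \<bar>n\<bar> \<le> 5 * \<bar>n2\<bar>" "4 * \<bar>n\<bar> \<le> 5 * \<bar>n3\<bar>"
  proof -
    from False have "10 * \<bar>n1 + n2\<bar> < \<bar>n\<bar> \<or> 10 * \<bar>n1 + n3\<bar> < \<bar>n\<bar>" by auto
    then have "4 * \<bar>n\<bar> \<le> 5 * \<bar>n1\<bar> \<and> 4 * \<bar>n\<bar> \<le> 5 * \<bar>n2\<bar> \<and> 4 * \<bar>n\<bar> \<le> 5 * \<bar>n3\<bar>"
    proof
      assume x: "10 * \<bar>n1 + n2\<bar> < \<bar>n\<bar>"
      then have "9 * \<bar>n\<bar> \<le> 10 * \<bar>n3\<bar>" using abs_triangle_ineq[of "n1 + n2" n3, folded n_def] by auto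
      moreover have "\<bar>n1\<bar> \<le> \<bar>n2\<bar> + \<bar>n1 + n2\<bar>" by linarith
      ultimately show ?thesis using x max by auto
    next
      assume x: "10 * \<bar>n1 + n3\<bar> < \<bar>n\<bar>"
      then have "9 * \<bar>n\<bar> \<le> 10 * \<bar>n2\<bar>"
        using abs_triangle_ineq[of "n1 + n3" n2] unfolding n_def by (simp add: algebra_simps)
      moreover have "\<bar>n1\<bar> \<le> \<bar>n3\<bar> + \<bar>n1 + n3\<bar>" by linarith
      ultimately show ?thesis using x max by auto
    qed
    then show "4 * \<bar>n\<bar> \<le> 5 * \<bar>n1\<bar>" "4 * \<bar>n\<bar> \<le> 5 * \<bar>n2\<bar>" "4 * \<bar>n\<bar> \<le> 5 * \<bar>n3\<bar>" by auto
  qed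
  show ?thesis
  \<comment> \<open>The largest of the three pair sums supplies \<open>W\<close>; the other two form
    the dominating pair.\<close>
  proof (cases rule: max3_cases[of "\<bar>n1 + n3\<bar>" "\<bar>n1 + n2\<bar>" "\<bar>n2 + n3\<bar>"])
    case 1
    have "dominating (n1 + n2 + n3) \<bar>real_of_int ((n2 + n3) * (n1 + n3) * (n1 + n2))\<bar> (jbr n1 * jbr n2 * jbr n3) (n2 + n3) (n1 + n3)"
      using 1 big nz by (intro dominating_comparable) (auto simp: n_def)
    then show ?thesis by (simp add: n_def h_def N_def algebra_simps)
  next
    case 2
    have "dominating (n1 + n3 + n2) \<bar>real_of_int ((n2 + n3) * (n1 + n2) * (n1 + n3))\<bar> (jbr n1 * jbr n3 * jbr n2) (n2 + n3) (n1 + n2)"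
      using 2 big nz by (intro dominating_comparable) (auto simp: n_def algebra_simps)
    then have "dominating n h N (n1 + n2) (n2 + n3)"
      by (subst dominating_commute) (simp add: n_def h_def N_def algebra_simps)
    then show ?thesis by simp
  next
    case 3
    have "dominating (n2 + n3 + n1) \<bar>real_of_int ((n1 + n3) * (n1 + n2) * (n2 + n3))\<bar> (jbr n2 * jbr n3 * jbr n1) (n1 + n3) (n1 + n2)"
      using 3 big nz by (intro dominating_comparable) (auto simp: n_def algebra_simps)
    then have "dominating n h N (n1 + n2) (n1 + n3)"
      by (subst dominating_commute) (simp add: n_def h_def N_def algebra_simps)
    then show ?thesis by simp
  qed
qed

text \<open>The statement is symmetric in \<open>j\<close>, \<open>k\<close> and
  \<open>l = n - j - k\<close>, so \<open>dominating_max\<close> is applied with the largest of them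
  in front; every pair it offers occurs in \<open>kernel_maps\<close>.\<close>

lemma dominating_exists:
  assumes nz: "j + k \<noteq> 0" "n - j \<noteq> 0" "n - k \<noteq> 0"
  shows "\<exists>i<9. case (kernel_maps n ! i) (j, k) of (u, v) \<Rightarrow>
    dominating n \<bar>real_of_int ((j + k) * (n - j) * (n - k))\<bar> (jbr j * jbr k * jbr (n - j - k)) u v"
proof -
  define l where "l = n - j - k"
  define D where "D = dominating n \<bar>real_of_int ((j + k) * (n - j) * (n - k))\<bar> (jbr j * jbr k * jbr (n - j - k))"
  have eqs: "n - j = k + l" "n - k = j + l" by (auto simp: l_def)
  have D1: "dominating (j + k + l) \<bar>real_of_int ((j + k) * (k + l) * (j + l))\<bar> (jbr j * jbr k * jbr l) = D"
    unfolding D_def l_def[symmetric] eqs by (simp add: l_def)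
  have D2: "dominating (k + j + l) \<bar>real_of_int ((k + j) * (j + l) * (k + l))\<bar> (jbr k * jbr j * jbr l) = D"
    unfolding D1[symmetric] by (simp only: ac_simps)
  have D3: "dominating (l + j + k) \<bar>real_of_int ((l + j) * (j + k) * (l + k))\<bar> (jbr l * jbr j * jbr k) = D"
    unfolding D1[symmetric] by (simp only: ac_simps)
  define Q where "Q \<longleftrightarrow> (\<exists>i<9. case (kernel_maps n ! i) (j, k) of (u, v) \<Rightarrow> D u v)"
  have I: Q if "i < 9" "D (fst ((kernel_maps n ! i) (j, k))) (snd ((kernel_maps n ! i) (j, k)))" for i
    using that unfolding Q_def by (intro exI[of _ i]) (simp add: case_prod_beta)
  have C: "D u v = D v u" for u v unfolding D_def by (rule dominating_commute)
  have "D (j + k) j \<or> D (j + k) k \<or> D (n - j) k \<or> D (n - j) (n - j - k) \<or> D (n - k) j \<or>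
    D (n - k) (n - j - k) \<or> D (j + k) (n - j) \<or> D (j + k) (n - k) \<or> D (n - j) (n - k)"
  proof (cases rule: max3_cases[of "\<bar>k\<bar>" "\<bar>j\<bar>" "\<bar>l\<bar>"])
    case 1
    then show ?thesis using dominating_max[of j k l, unfolded D1] nz
      unfolding eqs l_def[symmetric] by (auto simp: C add.commute)
  next
    case 2
    have "k + j = j + k" by simp
    then show ?thesis using 2 dominating_max[of k j l, unfolded D2] nz
      unfolding eqs l_def[symmetric] by (auto simp: C add.commute)
  next
    case 3
    have "l + j = j + l" "l + k = k + l" by simp_all
    then show ?thesis using 3 dominating_max[of l j k, unfolded D3] nz
      unfolding eqs l_def[symmetric] by (auto simp: C add.commute)
  qed
  then have Q
    using I[of 0, simplified kernel_maps_def, simplified] I[of 1, simplified kernel_maps_def, simplified]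
      I[of 2, simplified kernel_maps_def, simplified] I[of 3, simplified kernel_maps_def, simplified]
      I[of 4, simplified kernel_maps_def, simplified] I[of 5, simplified kernel_maps_def, simplified]
      I[of 6, simplified kernel_maps_def, simplified] I[of 7, simplified kernel_maps_def, simplified]
      I[of 8, simplified kernel_maps_def, simplified] by blast
  then show ?thesis by (simp add: Q_def D_def)
qed

text \<open>The derivative, the weights and the oscillatory gain of one interaction, without
  numerical constants. Since division by 0 yields 0, it vanishes on resonant pairs, and sums may run
  over all pairs.\<close>

definition kernel :: "real \<Rightarrow> int \<Rightarrow> int \<times> int \<Rightarrow> real" where
  "kernel s n = (\<lambda>(j, k). \<bar>real_of_int n\<bar> * jbr n powr s /
     (sqrt \<bar>real_of_int ((j + k) * (n - j) * (n - k))\<bar> * (jbr j * jbr k * jbr (n - j - k)) powr s))"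

lemma kernel_nonneg: "0 \<le> kernel s n jk"
  by (auto simp: kernel_def split: prod.split)

lemma kernel_le_dominating:
  assumes "s \<ge> 1/2" "dominating n h N u v" "h > 0" "N > 0"
  shows "\<bar>real_of_int n\<bar> * jbr n powr s / (sqrt h * N powr s) \<le> 2400 powr s * (jbr u * jbr v) powr - (s + 1/4)"
proof (cases "n = 0")
  case False
  define L m where "L = jbr u * jbr v" and "m = \<bar>real_of_int n\<bar>"
  have L: "L > 0" and m: "m > 0" using False jbr_pos by (auto simp: L_def m_def)
  obtain W where W: "W \<ge> 0" "L \<le> W\<^sup>2" "m ^ 3 * L * W \<le> 1200 * (h * N)" and 1: "m * L \<le> 1200 * N"
    using assms(2) by (auto simp: dominating_def L_def m_def)
  have "sqrt L \<le> W" using W by (simp add: real_le_lsqrt)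
  then have "m ^ 3 * L * sqrt L \<le> m ^ 3 * L * W" using L m by (intro mult_left_mono) auto
  then have "m ^ 3 * L * sqrt L \<le> 1200 * (h * N)" using W(3) by linarith
  moreover have "L powr (3/2) = L * sqrt L"
    using L powr_add[of L 1 "1/2"] by (simp add: powr_half_sqrt)
  ultimately have 2: "m powr 3 * L powr (3/2) \<le> 1200 * (h * N)"
    using m by (simp add: mult.assoc)
  have "m powr (1 + s) = m powr (3/2) * m powr (s - 1/2)" "L powr (s + 1/4) = L powr (3/4) * L powr (s - 1/2)"
    by (simp_all add: powr_add[symmetric] add.commute)
  moreover have "(m powr 3 * L powr (3/2)) powr (1/2) = m powr (3/2) * L powr (3/4)"
    using L m by (simp only: powr_mult powr_powr) simp
  ultimately have "m powr (1 + s) * L powr (s + 1/4) = (m powr 3 * L powr (3/2)) powr (1/2) * (m * L) powr (s - 1/2)"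
    using L m by (simp add: powr_mult)
  also have "\<dots> \<le> (1200 * (h * N)) powr (1/2) * (1200 * N) powr (s - 1/2)"
    by (rule mult_mono[OF powr_mono2 powr_mono2]) (use 1 2 L m assms in auto)
  also have "\<dots> = 1200 powr s * (sqrt h * N powr s)"
  proof -
    have "c powr s = c powr (1/2) * c powr (s - 1/2)" for c :: real
      by (simp add: powr_add[symmetric])
    from this[of 1200] this[of N] show ?thesis using assms by (simp add: powr_mult powr_half_sqrt)
  qed
  finally have 3: "m powr (1 + s) * L powr (s + 1/4) \<le> 1200 powr s * (sqrt h * N powr s)" .
  \<comment> \<open>Replacing the weight of \<open>n\<close> by a power of |n| costs
    \<open>2 powr s\<close>, which turns 1200 into 2400.\<close>
  have "m * jbr n powr s \<le> m * (2 * m) powr s"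
    using False jbr_le_twice[of n] jbr_pos[of n] assms m unfolding m_def by (intro mult_left_mono powr_mono2) auto
  also have "\<dots> = 2 powr s * m powr (1 + s)" using m by (simp add: powr_mult powr_add)
  also have "\<dots> = 2 powr s * (m powr (1 + s) * L powr (s + 1/4)) * L powr - (s + 1/4)"
    using L by (simp add: powr_minus field_simps)
  also have "\<dots> \<le> 2 powr s * (1200 powr s * (sqrt h * N powr s)) * L powr - (s + 1/4)"
    using 3 by (intro mult_right_mono mult_left_mono) auto
  also have "\<dots> = (2400 powr s * L powr - (s + 1/4)) * (sqrt h * N powr s)"
    using powr_mult[of 2 1200 s] by (simp add: algebra_simps)
  finally show ?thesis
    using assms unfolding L_def m_def by (subst pos_divide_le_eq) auto
qed simp

lemma kernel_le:
  assumes "s \<ge> 1/2"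
  shows "kernel s n jk \<le> 2400 powr s *
    (\<Sum>i<9. case (kernel_maps n ! i) jk of (u, v) \<Rightarrow> jbr u powr - (s + 1/4) * jbr v powr - (s + 1/4))"
proof -
  obtain j k where jk: "jk = (j, k)" by fastforce
  let ?g = "\<lambda>i. case (kernel_maps n ! i) jk of (u, v) \<Rightarrow> jbr u powr - (s + 1/4) * jbr v powr - (s + 1/4)"
  have g: "0 \<le> ?g i" for i by (auto split: prod.split)
  show ?thesis
  proof (cases "(j + k) * (n - j) * (n - k) = 0")
    case True
    then have "kernel s n jk = 0" unfolding jk kernel_def by (simp only: prod.case) simp
    then show ?thesis using g by (simp add: sum_nonneg)
  next
    case False
    then obtain i where i: "i < 9" "case (kernel_maps n ! i) (j, k) of (u, v) \<Rightarrow>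
        dominating n \<bar>real_of_int ((j + k) * (n - j) * (n - k))\<bar> (jbr j * jbr k * jbr (n - j - k)) u v"
      using dominating_exists[of j k n] by (metis mult_eq_0_iff)
    obtain u v where uv: "(kernel_maps n ! i) (j, k) = (u, v)" by fastforce
    have "kernel s n jk \<le> 2400 powr s * (jbr u * jbr v) powr - (s + 1/4)"
      using kernel_le_dominating[OF assms, of n _ _ u v] i(2) False jbr_pos unfolding jk kernel_def uv by simp
    also have "\<dots> = 2400 powr s * ?g i" using uv jk jbr_pos by (simp add: powr_mult less_imp_le)
    also have "\<dots> \<le> 2400 powr s * (\<Sum>i<9. ?g i)"
      using i g by (intro mult_left_mono member_le_sum) auto
    finally show ?thesis .
  qed
qed

lemma inj_kernel_maps: "i < 9 \<Longrightarrow> inj (kernel_maps n ! i)"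
proof -
  assume "i < 9"
  then have "i = 0 \<or> i = 1 \<or> i = 2 \<or> i = 3 \<or> i = 4 \<or> i = 5 \<or> i = 6 \<or> i = 7 \<or> i = 8" by linarith
  then show ?thesis unfolding kernel_maps_def by (elim disjE) (simp_all add: inj_def)
qed

text \<open>Uniformity in \<open>n\<close> comes from injectivity: each of the nine majorants is one
  fixed product family, composed with a map depending on \<open>n\<close>. The hypothesis relating
  \<open>s\<close> and \<open>p\<close> enters here, through \<open>lp_le_jbr\<close>.\<close>

lemma lp_le_kernel:
  assumes "s \<ge> 1/2" "1 \<le> p" "conj_exp p * ereal (s + 1/4) > 1"
  obtains \<kappa> where "\<And>n. lp_le (conj_exp p) (kernel s n) \<kappa>"
proof -
  note q = conj_exp_ge_1[OF assms(2)]
  obtain c where c: "lp_le (conj_exp p) (\<lambda>u. jbr u powr - (s + 1/4)) c"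
    using lp_le_jbr[OF q assms(3)] assms(1) by auto
  let ?g = "\<lambda>(u, v). jbr u powr - (s + 1/4) * jbr v powr - (s + 1/4)"
  have "lp_le (conj_exp p) (kernel s n) (2400 powr s * (\<Sum>i<(9::nat). c * c))" for n
  proof (rule lp_le_mono[OF q])
    show "lp_le (conj_exp p) (\<lambda>jk. 2400 powr s * (\<Sum>i<9. ?g ((kernel_maps n ! i) jk))) (2400 powr s * (\<Sum>i<(9::nat). c * c))"
      by (rule lp_le_scale[OF q lp_le_sum[OF q _ lp_le_inj[OF lp_le_prod[OF q c c] inj_kernel_maps]]]) simp_all
    show "kernel s n jk \<le> 2400 powr s * (\<Sum>i<9. ?g ((kernel_maps n ! i) jk))" for jk
      using kernel_le[OF assms(1)] by simp
  qed (auto intro: kernel_nonneg)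
  then show ?thesis using that by blast
qed

section \<open>The trilinear estimate\<close>

text \<open>Allows Hoelder's inequality on a finite set with the exact l^p norm over that set as
  bound, rather than a norm over all indices.\<close>

lemma lp_le_restrict:
  assumes "1 \<le> P" "finite F" "\<And>i. 0 \<le> X i"
  shows "lp_le (ereal P) (\<lambda>i. if i \<in> F then X i else 0) ((\<Sum>i\<in>F. X i powr P) powr (1 / P))"
proof -
  have "(\<Sum>i\<in>G. (if i \<in> F then X i else 0) powr P) \<le> (\<Sum>i\<in>F. X i powr P)" if "finite G" for G
  proof -
    have "(\<Sum>i\<in>G. (if i \<in> F then X i else 0) powr P) = (\<Sum>i\<in>G \<inter> F. X i powr P)"
      using that assms by (simp add: sum.inter_restrict if_distrib[of "\<lambda>x. x powr P"] cong: if_cong)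
    also have "\<dots> \<le> (\<Sum>i\<in>F. X i powr P)" using assms by (intro sum_mono2) auto
    finally show ?thesis .
  qed
  moreover have "((\<Sum>i\<in>F. X i powr P) powr (1 / P)) powr P = (\<Sum>i\<in>F. X i powr P)"
    using assms by (simp add: powr_powr sum_nonneg)
  ultimately show ?thesis using assms unfolding lp_le_real by auto
qed

definition convol3 :: "(int \<Rightarrow> real) \<Rightarrow> (int \<Rightarrow> real) \<Rightarrow> (int \<Rightarrow> real) \<Rightarrow> int \<Rightarrow> int \<times> int \<Rightarrow> real" where
  "convol3 A B C n = (\<lambda>(j, k). A j * B k * C (n - j - k))"

context
  fixes p :: ereal and K :: "int \<Rightarrow> int \<times> int \<Rightarrow> real" and \<kappa> \<alpha> \<beta> \<gamma> :: real and A B C :: "int \<Rightarrow> real"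
  assumes p: "1 \<le> p" and K: "\<And>n. lp_le (conj_exp p) (K n) \<kappa>"
    and A: "lp_le p A \<alpha>" and B: "lp_le p B \<beta>" and C: "lp_le p C \<gamma>"
begin

lemma lp_le_convol3: "lp_le p (convol3 A B C n) (\<alpha> * \<beta> * \<gamma>)"
proof (rule lp_le_mono[OF p])
  show "lp_le p (\<lambda>jk. \<gamma> * (case jk of (j, k) \<Rightarrow> A j * B k)) (\<gamma> * (\<alpha> * \<beta>))"
    by (rule lp_le_scale[OF p lp_le_prod[OF p A B] lp_le_bound_nonneg[OF C]])
  show "convol3 A B C n jk \<le> \<gamma> * (case jk of (j, k) \<Rightarrow> A j * B k)" for jk
    using lp_le_pointwise[OF p C] lp_le_nonneg[OF A] lp_le_nonneg[OF B]
    by (auto simp: convol3_def split: prod.split) (metis mult.commute mult_left_mono mult_nonneg_nonneg)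
  show "0 \<le> convol3 A B C n jk" for jk
    using lp_le_nonneg[OF A] lp_le_nonneg[OF B] lp_le_nonneg[OF C] by (auto simp: convol3_def split: prod.split)
qed simp

lemma sum_kernel_convol3_le:
  "finite F \<Longrightarrow> (\<Sum>jk\<in>F. K n jk * convol3 A B C n jk) \<le> \<kappa> * (\<alpha> * \<beta> * \<gamma>)"
  by (rule holder_lp_le[OF p K lp_le_convol3])

lemma kernel_convol3_nonneg: "0 \<le> K n jk * convol3 A B C n jk"
  using lp_le_nonneg[OF K] lp_le_nonneg[OF lp_le_convol3] by (rule mult_nonneg_nonneg)

lemma summable_kernel_convol3: "(\<lambda>jk. K n jk * convol3 A B C n jk) summable_on UNIV"
  by (rule nonneg_bounded_partial_sums_imp_summable_on[where C = "\<kappa> * (\<alpha> * \<beta> * \<gamma>)"])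
    (auto intro: kernel_convol3_nonneg sum_kernel_convol3_le eventually_finite_subsets_at_top_weakI)

text \<open>Hoelder in \<open>(j, k)\<close> at fixed \<open>n\<close> removes the kernel and leaves
  the l^p norm of the triple product. Its p-th power is then summed over \<open>n\<close> first: at
  fixed \<open>(j, k)\<close> this only sees a translate of \<open>C\<close>, so the three factors
  decouple.\<close>

lemma lp_le_sum_kernel_convol3:
  assumes F: "finite F"
  shows "lp_le p (\<lambda>n. \<Sum>jk\<in>F. K n jk * convol3 A B C n jk) (\<kappa> * (\<alpha> * \<beta> * \<gamma>))"
  using p
proof (cases rule: ereal_exponent_cases)
  case 1
  have "0 \<le> \<kappa> * (\<alpha> * \<beta> * \<gamma>)" using lp_le_bound_nonneg[OF K] lp_le_bound_nonneg[OF lp_le_convol3] by simp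
  then show ?thesis unfolding 1 lp_le_infinity
    using sum_kernel_convol3_le[OF F] kernel_convol3_nonneg by (auto intro: sum_nonneg)
next
  case (2 P)
  note nn = lp_le_nonneg[OF A] lp_le_nonneg[OF B] lp_le_nonneg[OF C] lp_le_nonneg[OF K] lp_le_nonneg[OF lp_le_convol3]
    lp_le_bound_nonneg[OF A] lp_le_bound_nonneg[OF B] lp_le_bound_nonneg[OF C] lp_le_bound_nonneg[OF K]
  have 1: "(\<Sum>jk\<in>F. K n jk * convol3 A B C n jk) powr P \<le> \<kappa> powr P * (\<Sum>jk\<in>F. convol3 A B C n jk powr P)" for n
  proof -
    have "(\<Sum>jk\<in>F. K n jk * convol3 A B C n jk) = (\<Sum>jk\<in>F. K n jk * (if jk \<in> F then convol3 A B C n jk else 0))"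
      by (intro sum.cong) auto
    also have "\<dots> \<le> \<kappa> * (\<Sum>jk\<in>F. convol3 A B C n jk powr P) powr (1 / P)"
      by (rule holder_lp_le[OF p K _ F], unfold \<open>p = ereal P\<close>, rule lp_le_restrict) (use 2 F nn in auto)
    finally have "(\<Sum>jk\<in>F. K n jk * convol3 A B C n jk) powr P
        \<le> (\<kappa> * (\<Sum>jk\<in>F. convol3 A B C n jk powr P) powr (1 / P)) powr P"
      using 2 nn by (intro powr_mono2) (auto intro: sum_nonneg)
    then show ?thesis using 2 nn by (simp add: powr_mult powr_powr sum_nonneg)
  qed
  have "(\<Sum>n\<in>G. (\<Sum>jk\<in>F. K n jk * convol3 A B C n jk) powr P) \<le> (\<kappa> * (\<alpha> * \<beta> * \<gamma>)) powr P" if G: "finite G" for G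
  proof -
    have C': "(\<Sum>n\<in>G. C (n - j - k) powr P) \<le> \<gamma> powr P" for j k
      using lp_le_inj[OF C, of "\<lambda>n. n - j - k"] G unfolding 2 by (auto simp: inj_def lp_le_real)
    have "(\<Sum>n\<in>G. (\<Sum>jk\<in>F. K n jk * convol3 A B C n jk) powr P) \<le> (\<Sum>n\<in>G. \<kappa> powr P * (\<Sum>jk\<in>F. convol3 A B C n jk powr P))"
      by (intro sum_mono 1)
    also have "\<dots> = \<kappa> powr P * (\<Sum>(j, k)\<in>F. A j powr P * B k powr P * (\<Sum>n\<in>G. C (n - j - k) powr P))"
      using nn by (simp add: sum_distrib_left[symmetric] sum.swap[of _ F G] convol3_def case_prod_beta powr_mult)
    also have "\<dots> \<le> \<kappa> powr P * (\<Sum>(j, k)\<in>F. A j powr P * B k powr P * \<gamma> powr P)"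
      using C' by (intro mult_left_mono sum_mono) (auto intro!: mult_left_mono split: prod.split)
    also have "\<dots> = \<kappa> powr P * ((\<Sum>(j, k)\<in>F. A j powr P * B k powr P) * \<gamma> powr P)"
      by (simp add: sum_distrib_right case_prod_beta)
    also have "\<dots> \<le> \<kappa> powr P * ((\<alpha> powr P * \<beta> powr P) * \<gamma> powr P)"
      using F A B unfolding 2 lp_le_real by (intro mult_left_mono mult_right_mono sum_product_le) auto
    finally show ?thesis using nn by (simp add: powr_mult)
  qed
  then show ?thesis unfolding 2 lp_le_real using nn by (auto intro!: sum_nonneg)
qed

lemma lp_le_infsum_kernel_convol3:
  "lp_le p (\<lambda>n. \<Sum>\<^sub>\<infinity>jk. K n jk * convol3 A B C n jk) (\<kappa> * (\<alpha> * \<beta> * \<gamma>))"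
proof (rule lp_le_limit[OF p, where F = "finite_subsets_at_top UNIV"])
  show "((\<lambda>F. \<Sum>jk\<in>F. K n jk * convol3 A B C n jk) \<longlongrightarrow> (\<Sum>\<^sub>\<infinity>jk. K n jk * convol3 A B C n jk)) (finite_subsets_at_top UNIV)" for n
    by (rule infsum_tendsto[OF summable_kernel_convol3])
  show "\<forall>\<^sub>F F in finite_subsets_at_top UNIV. lp_le p (\<lambda>n. \<Sum>jk\<in>F. K n jk * convol3 A B C n jk) (\<kappa> * (\<alpha> * \<beta> * \<gamma>))"
    by (rule eventually_finite_subsets_at_top_weakI) (rule lp_le_sum_kernel_convol3)
qed auto

end

section \<open>Hoelder continuity in time and oscillatory integrals\<close>

text \<open>A bound on a Hoelder-1/2 norm on \<open>{a..b}\<close>, made scale invariant by the time scale \<open>L\<close>.\<close>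

definition hoelder_le :: "real \<Rightarrow> real \<Rightarrow> real \<Rightarrow> (real \<Rightarrow> complex) \<Rightarrow> real \<Rightarrow> bool" where
  "hoelder_le a b L f G \<longleftrightarrow> 0 \<le> G \<and> (\<forall>t\<in>{a..b}. cmod (f t) \<le> G) \<and>
     (\<forall>t\<in>{a..b}. \<forall>t'\<in>{a..b}. cmod (f t - f t') \<le> G * sqrt (\<bar>t - t'\<bar> / L))"

lemma hbI:
  assumes "0 \<le> G" "\<And>t. t \<in> {a..b} \<Longrightarrow> cmod (f t) \<le> G"
    and "\<And>t t'. a \<le> t' \<Longrightarrow> t' \<le> t \<Longrightarrow> t \<le> b \<Longrightarrow> cmod (f t - f t') \<le> G * sqrt ((t - t') / L)"
  shows "hoelder_le a b L f G"
  unfolding hoelder_le_def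
proof (intro conjI ballI)
  fix t t' assume "t \<in> {a..b}" "t' \<in> {a..b}"
  then show "cmod (f t - f t') \<le> G * sqrt (\<bar>t - t'\<bar> / L)"
    using assms(3)[of t' t] assms(3)[of t t'] by (cases "t' \<le> t") (auto simp: norm_minus_commute abs_if)
qed (use assms in auto)

lemma hoelder_le_nonneg: "hoelder_le a b L f G \<Longrightarrow> 0 \<le> G"
  and hoelder_le_norm: "hoelder_le a b L f G \<Longrightarrow> t \<in> {a..b} \<Longrightarrow> cmod (f t) \<le> G"
  and hoelder_le_diff_le: "hoelder_le a b L f G \<Longrightarrow> t \<in> {a..b} \<Longrightarrow> t' \<in> {a..b} \<Longrightarrow> cmod (f t - f t') \<le> G * sqrt (\<bar>t - t'\<bar> / L)"
  by (auto simp: hoelder_le_def)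

lemma hoelder_le_mono:
  assumes "hoelder_le a b L f G" "G \<le> G'" "0 \<le> L" shows "hoelder_le a b L f G'"
  unfolding hoelder_le_def
proof (intro conjI ballI)
  fix t t' assume t: "t \<in> {a..b}" "t' \<in> {a..b}"
  have "cmod (f t - f t') \<le> G * sqrt (\<bar>t - t'\<bar> / L)" using assms t by (auto simp: hoelder_le_def)
  also have "\<dots> \<le> G' * sqrt (\<bar>t - t'\<bar> / L)" using assms by (intro mult_right_mono) auto
  finally show "cmod (f t - f t') \<le> G' * sqrt (\<bar>t - t'\<bar> / L)" .
qed (use assms in \<open>auto simp: hoelder_le_def intro: order_trans\<close>)

lemma hoelder_le_cong: "(\<And>t. t \<in> {a..b} \<Longrightarrow> f t = g t) \<Longrightarrow> hoelder_le a b L f G \<longleftrightarrow> hoelder_le a b L g G"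
  unfolding hoelder_le_def by auto

lemma hoelder_le_subinterval: "hoelder_le a b L f G \<Longrightarrow> a \<le> a' \<Longrightarrow> b' \<le> b \<Longrightarrow> hoelder_le a' b' L f G"
  unfolding hoelder_le_def by auto

lemma hoelder_le_shrink_scale:
  assumes "hoelder_le a b L f G" "0 < L'" "L' \<le> L" shows "hoelder_le a b L' f G"
  unfolding hoelder_le_def
proof (intro conjI ballI)
  fix t t' assume t: "t \<in> {a..b}" "t' \<in> {a..b}"
  have "cmod (f t - f t') \<le> G * sqrt (\<bar>t - t'\<bar> / L)" using assms t by (auto simp: hoelder_le_def)
  also have "\<dots> \<le> G * sqrt (\<bar>t - t'\<bar> / L')"
    using assms hoelder_le_nonneg[OF assms(1)] by (intro mult_left_mono real_sqrt_le_mono divide_left_mono) auto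
  finally show "cmod (f t - f t') \<le> G * sqrt (\<bar>t - t'\<bar> / L')" .
qed (use assms in \<open>auto simp: hoelder_le_def\<close>)

lemma hoelder_le_zero: "hoelder_le a b L (\<lambda>_. 0) 0"
  by (auto simp: hoelder_le_def)

lemma hoelder_le_const: "0 \<le> L \<Longrightarrow> hoelder_le a b L (\<lambda>_. c) (cmod c)"
  by (auto simp: hoelder_le_def)

lemma hoelder_le_add:
  assumes "hoelder_le a b L f G" "hoelder_le a b L g G'"
  shows "hoelder_le a b L (\<lambda>t. f t + g t) (G + G')"
  unfolding hoelder_le_def
proof (intro conjI ballI)
  fix t t' assume t: "t \<in> {a..b}" "t' \<in> {a..b}"
  have "cmod (f t + g t - (f t' + g t')) \<le> cmod (f t - f t') + cmod (g t - g t')"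
    by (metis add_diff_add norm_triangle_ineq)
  also have "\<dots> \<le> G * sqrt (\<bar>t - t'\<bar> / L) + G' * sqrt (\<bar>t - t'\<bar> / L)"
    using assms t by (auto simp: hoelder_le_def intro: add_mono)
  finally show "cmod (f t + g t - (f t' + g t')) \<le> (G + G') * sqrt (\<bar>t - t'\<bar> / L)"
    by (simp add: distrib_right)
qed (use assms in \<open>auto simp: hoelder_le_def intro!: order_trans[OF norm_triangle_ineq] add_mono\<close>)

lemma hoelder_le_cmult:
  assumes "hoelder_le a b L f G" shows "hoelder_le a b L (\<lambda>t. c * f t) (cmod c * G)"
  using assms unfolding hoelder_le_def
  by (auto simp: norm_mult right_diff_distrib[symmetric] mult.assoc intro: mult_left_mono)

lemma hoelder_le_uminus: "hoelder_le a b L f G \<Longrightarrow> hoelder_le a b L (\<lambda>t. - f t) G"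
  using hoelder_le_cmult[of a b L f G "-1"] by simp

lemma hoelder_le_diff: "hoelder_le a b L f G \<Longrightarrow> hoelder_le a b L g G' \<Longrightarrow> hoelder_le a b L (\<lambda>t. f t - g t) (G + G')"
  using hoelder_le_add[OF _ hoelder_le_uminus] by simp

lemma hoelder_le_mult:
  assumes f: "hoelder_le a b L f G" and g: "hoelder_le a b L g G'"
  shows "hoelder_le a b L (\<lambda>t. f t * g t) (2 * (G * G'))"
  unfolding hoelder_le_def
proof (intro conjI ballI)
  note nn = hoelder_le_nonneg[OF f] hoelder_le_nonneg[OF g]
  show "0 \<le> 2 * (G * G')" using nn by simp
  have "cmod (f t * g t) \<le> G * G'" if "t \<in> {a..b}" for t
    unfolding norm_mult using that f g by (intro mult_mono) (auto simp: hoelder_le_def)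
  then show "cmod (f t * g t) \<le> 2 * (G * G')" if "t \<in> {a..b}" for t
    using mult_nonneg_nonneg[OF nn] that by (smt (verit))
  fix t t' assume t: "t \<in> {a..b}" "t' \<in> {a..b}"
  have "cmod (f t * g t - f t' * g t') = cmod (f t * (g t - g t') + (f t - f t') * g t')"
    by (simp add: algebra_simps)
  also have "\<dots> \<le> cmod (f t) * cmod (g t - g t') + cmod (f t - f t') * cmod (g t')"
    by (metis norm_mult norm_triangle_ineq)
  also have "\<dots> \<le> G * (G' * sqrt (\<bar>t - t'\<bar> / L)) + (G * sqrt (\<bar>t - t'\<bar> / L)) * G'"
  proof -
    have "0 \<le> G * sqrt (\<bar>t - t'\<bar> / L)" using hoelder_le_diff_le[OF f t] norm_ge_zero order_trans by blast
    then show ?thesis using t f g nn by (intro add_mono mult_mono) (auto simp: hoelder_le_def)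
  qed
  finally show "cmod (f t * g t - f t' * g t') \<le> 2 * (G * G') * sqrt (\<bar>t - t'\<bar> / L)"
    by (simp add: algebra_simps)
qed

lemma hoelder_le_mult3:
  assumes "hoelder_le a b L f G" "hoelder_le a b L g G'" "hoelder_le a b L h G''"
  shows "hoelder_le a b L (\<lambda>t. f t * g t * h t) (4 * (G * G' * G''))"
  using hoelder_le_mult[OF hoelder_le_mult[OF assms(1,2)] assms(3)] by (simp add: mult.assoc)

lemma hoelder_le_continuous:
  assumes "hoelder_le a b L f G" "0 < L" shows "continuous_on {a..b} f"
proof (rule continuous_onI)
  fix x e :: real assume x: "x \<in> {a..b}" "0 < e"
  define d where "d = L * (e / (G + 1))\<^sup>2"
  have G: "0 \<le> G" using hoelder_le_nonneg[OF assms(1)] .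
  show "\<exists>d>0. \<forall>x'\<in>{a..b}. dist x' x < d \<longrightarrow> dist (f x') (f x) \<le> e"
  proof (intro exI conjI ballI impI)
    show "d > 0" using assms x G by (simp add: d_def)
    fix x' assume x': "x' \<in> {a..b}" "dist x' x < d"
    have "\<bar>x' - x\<bar> / L \<le> (e / (G + 1))\<^sup>2" using x' assms by (simp add: d_def dist_real_def field_simps)
    then have "sqrt (\<bar>x' - x\<bar> / L) \<le> e / (G + 1)" using x G by (simp add: real_le_lsqrt)
    then have "G * sqrt (\<bar>x' - x\<bar> / L) \<le> G * (e / (G + 1))" using G by (rule mult_left_mono)
    also have "\<dots> \<le> e" using G x by (simp add: field_simps)
    finally show "dist (f x') (f x) \<le> e"
      using hoelder_le_diff_le[OF assms(1) x'(1) x(1)] by (simp add: dist_norm)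
  qed
qed

lemma hoelder_le_limit:
  assumes "\<And>t. t \<in> {a..b} \<Longrightarrow> (\<lambda>k. f k t) \<longlonglongrightarrow> g t" "\<And>k::nat. hoelder_le a b L (f k) G"
  shows "hoelder_le a b L g G"
  unfolding hoelder_le_def
proof (intro conjI ballI)
  show "0 \<le> G" using hoelder_le_nonneg assms by blast
  show "cmod (g t) \<le> G" if "t \<in> {a..b}" for t
    by (rule Lim_bounded[OF tendsto_norm[OF assms(1)[OF that]], of 0]) (use assms that in \<open>auto simp: hoelder_le_def\<close>)
  show "cmod (g t - g t') \<le> G * sqrt (\<bar>t - t'\<bar> / L)" if "t \<in> {a..b}" "t' \<in> {a..b}" for t t'
    by (rule Lim_bounded[OF tendsto_norm[OF tendsto_diff[OF assms(1)[OF that(1)] assms(1)[OF that(2)]]], of 0])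
      (use assms that in \<open>auto simp: hoelder_le_def\<close>)
qed

lemma summable_on_diff:
  fixes f g :: "'i \<Rightarrow> 'a::real_normed_vector"
  assumes "f summable_on I" "g summable_on I"
  shows "(\<lambda>i. f i - g i) summable_on I"
  using summable_on_add[OF assms(1), of "\<lambda>i. - g i"] assms(2) by (simp add: summable_on_uminus)

lemma infsum_diff:
  fixes f g :: "'i \<Rightarrow> 'a::real_normed_vector"
  assumes "f summable_on I" "g summable_on I"
  shows "(\<Sum>\<^sub>\<infinity>i\<in>I. f i - g i) = (\<Sum>\<^sub>\<infinity>i\<in>I. f i) - (\<Sum>\<^sub>\<infinity>i\<in>I. g i)"
  using infsum_add[OF assms(1), of "\<lambda>i. - g i"] assms(2) by (simp add: summable_on_uminus infsum_uminus)

lemma hoelder_le_infsum: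
  assumes "\<And>i. i \<in> I \<Longrightarrow> hoelder_le a b L (f i) (G i)" "G summable_on I"
  shows "hoelder_le a b L (\<lambda>t. \<Sum>\<^sub>\<infinity>i\<in>I. f i t) (\<Sum>\<^sub>\<infinity>i\<in>I. G i)"
    and "t \<in> {a..b} \<Longrightarrow> (\<lambda>i. f i t) summable_on I"
proof -
  have sm: "(\<lambda>i. norm (f i t)) summable_on I" if "t \<in> {a..b}" for t
    by (rule summable_on_comparison_test[OF assms(2)]) (use assms(1) that in \<open>auto simp: hoelder_le_def\<close>)
  have sm': "(\<lambda>i. f i t) summable_on I" if "t \<in> {a..b}" for t by (rule Infinite_Sum.abs_summable_summable[OF sm[OF that]])
  show "t \<in> {a..b} \<Longrightarrow> (\<lambda>i. f i t) summable_on I" by (rule sm')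
  show "hoelder_le a b L (\<lambda>t. \<Sum>\<^sub>\<infinity>i\<in>I. f i t) (\<Sum>\<^sub>\<infinity>i\<in>I. G i)" unfolding hoelder_le_def
  proof (intro conjI ballI)
    show "0 \<le> (\<Sum>\<^sub>\<infinity>i\<in>I. G i)" using assms(1) by (intro infsum_nonneg) (auto simp: hoelder_le_def)
    show "cmod (\<Sum>\<^sub>\<infinity>i\<in>I. f i t) \<le> (\<Sum>\<^sub>\<infinity>i\<in>I. G i)" if "t \<in> {a..b}" for t
      by (rule norm_infsum_le[OF has_sum_infsum[OF Infinite_Sum.abs_summable_summable[OF sm[OF that]]] has_sum_infsum[OF assms(2)]])
        (use assms that in \<open>auto simp: hoelder_le_def\<close>)
    fix t t' assume t: "t \<in> {a..b}" "t' \<in> {a..b}"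
    have "(\<Sum>\<^sub>\<infinity>i\<in>I. f i t) - (\<Sum>\<^sub>\<infinity>i\<in>I. f i t') = (\<Sum>\<^sub>\<infinity>i\<in>I. f i t - f i t')"
      by (rule infsum_diff[OF sm'[OF t(1)] sm'[OF t(2)], symmetric])
    also have "cmod \<dots> \<le> (\<Sum>\<^sub>\<infinity>i\<in>I. G i * sqrt (\<bar>t - t'\<bar> / L))"
      by (rule norm_infsum_le[where f = "\<lambda>i. f i t - f i t'" and X = I and g = "\<lambda>i. G i * sqrt (\<bar>t - t'\<bar> / L)"])
        (use summable_on_diff[OF sm'[OF t(1)] sm'[OF t(2)]] t assms in \<open>auto simp: hoelder_le_def intro!: has_sum_infsum summable_on_cmult_left\<close>)
    also have "\<dots> = (\<Sum>\<^sub>\<infinity>i\<in>I. G i) * sqrt (\<bar>t - t'\<bar> / L)" by (rule infsum_cmult_left') 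
    finally show "cmod ((\<Sum>\<^sub>\<infinity>i\<in>I. f i t) - (\<Sum>\<^sub>\<infinity>i\<in>I. f i t')) \<le> (\<Sum>\<^sub>\<infinity>i\<in>I. G i) * sqrt (\<bar>t - t'\<bar> / L)" .
  qed
qed

text \<open>For the resonant term, which has no oscillation. The integral is even Lipschitz in time,
  and \<open>(t - t') / L\<close> is at most its own square root because it lies in the unit
  interval.\<close>

lemma hoelder_le_integral:
  assumes g: "hoelder_le a b L g G" and L: "0 < L" "b - a \<le> L"
  shows "hoelder_le a b L (\<lambda>t. integral {a..t} g) (L * G)"
proof (rule hbI)
  have G: "0 \<le> G" using hoelder_le_nonneg[OF g] .
  have cont: "continuous_on {a..b} g" using hoelder_le_continuous[OF g L(1)] .
  have bd: "cmod (integral {t'..t} g) \<le> G * (t - t')" if "a \<le> t'" "t' \<le> t" "t \<le> b" for t t'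
    using that by (intro integral_bound) (auto intro: continuous_on_subset[OF cont] hoelder_le_norm[OF g])
  show "0 \<le> L * G" using G L by simp
  show "cmod (integral {a..t} g) \<le> L * G" if "t \<in> {a..b}" for t
    using bd[of a t] that G L mult_left_mono[of "t - a" L G] by (auto simp: mult.commute)
  fix t t' assume t: "a \<le> t'" "t' \<le> t" "t \<le> b"
  have "integral {a..t} g - integral {a..t'} g = integral {t'..t} g"
    using Henstock_Kurzweil_Integration.integral_combine[of a t' t g] t
      integrable_continuous_real[OF continuous_on_subset[OF cont]] by (simp add: algebra_simps)
  then have "cmod (integral {a..t} g - integral {a..t'} g) \<le> G * (t - t')" using bd t by simp
  also have "\<dots> = L * G * ((t - t') / L)" using L by simp
  also have "\<dots> \<le> L * G * sqrt ((t - t') / L)"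
  proof (rule mult_left_mono)
    have "0 \<le> (t - t') / L" "(t - t') / L \<le> 1" using t L by auto
    then have "((t - t') / L)\<^sup>2 \<le> (t - t') / L" using mult_left_le[of "(t - t') / L" "(t - t') / L"] by (simp only: power2_eq_square)
    then show "(t - t') / L \<le> sqrt ((t - t') / L)" by (rule real_le_rsqrt)
  qed (use G L in simp)
  finally show "cmod (integral {a..t} g - integral {a..t'} g) \<le> L * G * sqrt ((t - t') / L)" .
qed

text \<open>Comparing the integrand with its translate by half a period \<open>\<pi>/\<bar>h\<bar>\<close>, which changes the sign of the
  exponential, gains \<open>\<bar>h\<bar>^(-1/2)\<close> from the Hoelder continuity of \<open>g\<close>.\<close>

lemma oscillatory_integral_le:
  assumes g: "hoelder_le a b L g G" and L: "0 < L" "b - a \<le> L" and h: "h \<noteq> 0"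
    and t: "a \<le> t'" "t' \<le> t" "t \<le> b"
  shows "cmod (integral {t'..t} (\<lambda>\<tau>. exp (\<i> * of_real (h * \<tau>)) * g \<tau>)) \<le> 3 * G * sqrt ((t - t') / \<bar>h\<bar>)"
proof -
  define \<eta> \<delta> where "\<eta> = pi / \<bar>h\<bar>" and "\<delta> = t - t'"
  define f where "f \<tau> = exp (\<i> * of_real (h * \<tau>)) * g \<tau>" for \<tau>
  have G: "0 \<le> G" using hoelder_le_nonneg[OF g] .
  have \<eta>: "\<eta> > 0" and \<delta>: "0 \<le> \<delta>" "\<delta> \<le> L" using h t L by (auto simp: \<eta>_def \<delta>_def)
  have contg: "continuous_on {a..b} g" using hoelder_le_continuous[OF g L(1)] .
  have cont: "continuous_on {x..y} f" if "a \<le> x" "y \<le> b" for x y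
    unfolding f_def using that by (intro continuous_intros continuous_on_subset[OF contg]) auto
  have fnorm: "cmod (f \<tau>) \<le> G" if "\<tau> \<in> {a..b}" for \<tau>
    using hoelder_le_norm[OF g that] by (simp add: f_def norm_mult)
  have bd: "cmod (integral {x..y} f) \<le> G * (y - x)" if "a \<le> x" "x \<le> y" "y \<le> b" for x y
    using that by (intro integral_bound cont) (auto intro: fnorm)
  have main: "cmod (integral {t'..t} f) \<le> 3/2 * G * sqrt (\<delta> * \<eta>)"
  proof (cases "\<delta> \<le> \<eta>")
    \<comment> \<open>On less than half a period there is no cancellation to exploit; the trivial
      bound is already good enough.\<close>
    case True
    have "cmod (integral {t'..t} f) \<le> G * \<delta>" using bd t by (simp add: \<delta>_def)
    also have "\<delta> = sqrt (\<delta> * \<delta>)" using \<delta> by simp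
    also have "\<dots> \<le> sqrt (\<delta> * \<eta>)" using \<delta> True by (intro real_sqrt_le_mono mult_left_mono) auto
    also have "G * sqrt (\<delta> * \<eta>) \<le> 3/2 * G * sqrt (\<delta> * \<eta>)"
      using G \<delta> \<eta> by (intro mult_right_mono) auto
    finally show ?thesis using G by (simp add: mult_left_mono)
  next
    case False
    then have tt: "t' + \<eta> \<le> t" "t' \<le> t - \<eta>" using \<eta> by (auto simp: \<delta>_def)
    have flip: "f (\<tau> + \<eta>) = - (exp (\<i> * of_real (h * \<tau>)) * g (\<tau> + \<eta>))" for \<tau>
    proof -
      have "h * \<eta> = pi \<or> h * \<eta> = - pi" using h by (auto simp: \<eta>_def abs_if)
      then have "exp (\<i> * of_real (h * \<eta>)) = - 1"
        using exp_pi_i' by (elim disjE) (simp_all add: exp_minus)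
      moreover have "\<i> * of_real (h * (\<tau> + \<eta>)) = \<i> * of_real (h * \<tau>) + \<i> * of_real (h * \<eta>)"
        by (simp add: algebra_simps)
      ultimately show ?thesis by (simp add: f_def exp_add)
    qed
    let ?I = "integral {t'..t} f" and ?J = "integral {t'..t - \<eta>} (\<lambda>\<tau>. f \<tau> + f (\<tau> + \<eta>))"
    have int: "f integrable_on {x..y}" if "a \<le> x" "y \<le> b" for x y
      by (rule integrable_continuous_real[OF cont[OF that]])
    have conts: "continuous_on {t'..t - \<eta>} (\<lambda>\<tau>. f (\<tau> + \<eta>))"
      by (rule continuous_on_compose2[OF cont[of "t' + \<eta>" t]]) (use t tt \<eta> in \<open>auto intro!: continuous_intros\<close>)
    have s: "integral {t'..t - \<eta>} (\<lambda>\<tau>. f (\<tau> + \<eta>)) = integral {t' + \<eta>..t} f"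
      using integral_shift_Icc_real[of t' "t - \<eta>" f \<eta>] by (simp add: o_def add.commute)
    have "?I = integral {t'..t' + \<eta>} f + integral {t' + \<eta>..t} f"
      using t tt \<eta> by (intro Henstock_Kurzweil_Integration.integral_combine[symmetric] int) auto
    moreover have "?I = integral {t'..t - \<eta>} f + integral {t - \<eta>..t} f"
      using t tt \<eta> by (intro Henstock_Kurzweil_Integration.integral_combine[symmetric] int) auto
    moreover have "?J = integral {t'..t - \<eta>} f + integral {t' + \<eta>..t} f"
      unfolding s[symmetric] using t \<eta> by (intro Henstock_Kurzweil_Integration.integral_add int integrable_continuous_real[OF conts]) auto
    \<comment> \<open>The integral plus its translate counts everything twice, except for one end
      piece of length \<eta> on either side.\<close>
    ultimately have "2 * ?I = ?J + integral {t'..t' + \<eta>} f + integral {t - \<eta>..t} f"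
      by (simp add: algebra_simps)
    then have "2 * cmod ?I = cmod (?J + integral {t'..t' + \<eta>} f + integral {t - \<eta>..t} f)"
      by (metis norm_mult norm_numeral)
    also have "\<dots> \<le> cmod ?J + cmod (integral {t'..t' + \<eta>} f) + cmod (integral {t - \<eta>..t} f)"
      by (intro norm_triangle_le add_mono order_refl)
    also have "cmod ?J \<le> G * sqrt (\<eta> / L) * (t - \<eta> - t')"
    proof (rule integral_bound)
      fix \<tau> assume \<tau>: "\<tau> \<in> {t'..t - \<eta>}"
      have "f \<tau> + f (\<tau> + \<eta>) = exp (\<i> * of_real (h * \<tau>)) * (g \<tau> - g (\<tau> + \<eta>))"
        unfolding flip by (simp add: f_def algebra_simps)
      then have "cmod (f \<tau> + f (\<tau> + \<eta>)) = cmod (g \<tau> - g (\<tau> + \<eta>))" by (simp add: norm_mult)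
      also have "\<dots> \<le> G * sqrt (\<eta> / L)" using hoelder_le_diff_le[OF g, of \<tau> "\<tau> + \<eta>"] \<tau> t \<eta> by simp
      finally show "cmod (f \<tau> + f (\<tau> + \<eta>)) \<le> G * sqrt (\<eta> / L)" .
    qed (use t tt \<eta> conts in \<open>auto intro!: continuous_intros cont\<close>)
    also have "cmod (integral {t'..t' + \<eta>} f) \<le> G * \<eta>" using bd[of t' "t' + \<eta>"] t tt \<eta> by simp
    also have "cmod (integral {t - \<eta>..t} f) \<le> G * \<eta>" using bd[of "t - \<eta>" t] t tt \<eta> by simp
    finally have 1: "2 * cmod ?I \<le> G * sqrt (\<eta> / L) * (t - \<eta> - t') + G * \<eta> + G * \<eta>" by simp
    \<comment> \<open>The length \<open>L\<close> of the time scale cancels because \<delta> \<le>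
      L. The three terms on the right of the bound for \<open>2 * cmod ?I\<close> are thus each at
      most \<open>G * sqrt (\<delta> * \<eta>)\<close>, which gives the factor 3/2.\<close>
    have "sqrt (\<eta> / L) * (t - \<eta> - t') \<le> sqrt (\<eta> / L) * \<delta>" using \<eta> L by (intro mult_left_mono) (auto simp: \<delta>_def)
    also have "\<dots> = sqrt (\<eta> / L * \<delta>\<^sup>2)" unfolding real_sqrt_mult using \<delta> by simp
    also have "\<dots> \<le> sqrt (\<delta> * \<eta>)"
      using \<delta> L \<eta> mult_left_mono[of \<delta> L "\<delta> * \<eta>"] by (intro real_sqrt_le_mono) (simp add: field_simps power2_eq_square)
    finally have 2: "sqrt (\<eta> / L) * (t - \<eta> - t') \<le> sqrt (\<delta> * \<eta>)" .
    have "\<eta> = sqrt (\<eta> * \<eta>)" using \<eta> by simp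
    also have "\<dots> \<le> sqrt (\<delta> * \<eta>)" using \<eta> False by (intro real_sqrt_le_mono mult_right_mono) auto
    finally have 3: "\<eta> \<le> sqrt (\<delta> * \<eta>)" .
    from 1 mult_left_mono[OF 2 G] mult_left_mono[OF 3 G] show ?thesis by (simp add: mult.assoc)
  qed
  also have "\<dots> = 3/2 * G * (sqrt pi * sqrt ((t - t') / \<bar>h\<bar>))"
    by (simp add: \<eta>_def \<delta>_def real_sqrt_mult[symmetric] mult.commute)
  also have "\<dots> \<le> 3/2 * G * (2 * sqrt ((t - t') / \<bar>h\<bar>))"
  proof -
    have "sqrt pi \<le> 2" using pi_less_4 by (intro real_le_lsqrt) auto
    then show ?thesis using G t by (intro mult_left_mono mult_right_mono) auto
  qed
  finally show ?thesis unfolding f_def by simp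
qed

lemma hoelder_le_oscillatory_integral:
  assumes g: "hoelder_le a b L g G" and L: "0 < L" "b - a \<le> L" and h: "h \<noteq> 0"
  shows "hoelder_le a b L (\<lambda>t. integral {a..t} (\<lambda>\<tau>. exp (\<i> * of_real (h * \<tau>)) * g \<tau>)) (3 * G * sqrt (L / \<bar>h\<bar>))"
proof (rule hbI)
  let ?f = "\<lambda>\<tau>. exp (\<i> * of_real (h * \<tau>)) * g \<tau>"
  have G: "0 \<le> G" using hoelder_le_nonneg[OF g] .
  then show "0 \<le> 3 * G * sqrt (L / \<bar>h\<bar>)" using L by simp
  show "cmod (integral {a..t} ?f) \<le> 3 * G * sqrt (L / \<bar>h\<bar>)" if "t \<in> {a..b}" for t
  proof -
    have "cmod (integral {a..t} ?f) \<le> 3 * G * sqrt ((t - a) / \<bar>h\<bar>)"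
      using oscillatory_integral_le[OF g L h, of a t] that by simp
    also have "\<dots> \<le> 3 * G * sqrt (L / \<bar>h\<bar>)"
      using that L G by (intro mult_left_mono real_sqrt_le_mono divide_right_mono) auto
    finally show ?thesis .
  qed
  fix t t' assume t: "a \<le> t'" "t' \<le> t" "t \<le> b"
  have cont: "continuous_on {a..t} ?f"
    using t by (intro continuous_intros continuous_on_subset[OF hoelder_le_continuous[OF g L(1)]]) auto
  have "integral {a..t} ?f - integral {a..t'} ?f = integral {t'..t} ?f"
    using Henstock_Kurzweil_Integration.integral_combine[of a t' t ?f] t integrable_continuous_real[OF cont]
    by (simp add: algebra_simps)
  then show "cmod (integral {a..t} ?f - integral {a..t'} ?f) \<le> 3 * G * sqrt (L / \<bar>h\<bar>) * sqrt ((t - t') / L)"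
    using oscillatory_integral_le[OF g L h t] L by (simp add: mult.assoc real_sqrt_mult[symmetric])
qed

section \<open>The Duhamel operator\<close>

lemma summable_on_divide:
  fixes f :: "'i \<Rightarrow> real"
  shows "f summable_on I \<Longrightarrow> (\<lambda>i. f i / c) summable_on I"
  using summable_on_cmult_left[of f I "1 / c"] by simp

text \<open>With \<open>l = n - j - k\<close> the resonance function is \<open>j^3 + k^3 + l^3 - n^3\<close>. The Duhamel operator is the
  time integral of the nonlinearity for \<open>a n t = exp (- \<i> n^3 t) * u n t\<close>, where \<open>u n t\<close> are the Fourier
  coefficients of the solution: symmetrising the derivative over \<open>j, k, l\<close> gives the factor \<open>n/3\<close>, and all
  resonant interactions except \<open>(n, n, -n)\<close> cancel. The sum is taken after the integration in time, since the
  unintegrated sum need not converge.\<close>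

definition resonance :: "int \<Rightarrow> int \<Rightarrow> int \<Rightarrow> real" where
  "resonance n j k = - 3 * real_of_int ((j + k) * (n - j) * (n - k))"

definition nonresonant :: "int \<Rightarrow> (int \<times> int) set" where
  "nonresonant n = {(j, k). j + k \<noteq> 0 \<and> n - j \<noteq> 0 \<and> n - k \<noteq> 0}"

definition resonant_part :: "real \<Rightarrow> (int \<Rightarrow> real \<Rightarrow> complex) \<Rightarrow> int \<Rightarrow> real \<Rightarrow> complex" where
  "resonant_part t0 a n t = integral {t0..t} (\<lambda>\<tau>. a n \<tau> * a n \<tau> * a (- n) \<tau>)"

definition interaction :: "real \<Rightarrow> (int \<Rightarrow> real \<Rightarrow> complex) \<Rightarrow> int \<Rightarrow> int \<times> int \<Rightarrow> real \<Rightarrow> complex" where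
  "interaction t0 a n = (\<lambda>(j, k) t. integral {t0..t} (\<lambda>\<tau>. exp (\<i> * of_real (resonance n j k * \<tau>)) *
     (a j \<tau> * a k \<tau> * a (n - j - k) \<tau>)))"

definition duhamel :: "real \<Rightarrow> (int \<Rightarrow> real \<Rightarrow> complex) \<Rightarrow> int \<Rightarrow> real \<Rightarrow> complex" where
  "duhamel t0 a n t = \<i> * of_int n * resonant_part t0 a n t
     - \<i> * of_int n / 3 * (\<Sum>\<^sub>\<infinity>jk\<in>nonresonant n. interaction t0 a n jk t)"

lemma jbr_nonzero [simp]: "jbr n \<noteq> 0" and jbr_positive [simp]: "0 < jbr n" and jbr_nonneg [simp]: "0 \<le> jbr n"
  using jbr_pos[of n] by auto

lemma duhamel_zero [simp]: "duhamel t0 (\<lambda>_ _. 0) n t = 0"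
  by (simp add: duhamel_def resonant_part_def interaction_def case_prod_beta)

section \<open>Weighted path spaces and the Lipschitz estimate for the Duhamel operator\<close>

locale mkdv_kernel =
  fixes s :: real and p :: ereal and \<kappa> :: real
  assumes s: "s \<ge> 1/2" and p: "1 \<le> p" and kernel: "\<And>n. lp_le (conj_exp p) (kernel s n) \<kappa>"
begin

abbreviation wt :: "int \<Rightarrow> real" where "wt n \<equiv> jbr n powr s"

lemma wt_pos [simp]: "0 < wt n" and wt_ge_1: "1 \<le> wt n" and wt_minus [simp]: "wt (- n) = wt n"
  using jbr_pos[of n] jbr_ge_1[of n] s by (auto simp: ge_one_powr_ge_zero)

lemma wt_nonneg [simp]: "0 \<le> wt n" by (simp add: less_imp_le)

text \<open>The resonant term carries a derivative but no oscillation; by s \<ge> 1/2 two of its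
  three weights absorb the derivative.\<close>

lemma frequency_le_wt_square: "\<bar>real_of_int n\<bar> \<le> wt n * wt n"
proof -
  have "\<bar>real_of_int n\<bar> \<le> jbr n powr 1" using abs_le_jbr jbr_pos[of n] by simp
  also have "\<dots> \<le> jbr n powr (s + s)" using s jbr_ge_1 by (intro powr_mono) auto
  finally show ?thesis by (simp only: powr_add)
qed

text \<open>The time norm sits inside the sequence norm: \<open>A\<close> is an envelope bounding
  the Hoelder norm of every coefficient separately. This lets the oscillatory integral be estimated
  one interaction at a time, each with its own resonance.\<close>

definition path_le :: "real \<Rightarrow> real \<Rightarrow> real \<Rightarrow> (int \<Rightarrow> real \<Rightarrow> complex) \<Rightarrow> real \<Rightarrow> bool" where
  "path_le a b L f C \<longleftrightarrow> (\<exists>A. lp_le p A C \<and> (\<forall>n. hoelder_le a b L (f n) (A n / wt n)))"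

lemma path_le_nonneg: "path_le a b L f C \<Longrightarrow> 0 \<le> C"
  by (auto simp: path_le_def dest: lp_le_bound_nonneg)

lemma path_le_mono: "path_le a b L f C \<Longrightarrow> C \<le> D \<Longrightarrow> path_le a b L f D"
  unfolding path_le_def by (elim exE conjE) (rule exI, rule conjI, rule lp_le_mono[OF p], auto dest: lp_le_nonneg)

lemma path_le_cong:
  assumes "\<And>n t. t \<in> {a..b} \<Longrightarrow> f n t = g n t" shows "path_le a b L f C \<longleftrightarrow> path_le a b L g C"
proof -
  have "hoelder_le a b L (f n) G \<longleftrightarrow> hoelder_le a b L (g n) G" for n G using assms by (intro hoelder_le_cong)
  then show ?thesis by (simp add: path_le_def)
qed

lemma path_le_add:
  assumes "path_le a b L f C" "path_le a b L g D" shows "path_le a b L (\<lambda>n t. f n t + g n t) (C + D)"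
proof -
  obtain A B where "lp_le p A C" "\<And>n. hoelder_le a b L (f n) (A n / wt n)" "lp_le p B D" "\<And>n. hoelder_le a b L (g n) (B n / wt n)"
    using assms by (auto simp: path_le_def)
  then have "lp_le p (\<lambda>n. A n + B n) (C + D)" "\<And>n. hoelder_le a b L (\<lambda>t. f n t + g n t) ((A n + B n) / wt n)"
    using hoelder_le_add by (auto simp: add_divide_distrib intro: lp_le_add[OF p])
  then show ?thesis unfolding path_le_def by (intro exI[of _ "\<lambda>n. A n + B n"]) auto
qed

lemma path_le_uminus: "path_le a b L f C \<Longrightarrow> path_le a b L (\<lambda>n t. - f n t) C"
  unfolding path_le_def using hoelder_le_uminus by blast

lemma path_le_diff: "path_le a b L f C \<Longrightarrow> path_le a b L g D \<Longrightarrow> path_le a b L (\<lambda>n t. f n t - g n t) (C + D)"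
  using path_le_add[OF _ path_le_uminus] by simp

lemma path_le_const: "0 \<le> L \<Longrightarrow> lp_le p (\<lambda>n. wt n * cmod (c n)) C \<Longrightarrow> path_le a b L (\<lambda>n t. c n) C"
  unfolding path_le_def by (rule exI[of _ "\<lambda>n. wt n * cmod (c n)"]) (auto simp: hoelder_le_const)

lemma path_le_subinterval: "path_le a b L f C \<Longrightarrow> a \<le> a' \<Longrightarrow> b' \<le> b \<Longrightarrow> path_le a' b' L f C"
  unfolding path_le_def using hoelder_le_subinterval by blast

lemma path_le_shrink_scale: "path_le a b L f C \<Longrightarrow> 0 < L' \<Longrightarrow> L' \<le> L \<Longrightarrow> path_le a b L' f C"
  unfolding path_le_def using hoelder_le_shrink_scale by blast

lemma path_le_lp_le:
  assumes "path_le a b L f C" "t \<in> {a..b}"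
  shows "lp_le p (\<lambda>n. wt n * cmod (f n t)) C"
proof -
  obtain A where A: "lp_le p A C" "\<And>n. hoelder_le a b L (f n) (A n / wt n)" using assms by (auto simp: path_le_def)
  have "wt n * cmod (f n t) \<le> A n" for n
    using hoelder_le_norm[OF A(2) assms(2), of n] by (simp add: field_simps)
  then show ?thesis by (intro lp_le_mono[OF p A(1)]) auto
qed

lemma path_le_norm_le:
  assumes "path_le a b L f C" "t \<in> {a..b}"
  shows "cmod (f n t) \<le> C"
proof -
  have "1 * cmod (f n t) \<le> wt n * cmod (f n t)" by (intro mult_right_mono wt_ge_1) auto
  also have "\<dots> \<le> C" using lp_le_pointwise[OF p path_le_lp_le[OF assms]] .
  finally show ?thesis by simp
qed

lemma path_le_continuous: "path_le a b L f C \<Longrightarrow> 0 < L \<Longrightarrow> continuous_on {a..b} (f n)"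
  unfolding path_le_def using hoelder_le_continuous by blast

lemma hoelder_le_triple_diff:
  assumes "hoelder_le a b L f1 F1" "hoelder_le a b L f2 F2" "hoelder_le a b L f3 F3"
    and "hoelder_le a b L g1 F1" "hoelder_le a b L g2 F2" "hoelder_le a b L g3 F3"
    and "hoelder_le a b L (\<lambda>t. f1 t - g1 t) D1" "hoelder_le a b L (\<lambda>t. f2 t - g2 t) D2" "hoelder_le a b L (\<lambda>t. f3 t - g3 t) D3"
  shows "hoelder_le a b L (\<lambda>t. f1 t * f2 t * f3 t - g1 t * g2 t * g3 t)
    (4 * (D1 * F2 * F3 + F1 * D2 * F3 + F1 * F2 * D3))"
proof -
  have "hoelder_le a b L (\<lambda>t. (f1 t - g1 t) * f2 t * f3 t + g1 t * (f2 t - g2 t) * f3 t + g1 t * g2 t * (f3 t - g3 t))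
    (4 * (D1 * F2 * F3) + 4 * (F1 * D2 * F3) + 4 * (F1 * F2 * D3))"
    using assms by (intro hoelder_le_add hoelder_le_mult3)
  then show ?thesis by (simp add: algebra_simps)
qed

text \<open>The majorant for a difference of two cubic terms: \<open>D\<close> bounds the difference
  and takes each of the three places in turn, while the common envelope \<open>A\<close> of both
  paths fills the other two.\<close>

definition interaction_bound :: "(int \<Rightarrow> real) \<Rightarrow> (int \<Rightarrow> real) \<Rightarrow> int \<Rightarrow> int \<times> int \<Rightarrow> real" where
  "interaction_bound A D n jk = kernel s n jk * (convol3 D A A n jk + convol3 A D A n jk + convol3 A A D n jk)"

context
  fixes a b L :: real
  assumes L: "0 < L" "L \<le> 1" "b - a \<le> L"
begin

lemma hoelder_le_resonant_diff:
  assumes f: "\<And>n. hoelder_le a b L (f n) (A n / wt n)" and g: "\<And>n. hoelder_le a b L (g n) (A n / wt n)"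
    and d: "\<And>n. hoelder_le a b L (\<lambda>t. f n t - g n t) (D n / wt n)"
  shows "hoelder_le a b L (\<lambda>t. resonant_part a f n t - resonant_part a g n t)
    (L * (4 * (D n * A n * A (- n) + A n * D n * A (- n) + A n * A n * D (- n))) / (wt n * wt n * wt n))"
proof -
  have "hoelder_le a b L (\<lambda>t. integral {a..t} (\<lambda>\<tau>. f n \<tau> * f n \<tau> * f (- n) \<tau> - g n \<tau> * g n \<tau> * g (- n) \<tau>))
    (L * (4 * (D n / wt n * (A n / wt n) * (A (- n) / wt (- n)) + A n / wt n * (D n / wt n) * (A (- n) / wt (- n))
      + A n / wt n * (A n / wt n) * (D (- n) / wt (- n)))))"
    by (intro hoelder_le_integral L hoelder_le_triple_diff f g d)
  also have "(L * (4 * (D n / wt n * (A n / wt n) * (A (- n) / wt (- n)) + A n / wt n * (D n / wt n) * (A (- n) / wt (- n))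
      + A n / wt n * (A n / wt n) * (D (- n) / wt (- n)))))
    = L * (4 * (D n * A n * A (- n) + A n * D n * A (- n) + A n * A n * D (- n))) / (wt n * wt n * wt n)"
    by (simp add: add_divide_distrib distrib_left)
  finally show ?thesis
  proof (rule iffD1[OF hoelder_le_cong, rotated])
    fix t assume t: "t \<in> {a..b}"
    have "continuous_on {a..t} (h n)" if "\<And>n. hoelder_le a b L (h n) (A n / wt n)" for h n
      by (rule continuous_on_subset[OF hoelder_le_continuous[OF that L(1)]]) (use t in auto)
    from this[OF f] this[OF g]
    show "integral {a..t} (\<lambda>\<tau>. f n \<tau> * f n \<tau> * f (- n) \<tau> - g n \<tau> * g n \<tau> * g (- n) \<tau>)
        = resonant_part a f n t - resonant_part a g n t"
      unfolding resonant_part_def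
      by (intro Henstock_Kurzweil_Integration.integral_diff integrable_continuous_real continuous_intros)
  qed
qed

text \<open>The 12 is 4 from the product of three Hoelder functions times 3 from the oscillatory
  integral. The factor \<open>n\<close> stays with the interaction, because \<open>kernel\<close>
  contains it; for \<open>n = 0\<close> the estimate says nothing about the interaction
  itself.\<close>

lemma hoelder_le_interaction_diff:
  assumes f: "\<And>n. hoelder_le a b L (f n) (A n / wt n)" and g: "\<And>n. hoelder_le a b L (g n) (A n / wt n)"
    and d: "\<And>n. hoelder_le a b L (\<lambda>t. f n t - g n t) (D n / wt n)"
    and jk: "jk \<in> nonresonant n"
  shows "hoelder_le a b L (\<lambda>t. of_int n * (interaction a f n jk t - interaction a g n jk t))
    (12 * sqrt L * interaction_bound A D n jk / wt n)"
proof -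
  obtain j k where [simp]: "jk = (j, k)" by fastforce
  define l where "l = n - j - k"
  define H where "H = \<bar>real_of_int ((j + k) * (n - j) * (n - k))\<bar>"
  have H: "H > 0" "\<bar>resonance n j k\<bar> = 3 * H" "resonance n j k \<noteq> 0"
    using jk unfolding H_def resonance_def nonresonant_def by (auto simp: abs_mult)
  define W where "W = wt j * wt k * wt l"
  define S where "S = D j * A k * A l + A j * D k * A l + A j * A k * D l"
  have W: "W > 0" by (simp add: W_def)
  have nn: "0 \<le> A m" "0 \<le> D m" for m
    using mult_nonneg_nonneg[OF hoelder_le_nonneg[OF f, of m], of "wt m"] mult_nonneg_nonneg[OF hoelder_le_nonneg[OF d, of m], of "wt m"]
    by simp_all
  then have S: "0 \<le> S" by (simp add: S_def)
  have "hoelder_le a b L (\<lambda>\<tau>. f j \<tau> * f k \<tau> * f l \<tau> - g j \<tau> * g k \<tau> * g l \<tau>)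
    (4 * (D j / wt j * (A k / wt k) * (A l / wt l) + A j / wt j * (D k / wt k) * (A l / wt l)
      + A j / wt j * (A k / wt k) * (D l / wt l)))"
    by (intro hoelder_le_triple_diff f g d)
  also have "4 * (D j / wt j * (A k / wt k) * (A l / wt l) + A j / wt j * (D k / wt k) * (A l / wt l)
      + A j / wt j * (A k / wt k) * (D l / wt l)) = 4 * S / W"
    by (simp add: S_def W_def add_divide_distrib)
  finally have "hoelder_le a b L (\<lambda>t. of_int n * integral {a..t} (\<lambda>\<tau>. exp (\<i> * of_real (resonance n j k * \<tau>)) *
      (f j \<tau> * f k \<tau> * f l \<tau> - g j \<tau> * g k \<tau> * g l \<tau>)))
    (cmod (of_int n) * (3 * (4 * S / W) * sqrt (L / \<bar>resonance n j k\<bar>)))"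
    by (intro hoelder_le_cmult hoelder_le_oscillatory_integral L H)
  then have "hoelder_le a b L (\<lambda>t. of_int n * (interaction a f n jk t - interaction a g n jk t))
    (cmod (of_int n) * (3 * (4 * S / W) * sqrt (L / \<bar>resonance n j k\<bar>)))"
  proof (rule iffD1[OF hoelder_le_cong, rotated])
    fix t assume t: "t \<in> {a..b}"
    have "continuous_on {a..t} (h n)" if "\<And>n. hoelder_le a b L (h n) (A n / wt n)" for h n
      by (rule continuous_on_subset[OF hoelder_le_continuous[OF that L(1)]]) (use t in auto)
    from this[OF f] this[OF g]
    have "integral {a..t} (\<lambda>\<tau>. exp (\<i> * of_real (resonance n j k * \<tau>)) *
        (f j \<tau> * f k \<tau> * f l \<tau> - g j \<tau> * g k \<tau> * g l \<tau>)) = interaction a f n jk t - interaction a g n jk t"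
      unfolding interaction_def l_def[symmetric] prod.case \<open>jk = (j, k)\<close> right_diff_distrib
      by (intro Henstock_Kurzweil_Integration.integral_diff integrable_continuous_real continuous_intros)
    then show "of_int n * integral {a..t} (\<lambda>\<tau>. exp (\<i> * of_real (resonance n j k * \<tau>)) *
        (f j \<tau> * f k \<tau> * f l \<tau> - g j \<tau> * g k \<tau> * g l \<tau>)) = of_int n * (interaction a f n jk t - interaction a g n jk t)"
      by simp
  qed
  then show ?thesis
  proof (rule hoelder_le_mono)
    \<comment> \<open>The resonance is 3 times \<open>H\<close> in modulus; the 3 is given away to
      match \<open>kernel\<close>.\<close>
    have "sqrt (L / \<bar>resonance n j k\<bar>) \<le> sqrt L / sqrt H"
      unfolding real_sqrt_divide[symmetric] using H L by (intro real_sqrt_le_mono divide_left_mono) auto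
    then have "cmod (of_int n) * (3 * (4 * S / W) * sqrt (L / \<bar>resonance n j k\<bar>))
        \<le> \<bar>real_of_int n\<bar> * (3 * (4 * S / W) * (sqrt L / sqrt H))"
      using S W unfolding norm_of_int by (intro mult_left_mono) auto
    also have "\<dots> = 12 * sqrt L * interaction_bound A D n jk / wt n"
      unfolding interaction_bound_def kernel_def convol3_def \<open>jk = (j, k)\<close> prod.case
        l_def[symmetric] H_def[symmetric] S_def[symmetric] W_def by (simp add: powr_mult mult_ac)
    finally show "cmod (of_int n) * (3 * (4 * S / W) * sqrt (L / \<bar>resonance n j k\<bar>)) \<le> \<dots>" .
  qed (use L in simp)
qed

lemma summable_interaction_bound:
  assumes "lp_le p A \<rho>" "lp_le p D \<delta>"
  shows "interaction_bound A D n summable_on UNIV"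
    and "lp_le p (\<lambda>n. \<Sum>\<^sub>\<infinity>jk. interaction_bound A D n jk) (3 * \<kappa> * \<rho>\<^sup>2 * \<delta>)"
proof -
  let ?f = "\<lambda>X Y Z n jk. kernel s n jk * convol3 X Y Z n jk"
  note sm = summable_kernel_convol3[where K = "kernel s", OF p kernel assms(2,1,1)] summable_kernel_convol3[where K = "kernel s", OF p kernel assms(1,2,1)]
    summable_kernel_convol3[where K = "kernel s", OF p kernel assms(1,1,2)]
  have eq: "interaction_bound A D n = (\<lambda>jk. ?f D A A n jk + ?f A D A n jk + ?f A A D n jk)" for n
    by (simp add: fun_eq_iff interaction_bound_def algebra_simps)
  show "interaction_bound A D n summable_on UNIV"
    unfolding eq by (intro summable_on_add sm)
  have sum: "(\<Sum>\<^sub>\<infinity>jk. interaction_bound A D n jk) = (\<Sum>\<^sub>\<infinity>jk. ?f D A A n jk) + (\<Sum>\<^sub>\<infinity>jk. ?f A D A n jk) + (\<Sum>\<^sub>\<infinity>jk. ?f A A D n jk)" for n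
    unfolding eq using sm by (simp add: infsum_add summable_on_add)
  have "lp_le p (\<lambda>n. (\<Sum>\<^sub>\<infinity>jk. ?f D A A n jk) + (\<Sum>\<^sub>\<infinity>jk. ?f A D A n jk) + (\<Sum>\<^sub>\<infinity>jk. ?f A A D n jk))
    (\<kappa> * (\<delta> * \<rho> * \<rho>) + \<kappa> * (\<rho> * \<delta> * \<rho>) + \<kappa> * (\<rho> * \<rho> * \<delta>))"
    by (intro lp_le_add[OF p] lp_le_infsum_kernel_convol3[where K = "kernel s", OF p kernel] assms)
  then show "lp_le p (\<lambda>n. \<Sum>\<^sub>\<infinity>jk. interaction_bound A D n jk) (3 * \<kappa> * \<rho>\<^sup>2 * \<delta>)"
    unfolding sum by (simp add: power2_eq_square algebra_simps)
qed

lemma interaction_bound_nonneg: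
  "(\<And>n. 0 \<le> A n) \<Longrightarrow> (\<And>n. 0 \<le> D n) \<Longrightarrow> 0 \<le> interaction_bound A D n jk"
  using kernel_nonneg by (auto simp: interaction_bound_def convol3_def split: prod.split)

lemma summable_interaction:
  assumes f: "\<And>n. hoelder_le a b L (f n) (A n / wt n)" and A: "lp_le p A \<rho>" and t: "t \<in> {a..b}"
  shows "(\<lambda>jk. of_int n * interaction a f n jk t) summable_on nonresonant n"
proof -
  have z: "hoelder_le a b L (\<lambda>_. 0) (A n / wt n)" for n
    using hoelder_le_zero by (rule hoelder_le_mono) (use lp_le_nonneg[OF A] L in auto)
  have "hoelder_le a b L (\<lambda>t. of_int n * (interaction a f n jk t - interaction a (\<lambda>_ _. 0) n jk t))
      (12 * sqrt L * interaction_bound A A n jk / wt n)" if "jk \<in> nonresonant n" for jk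
    by (rule hoelder_le_interaction_diff[OF f z _ that]) (simp add: f)
  moreover have "interaction a (\<lambda>_ _. 0) n jk t = 0" for jk t
    by (auto simp: interaction_def split: prod.split)
  ultimately have "hoelder_le a b L (\<lambda>t. of_int n * interaction a f n jk t)
      (12 * sqrt L * interaction_bound A A n jk / wt n)" if "jk \<in> nonresonant n" for jk
    using that by simp
  moreover have "(\<lambda>jk. 12 * sqrt L * interaction_bound A A n jk / wt n) summable_on nonresonant n"
    using summable_on_subset[OF summable_interaction_bound(1)[OF A A]]
    by (intro summable_on_cmult_right summable_on_divide) auto
  ultimately show ?thesis using t by (rule hoelder_le_infsum(2))
qed

lemma duhamel_diff:
  assumes f: "\<And>n. hoelder_le a b L (f n) (A n / wt n)" and g: "\<And>n. hoelder_le a b L (g n) (A n / wt n)"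
    and d: "\<And>n. hoelder_le a b L (\<lambda>t. f n t - g n t) (D n / wt n)"
    and A: "lp_le p A \<rho>" and D: "lp_le p D \<delta>"
  shows "path_le a b L (\<lambda>n t. duhamel a f n t - duhamel a g n t) (12 * (1 + \<kappa>) * sqrt L * \<rho>\<^sup>2 * \<delta>)"
proof -
  note nn = lp_le_nonneg[OF A] lp_le_nonneg[OF D] lp_le_bound_nonneg[OF A] lp_le_bound_nonneg[OF D] lp_le_bound_nonneg[OF kernel]
  \<comment> \<open>In the resonant part two factors are bounded pointwise by \<rho> and
    \<open>D\<close> keeps the sequence norm, once at \<open>- n\<close>. The 4 in \<open>M2\<close>
    is the 12 of the interactions divided by the 3 in \<open>duhamel\<close>.\<close>
  define M1 where "M1 n = 4 * L * \<rho>\<^sup>2 * (D n + D n + D (- n))" for n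
  define M2 where "M2 n = 4 * sqrt L * (\<Sum>\<^sub>\<infinity>jk. interaction_bound A D n jk)" for n
  have 1: "hoelder_le a b L (\<lambda>t. \<i> * of_int n * (resonant_part a f n t - resonant_part a g n t)) (M1 n / wt n)" for n
  proof (rule hoelder_le_mono[OF hoelder_le_cmult[OF hoelder_le_resonant_diff[OF f g d]]])
    have A': "A n \<le> \<rho>" for n using lp_le_pointwise[OF p A] .
    have "D n * A n * A (- n) + A n * D n * A (- n) + A n * A n * D (- n)
        \<le> D n * \<rho> * \<rho> + \<rho> * D n * \<rho> + \<rho> * \<rho> * D (- n)"
      using nn A' by (intro add_mono mult_mono mult_nonneg_nonneg add_nonneg_nonneg) auto
    also have "\<dots> = \<rho>\<^sup>2 * (D n + D n + D (- n))" by (simp add: power2_eq_square algebra_simps)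
    finally have "L * (4 * (D n * A n * A (- n) + A n * D n * A (- n) + A n * A n * D (- n))) \<le> M1 n"
      using L unfolding M1_def by (simp add: mult.assoc mult_left_mono)
    moreover have "0 \<le> L * (4 * (D n * A n * A (- n) + A n * D n * A (- n) + A n * A n * D (- n)))" 
      using nn L by (intro mult_nonneg_nonneg add_nonneg_nonneg) auto
    ultimately have "\<bar>real_of_int n\<bar> * (L * (4 * (D n * A n * A (- n) + A n * D n * A (- n) + A n * A n * D (- n))))
        \<le> (wt n * wt n) * M1 n"
      by (intro mult_mono frequency_le_wt_square) auto
    then have "\<bar>real_of_int n\<bar> * (L * (4 * (D n * A n * A (- n) + A n * D n * A (- n) + A n * A n * D (- n)))) / (wt n * wt n * wt n)
        \<le> (wt n * wt n) * M1 n / (wt n * wt n * wt n)"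
      by (rule divide_right_mono) simp
    then show "cmod (\<i> * of_int n) * (L * (4 * (D n * A n * A (- n) + A n * D n * A (- n) + A n * A n * D (- n))) / (wt n * wt n * wt n))
        \<le> M1 n / wt n"
      by (simp add: norm_mult)
  qed (use L in simp)
  have 2: "hoelder_le a b L (\<lambda>t. \<i> / 3 * (\<Sum>\<^sub>\<infinity>jk\<in>nonresonant n. of_int n * (interaction a f n jk t - interaction a g n jk t))) (M2 n / wt n)" for n
  proof (rule hoelder_le_mono[OF hoelder_le_cmult[OF hoelder_le_infsum(1)[OF hoelder_le_interaction_diff[OF f g d]]]])
    have sm: "interaction_bound A D n summable_on S" for S
      using summable_on_subset[OF summable_interaction_bound(1)[OF A D]] by auto
    show "(\<lambda>jk. 12 * sqrt L * interaction_bound A D n jk / wt n) summable_on nonresonant n"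
      using sm by (intro summable_on_cmult_right summable_on_divide)
    have "(\<Sum>\<^sub>\<infinity>jk\<in>nonresonant n. 12 * sqrt L * interaction_bound A D n jk / wt n)
      = 12 * sqrt L / wt n * (\<Sum>\<^sub>\<infinity>jk\<in>nonresonant n. interaction_bound A D n jk)"
      by (subst infsum_cmult_right'[symmetric]) simp
    also have "\<dots> \<le> 12 * sqrt L / wt n * (\<Sum>\<^sub>\<infinity>jk. interaction_bound A D n jk)"
      using sm L interaction_bound_nonneg nn by (intro mult_left_mono infsum_mono2) auto
    finally show "cmod (\<i> / 3) * (\<Sum>\<^sub>\<infinity>jk\<in>nonresonant n. 12 * sqrt L * interaction_bound A D n jk / wt n) \<le> M2 n / wt n"
      by (simp add: M2_def norm_divide)
  qed (use L in auto)
  have M: "lp_le p (\<lambda>n. M1 n + M2 n) (4 * L * \<rho>\<^sup>2 * (\<delta> + \<delta> + \<delta>) + 4 * sqrt L * (3 * \<kappa> * \<rho>\<^sup>2 * \<delta>))"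
    unfolding M1_def M2_def using L nn
    by (intro lp_le_add[OF p] lp_le_scale[OF p] D lp_le_inj[OF D, of uminus] summable_interaction_bound[OF A D]) (auto simp: inj_def)
  have M': "4 * L * \<rho>\<^sup>2 * (\<delta> + \<delta> + \<delta>) + 4 * sqrt L * (3 * \<kappa> * \<rho>\<^sup>2 * \<delta>) \<le> 12 * (1 + \<kappa>) * sqrt L * \<rho>\<^sup>2 * \<delta>"
  proof -
    \<comment> \<open>The resonant part gains a full factor \<open>L\<close>, the other only its
      root; L \<le> 1 brings both to the weaker one.\<close>
    have "L \<le> sqrt L" using L by (intro real_le_rsqrt) (simp add: power2_eq_square mult_left_le)
    then have "L * (12 * \<rho>\<^sup>2 * \<delta>) \<le> sqrt L * (12 * \<rho>\<^sup>2 * \<delta>)" using nn by (intro mult_right_mono) auto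
    then show ?thesis by (simp add: algebra_simps)
  qed
  have 3: "lp_le p (\<lambda>n. M1 n + M2 n) (12 * (1 + \<kappa>) * sqrt L * \<rho>\<^sup>2 * \<delta>)"
    by (rule lp_le_mono[OF p M lp_le_nonneg[OF M] order_refl M'])
  show ?thesis unfolding path_le_def
  proof (intro exI conjI allI)
    fix n
    have "hoelder_le a b L (\<lambda>t. \<i> * of_int n * (resonant_part a f n t - resonant_part a g n t) -
        \<i> / 3 * (\<Sum>\<^sub>\<infinity>jk\<in>nonresonant n. of_int n * (interaction a f n jk t - interaction a g n jk t))) (M1 n / wt n + M2 n / wt n)"
      by (rule hoelder_le_diff[OF 1 2])
    then show "hoelder_le a b L (\<lambda>t. duhamel a f n t - duhamel a g n t) ((M1 n + M2 n) / wt n)"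
      unfolding add_divide_distrib
    proof (rule iffD1[OF hoelder_le_cong, rotated])
      fix t assume t: "t \<in> {a..b}"
      have "(\<Sum>\<^sub>\<infinity>jk\<in>nonresonant n. of_int n * (interaction a f n jk t - interaction a g n jk t))
        = of_int n * (\<Sum>\<^sub>\<infinity>jk\<in>nonresonant n. interaction a f n jk t) - of_int n * (\<Sum>\<^sub>\<infinity>jk\<in>nonresonant n. interaction a g n jk t)"
        unfolding right_diff_distrib infsum_cmult_right'[symmetric]
        by (rule infsum_diff[OF summable_interaction[OF f A t] summable_interaction[OF g A t]])
      from arg_cong[OF this, of "\<lambda>x. \<i> / 3 * x"]
      show "\<i> * of_int n * (resonant_part a f n t - resonant_part a g n t) -
        \<i> / 3 * (\<Sum>\<^sub>\<infinity>jk\<in>nonresonant n. of_int n * (interaction a f n jk t - interaction a g n jk t)) = duhamel a f n t - duhamel a g n t"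
        unfolding duhamel_def by (simp only:) (simp add: algebra_simps)
    qed
  qed (rule 3)
qed

text \<open>The two paths come with different envelopes. Their sum is a common one, with bound
  \<open>\<rho> + \<rho>\<close>; squaring turns the 12 of \<open>duhamel_diff\<close> into
  48.\<close>

lemma path_le_duhamel_diff:
  assumes f: "path_le a b L f \<rho>" and g: "path_le a b L g \<rho>" and d: "path_le a b L (\<lambda>n t. f n t - g n t) \<delta>"
  shows "path_le a b L (\<lambda>n t. duhamel a f n t - duhamel a g n t) (48 * (1 + \<kappa>) * sqrt L * \<rho>\<^sup>2 * \<delta>)"
proof -
  obtain A where A: "lp_le p A \<rho>" "\<And>n. hoelder_le a b L (f n) (A n / wt n)" using f by (auto simp: path_le_def)
  obtain B where B: "lp_le p B \<rho>" "\<And>n. hoelder_le a b L (g n) (B n / wt n)" using g by (auto simp: path_le_def)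
  obtain D where D: "lp_le p D \<delta>" "\<And>n. hoelder_le a b L (\<lambda>t. f n t - g n t) (D n / wt n)" using d by (auto simp: path_le_def)
  have "path_le a b L (\<lambda>n t. duhamel a f n t - duhamel a g n t) (12 * (1 + \<kappa>) * sqrt L * (\<rho> + \<rho>)\<^sup>2 * \<delta>)"
  proof (rule duhamel_diff[OF _ _ D(2) lp_le_add[OF p A(1) B(1)] D(1)])
    show "hoelder_le a b L (f n) ((A n + B n) / wt n)" for n
      by (rule hoelder_le_mono[OF A(2)]) (use L lp_le_nonneg[OF B(1)] in \<open>auto simp: divide_right_mono\<close>)
    show "hoelder_le a b L (g n) ((A n + B n) / wt n)" for n
      by (rule hoelder_le_mono[OF B(2)]) (use L lp_le_nonneg[OF A(1)] in \<open>auto simp: divide_right_mono\<close>)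
  qed
  also have "12 * (1 + \<kappa>) * sqrt L * (\<rho> + \<rho>)\<^sup>2 * \<delta> = 48 * (1 + \<kappa>) * sqrt L * \<rho>\<^sup>2 * \<delta>"
    by (simp add: power2_eq_square algebra_simps)
  finally show ?thesis .
qed

lemma path_le_zero: "0 \<le> C \<Longrightarrow> path_le a b L (\<lambda>_ _. 0) C"
  using path_le_const[of L "\<lambda>_. 0" C a b] L lp_le_zero[OF p, of C] by simp

lemma path_le_duhamel:
  assumes "path_le a b L f \<rho>"
  shows "path_le a b L (duhamel a f) (48 * (1 + \<kappa>) * sqrt L * \<rho> ^ 3)"
  using path_le_duhamel_diff[of f \<rho> "\<lambda>_ _. 0" \<rho>] assms path_le_zero[OF path_le_nonneg[OF assms]]
  by (simp add: power3_eq_cube power2_eq_square mult.assoc)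

end

end

section \<open>Mild solutions\<close>

lemma duhamel_start [simp]: "duhamel t0 a n t0 = 0"
  by (simp add: duhamel_def resonant_part_def interaction_def case_prod_beta)

lemma infsum_nonresonant_minus:
  "(\<Sum>\<^sub>\<infinity>jk\<in>nonresonant (- n). g jk) = (\<Sum>\<^sub>\<infinity>(j, k)\<in>nonresonant n. g (- j, - k))"
  by (rule infsum_reindex_bij_witness[of _ "\<lambda>(j, k). (- j, - k)" "\<lambda>(j, k). (- j, - k)"])
    (auto simp: nonresonant_def)

lemma duhamel_cnj:
  assumes "\<And>n t. a (- n) t = cnj (a n t)"
  shows "duhamel t0 a (- n) t = cnj (duhamel t0 a n t)"
proof -
  have a: "cnj (a m \<tau>) = a (- m) \<tau>" for m \<tau> using assms by simp
  have "resonant_part t0 a (- n) t = cnj (resonant_part t0 a n t)"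
    unfolding resonant_part_def integral_cnj by (simp add: a)
  moreover have "interaction t0 a (- n) (- j, - k) t = cnj (interaction t0 a n (j, k) t)" for j k
  proof -
    have "resonance (- n) (- j) (- k) = - resonance n j k" by (simp add: resonance_def algebra_simps)
    then show ?thesis
      unfolding interaction_def prod.case integral_cnj by (simp add: a exp_cnj algebra_simps)
  qed
  then have "(\<Sum>\<^sub>\<infinity>jk\<in>nonresonant (- n). interaction t0 a (- n) jk t) = cnj (\<Sum>\<^sub>\<infinity>jk\<in>nonresonant n. interaction t0 a n jk t)"
    unfolding infsum_nonresonant_minus infsum_cnj[symmetric] by (intro infsum_cong) auto
  ultimately show ?thesis by (simp add: duhamel_def)
qed

definition mild :: "real \<Rightarrow> real \<Rightarrow> (int \<Rightarrow> complex) \<Rightarrow> (int \<Rightarrow> real \<Rightarrow> complex) \<Rightarrow> bool" where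
  "mild t0 T c a \<longleftrightarrow> (\<forall>n. \<forall>t\<in>{t0..T}. a n t = c n + duhamel t0 a n t)"

fun picard :: "(int \<Rightarrow> complex) \<Rightarrow> nat \<Rightarrow> int \<Rightarrow> real \<Rightarrow> complex" where
  "picard c 0 = (\<lambda>n t. c n)"
| "picard c (Suc k) = (\<lambda>n t. c n + duhamel 0 (picard c k) n t)"

lemma picard_cnj:
  assumes "real_coeffs c" shows "picard c k (- n) t = cnj (picard c k n t)"
  using assms by (induction k arbitrary: n t) (simp_all add: real_coeffs_def duhamel_cnj)

definition band_limited :: "int \<Rightarrow> (int \<Rightarrow> real \<Rightarrow> complex) \<Rightarrow> bool" where
  "band_limited N f \<longleftrightarrow> (\<forall>n t. N < \<bar>n\<bar> \<longrightarrow> f n t = 0)"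

lemma band_limited_duhamel:
  assumes "band_limited N f" "0 \<le> N" shows "band_limited (3 * N) (duhamel t0 f)"
  unfolding band_limited_def
proof (intro allI impI)
  fix n t assume n: "3 * N < \<bar>n\<bar>"
  have "f n \<tau> = 0" for \<tau> using assms n by (auto simp: band_limited_def)
  then have "resonant_part t0 f n t = 0" by (simp add: resonant_part_def)
  moreover have "interaction t0 f n (j, k) t = 0" for j k
  proof -
    have "N < \<bar>j\<bar> \<or> N < \<bar>k\<bar> \<or> N < \<bar>n - j - k\<bar>" using n by linarith
    then have "f j \<tau> * f k \<tau> * f (n - j - k) \<tau> = 0" for \<tau> using assms by (auto simp: band_limited_def)
    then show ?thesis unfolding interaction_def prod.case by (simp only: mult_zero_right integral_0)
  qed
  then have "(\<Sum>\<^sub>\<infinity>jk\<in>nonresonant n. interaction t0 f n jk t) = 0" by (intro infsum_0) auto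
  ultimately show "duhamel t0 f n t = 0" by (simp add: duhamel_def)
qed

lemma band_limited_add:
  "band_limited N f \<Longrightarrow> band_limited M g \<Longrightarrow> band_limited (max N M) (\<lambda>n t. f n t + g n t)"
  by (auto simp: band_limited_def)

section \<open>Existence, Lipschitz dependence, uniqueness and approximation of mild
  solutions\<close>

context mkdv_kernel
begin

text \<open>Completeness of the path space along geometrically convergent sequences. The limit is
  taken pointwise; the envelopes of the increments add up to an envelope of the remainder, whose
  bound follows from \<open>lp_le_limit\<close>.\<close>

lemma path_le_telescoping_limit:
  assumes R: "0 \<le> R" and f: "\<And>k. path_le a b L (\<lambda>n t. f (Suc k) n t - f k n t) (R / 2 ^ Suc k)" and L: "0 \<le> L"
  obtains g where "\<And>m. path_le a b L (\<lambda>n t. g n t - f m n t) (R / 2 ^ m)"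
proof -
  have "\<exists>D. lp_le p D (R / 2 ^ Suc k) \<and> (\<forall>n. hoelder_le a b L (\<lambda>t. f (Suc k) n t - f k n t) (D n / wt n))" for k
    using f[of k] by (auto simp: path_le_def)
  then obtain D where D: "\<And>k. lp_le p (D k) (R / 2 ^ Suc k)"
      "\<And>k n. hoelder_le a b L (\<lambda>t. f (Suc k) n t - f k n t) (D k n / wt n)"
    by metis
  define g where "g n t = lim (\<lambda>k. f k n t)" for n t
  have geo: "summable (\<lambda>k. R / 2 ^ Suc k)"
    using summable_mult[OF summable_geometric[of "1/2::real"], of "R / 2"] by (simp add: power_one_over field_simps)
  have lim: "(\<lambda>k. f k n t) \<longlonglongrightarrow> g n t" if t: "t \<in> {a..b}" for n t
  proof -
    have "summable (\<lambda>k. f (Suc k) n t - f k n t)"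
      by (rule summable_comparison_test'[OF geo, of 0]) (use path_le_norm_le[OF f t] in simp)
    then have "convergent (\<lambda>m. (\<Sum>k<m. f (Suc k) n t - f k n t) + f 0 n t)"
      by (intro convergent_add convergent_const) (simp add: summable_iff_convergent)
    then have "convergent (\<lambda>m. f m n t)" using sum_lessThan_telescope[of "\<lambda>k. f k n t"] by simp
    then show ?thesis by (simp add: g_def convergent_LIMSEQ_iff)
  qed
  have "path_le a b L (\<lambda>n t. g n t - f m n t) (R / 2 ^ m)" for m
  proof -
    have smD: "summable (\<lambda>i. D (i + m) n)" for n
    proof (rule summable_comparison_test'[OF summable_ignore_initial_segment[OF geo, of m], of 0])
      show "norm (D (i + m) n) \<le> R / 2 ^ Suc (i + m)" for i
        using lp_le_pointwise[OF p D(1)] lp_le_nonneg[OF D(1)] by simp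
    qed
    define S where "S n = (\<Sum>i. D (i + m) n)" for n
    have "lp_le p S (R / 2 ^ m)"
    proof (rule lp_le_limit[OF p, of sequentially])
      show "(\<lambda>j. \<Sum>i<j. D (i + m) n) \<longlonglongrightarrow> S n" for n
        unfolding S_def by (rule summable_LIMSEQ[OF smD])
      show "\<forall>\<^sub>F j in sequentially. lp_le p (\<lambda>n. \<Sum>i<j. D (i + m) n) (\<Sum>i<j. R / 2 ^ Suc (i + m))"
        by (intro always_eventually allI lp_le_sum[OF p] D) auto
      have "(\<Sum>i<j. R / 2 ^ Suc (i + m)) = R / 2 ^ m - R / 2 ^ m * (1/2) ^ j" for j
        by (induction j) (simp_all add: power_add power_one_over field_simps)
      moreover have "(\<lambda>j. R / 2 ^ m - R / 2 ^ m * (1/2) ^ j) \<longlonglongrightarrow> R / 2 ^ m - R / 2 ^ m * 0"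
        by (intro tendsto_intros LIMSEQ_realpow_zero) auto
      ultimately show "(\<lambda>j. \<Sum>i<j. R / 2 ^ Suc (i + m)) \<longlonglongrightarrow> R / 2 ^ m" by simp
    qed simp
    moreover have "hoelder_le a b L (\<lambda>t. g n t - f m n t) (S n / wt n)" for n
    proof (rule hoelder_le_limit)
      show "(\<lambda>j. f (j + m) n t - f m n t) \<longlonglongrightarrow> g n t - f m n t" if "t \<in> {a..b}" for t
        by (intro tendsto_diff tendsto_const LIMSEQ_ignore_initial_segment lim that)
      show "hoelder_le a b L (\<lambda>t. f (j + m) n t - f m n t) (S n / wt n)" for j
      proof (rule hoelder_le_mono)
        show "hoelder_le a b L (\<lambda>t. f (j + m) n t - f m n t) ((\<Sum>i<j. D (i + m) n) / wt n)"
        proof (induction j)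
          case 0
          then show ?case by (simp add: hoelder_le_zero)
        next
          case (Suc j)
          from hoelder_le_add[OF this D(2)[of "j + m" n]] show ?case by (simp add: add_divide_distrib)
        qed
        show "(\<Sum>i<j. D (i + m) n) / wt n \<le> S n / wt n"
          unfolding S_def using smD lp_le_nonneg[OF D(1)] by (intro divide_right_mono sum_le_suminf) auto
      qed (rule L)
    qed
    ultimately show ?thesis unfolding path_le_def by blast
  qed
  then show ?thesis using that by blast
qed

text \<open>Picard iteration in the ball of radius \<open>2 * R\<close>, where \<open>small\<close>
  makes the Duhamel operator a contraction with factor 1/4. The rate of convergence is kept in the
  conclusion because later properties, such as conjugation symmetry and approximability, are
  inherited from the iterates.\<close>

lemma exists_mild:
  assumes T: "0 < T" "T \<le> 1" and R: "0 < R" and small: "48 * (1 + \<kappa>) * sqrt T * (2 * R)\<^sup>2 \<le> 1/4"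
    and c: "lp_le p (\<lambda>n. wt n * cmod (c n)) R"
  shows "\<exists>a. mild 0 T c a \<and> path_le 0 T T a (2 * R) \<and> (\<forall>m. path_le 0 T T (\<lambda>n t. a n t - picard c m n t) (R / 2 ^ m))"
proof -
  have TT: "T - 0 \<le> T" by simp
  note dd = path_le_duhamel_diff[OF T TT]
  let ?q = "48 * (1 + \<kappa>) * sqrt T * (2 * R)\<^sup>2"
  have q: "0 \<le> ?q" using lp_le_bound_nonneg[OF kernel] T by simp
  have c': "path_le 0 T T (\<lambda>n t. c n) R" using c T by (intro path_le_const) auto
  have pic: "path_le 0 T T (picard c k) (2 * R)" for k
  proof (induction k)
    case 0
    then show ?case using path_le_mono[OF c'] R by simp
  next
    case (Suc k)
    have "48 * (1 + \<kappa>) * sqrt T * (2 * R) ^ 3 = ?q * (2 * R)" by (simp add: power3_eq_cube power2_eq_square)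
    also have "\<dots> \<le> 1/4 * (2 * R)" using small R by (intro mult_right_mono) auto
    finally have "R + 48 * (1 + \<kappa>) * sqrt T * (2 * R) ^ 3 \<le> 2 * R" using R by simp
    from path_le_mono[OF path_le_add[OF c' path_le_duhamel[OF T TT Suc]] this] show ?case by simp
  qed
  have diff: "path_le 0 T T (\<lambda>n t. picard c (Suc k) n t - picard c k n t) (R / 2 ^ Suc k)" for k
  proof (induction k)
    case 0
    \<comment> \<open>The first increment is the Duhamel term of the constant path, seen as a
      difference with that of the zero path.\<close>
    have "path_le 0 T T (\<lambda>n t. duhamel 0 (\<lambda>n t. c n) n t - duhamel 0 (\<lambda>_ _. 0) n t) (?q * R)"
      by (rule dd) (use path_le_mono[OF c', of "2 * R"] c' R path_le_zero[OF T TT] in auto)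
    moreover have "?q * R \<le> R / 2" using mult_right_mono[OF small, of R] R by simp
    ultimately show ?case using path_le_mono by simp
  next
    case (Suc k)
    have "path_le 0 T T (\<lambda>n t. duhamel 0 (picard c (Suc k)) n t - duhamel 0 (picard c k) n t) (?q * (R / 2 ^ Suc k))"
      by (rule dd[OF pic pic Suc])
    moreover have "?q * (R / 2 ^ Suc k) \<le> R / 2 ^ Suc (Suc k)"
    proof -
      have "?q * (R / 2 ^ Suc k) \<le> 1/2 * (R / 2 ^ Suc k)" using small R by (intro mult_right_mono) auto
      then show ?thesis by simp
    qed
    ultimately show ?case using path_le_mono by simp
  qed
  obtain a where a: "\<And>m. path_le 0 T T (\<lambda>n t. a n t - picard c m n t) (R / 2 ^ m)"
    using path_le_telescoping_limit[OF _ diff] R T by auto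
  have aR: "path_le 0 T T a (2 * R)"
    using path_le_add[OF a[of 0] c'] by simp
  have "a n t = c n + duhamel 0 a n t" if t: "t \<in> {0..T}" for n t
  proof -
    have "cmod (a n t - (c n + duhamel 0 a n t)) \<le> 2 * R * (1/2) ^ m" for m
    proof -
      have "path_le 0 T T (\<lambda>n t. (a n t - picard c (Suc m) n t) - (duhamel 0 a n t - duhamel 0 (picard c m) n t))
          (R / 2 ^ Suc m + ?q * (R / 2 ^ m))"
        by (rule path_le_diff[OF a dd[OF aR pic a]])
      from path_le_norm_le[OF this t, of n]
      have "cmod (a n t - (c n + duhamel 0 a n t)) \<le> R / 2 ^ Suc m + ?q * (R / 2 ^ m)" by (simp add: algebra_simps)
      also have "\<dots> \<le> R / 2 ^ Suc m + 1/4 * (R / 2 ^ m)" using small R by (intro add_left_mono mult_right_mono) auto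
      also have "\<dots> \<le> 2 * R * (1/2) ^ m" using R by (simp add: power_one_over field_simps)
      finally show ?thesis .
    qed
    moreover have "(\<lambda>m. 2 * R * (1/2) ^ m) \<longlonglongrightarrow> 2 * R * 0"
      by (intro tendsto_intros LIMSEQ_realpow_zero) auto
    ultimately have "cmod (a n t - (c n + duhamel 0 a n t)) \<le> 2 * R * 0"
      by (intro LIMSEQ_le_const) auto
    then show ?thesis by simp
  qed
  then show ?thesis using a aR unfolding mild_def by blast
qed

text \<open>Any bound whatsoever improves itself: iterating the step drives it to the fixed point
  \<open>2 * \<delta>\<close> of \<open>C \<mapsto> \<delta> + C / 2\<close>. The initial bound
  \<open>C0\<close> only has to be finite.\<close>

lemma path_le_contraction:
  assumes f: "path_le a b L f C0" and step: "\<And>C. path_le a b L f C \<Longrightarrow> path_le a b L f (\<delta> + C / 2)"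
    and t: "t \<in> {a..b}" and \<delta>: "0 \<le> \<delta>"
  shows "lp_le p (\<lambda>n. wt n * cmod (f n t)) (2 * \<delta>)"
proof (rule lp_le_bound_limit[OF p])
  have "path_le a b L f (2 * \<delta> + C0 * (1/2) ^ k)" for k
  proof (induction k)
    case 0
    then show ?case using path_le_mono[OF f] \<delta> by simp
  next
    case (Suc k)
    from step[OF this] show ?case by (simp add: add_divide_distrib)
  qed
  then show "lp_le p (\<lambda>n. wt n * cmod (f n t)) (2 * \<delta> + C0 * (1/2) ^ k)" for k
    using path_le_lp_le t by blast
  have "(\<lambda>k. 2 * \<delta> + C0 * (1/2) ^ k) \<longlonglongrightarrow> 2 * \<delta> + C0 * 0"
    by (intro tendsto_intros LIMSEQ_realpow_zero) auto
  then show "(\<lambda>k. 2 * \<delta> + C0 * (1/2) ^ k) \<longlonglongrightarrow> 2 * \<delta>" by simp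
qed

lemma mild_diff_le:
  assumes L: "0 < L" "L \<le> 1" "b - a \<le> L" and small: "48 * (1 + \<kappa>) * sqrt L * \<rho>\<^sup>2 \<le> 1/2"
    and f: "mild a b c f" "path_le a b L f \<rho>" and g: "mild a b d g" "path_le a b L g \<rho>"
    and cd: "lp_le p (\<lambda>n. wt n * cmod (c n - d n)) \<delta>" and t: "t \<in> {a..b}"
  shows "lp_le p (\<lambda>n. wt n * cmod (f n t - g n t)) (2 * \<delta>)"
proof (rule path_le_contraction[OF path_le_diff[OF f(2) g(2)] _ t lp_le_bound_nonneg[OF cd]])
  fix C assume C: "path_le a b L (\<lambda>n t. f n t - g n t) C"
  have "path_le a b L (\<lambda>n t. (c n - d n) + (duhamel a f n t - duhamel a g n t)) (\<delta> + 48 * (1 + \<kappa>) * sqrt L * \<rho>\<^sup>2 * C)"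
    using L cd by (intro path_le_add path_le_const path_le_duhamel_diff f g C) auto
  moreover have "48 * (1 + \<kappa>) * sqrt L * \<rho>\<^sup>2 * C \<le> C / 2"
    using mult_right_mono[OF small path_le_nonneg[OF C]] by simp
  ultimately have "path_le a b L (\<lambda>n t. (c n - d n) + (duhamel a f n t - duhamel a g n t)) (\<delta> + C / 2)"
    by (elim path_le_mono) simp
  then show "path_le a b L (\<lambda>n t. f n t - g n t) (\<delta> + C / 2)"
    by (rule iffD1[OF path_le_cong, rotated]) (use f(1) g(1) in \<open>simp add: mild_def\<close>)
qed

lemma duhamel_combine:
  assumes T: "0 < T" "T \<le> 1" and f: "path_le 0 T T f \<rho>" and t: "0 \<le> \<tau>" "\<tau> \<le> t" "t \<le> T"
  shows "duhamel 0 f n t = duhamel 0 f n \<tau> + duhamel \<tau> f n t"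
proof (cases "n = 0")
  \<comment> \<open>Summability of the interactions is known only after multiplication by
    \<open>n\<close>. At \<open>n = 0\<close> the whole operator vanishes.\<close>
  case True
  then show ?thesis by (simp add: duhamel_def)
next
  case False
  obtain A where A: "lp_le p A \<rho>" "\<And>n. hoelder_le 0 T T (f n) (A n / wt n)" using f by (auto simp: path_le_def)
  have cont: "continuous_on {0..t} (f n)" for n
    by (rule continuous_on_subset[OF path_le_continuous[OF f T(1)]]) (use t in auto)
  have "integral {0..\<tau>} h + integral {\<tau>..t} h = integral {0..t} h" if "continuous_on {0..t} h" for h :: "real \<Rightarrow> complex"
    using t by (intro Henstock_Kurzweil_Integration.integral_combine integrable_continuous_real that)
  note comb = this[symmetric]
  have 1: "resonant_part 0 f n t = resonant_part 0 f n \<tau> + resonant_part \<tau> f n t"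
    unfolding resonant_part_def by (intro comb continuous_intros cont)
  have 2: "interaction 0 f n jk t = interaction 0 f n jk \<tau> + interaction \<tau> f n jk t" for jk
    unfolding interaction_def case_prod_beta by (intro comb continuous_intros cont)
  have sm: "(\<lambda>jk. interaction 0 f n jk t') summable_on nonresonant n" if "t' \<in> {0..T}" for t'
    using summable_on_cmult_right[OF summable_interaction[OF T _ A(2,1) that, of n], of "1 / of_int n"] False by simp
  have 3: "(\<lambda>jk. interaction \<tau> f n jk t) summable_on nonresonant n"
    using summable_on_diff[OF sm[of t] sm[of \<tau>]] t by (simp add: 2)
  have "(\<Sum>\<^sub>\<infinity>jk\<in>nonresonant n. interaction 0 f n jk t)
      = (\<Sum>\<^sub>\<infinity>jk\<in>nonresonant n. interaction 0 f n jk \<tau>) + (\<Sum>\<^sub>\<infinity>jk\<in>nonresonant n. interaction \<tau> f n jk t)"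
    unfolding 2 using sm[of \<tau>] 3 t by (intro infsum_add) auto
  then show ?thesis unfolding duhamel_def 1 by (simp add: algebra_simps)
qed

text \<open>There is no smallness relation between \<rho> and \<open>T\<close>, so the contraction
  works only on short intervals. Their length \<eta> depends on \<rho> alone apart from the cap
  \<open>T\<close>, and agreement is propagated from each interval to the next by restarting the
  equation.\<close>

lemma mild_unique:
  assumes T: "0 < T" "T \<le> 1" and f: "mild 0 T c f" "path_le 0 T T f \<rho>" and g: "mild 0 T c g" "path_le 0 T T g \<rho>"
    and t: "t \<in> {0..T}"
  shows "f n t = g n t"
proof -
  \<comment> \<open>Up to the added 1 this is twice the Lipschitz constant with its time factor
    removed, so time steps of at most \<open>1 / B\<^sup>2\<close> give a contraction factor of at
    most 1/2.\<close>
  define B where "B = 96 * (1 + \<kappa>) * \<rho>\<^sup>2 + 1"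
  have B: "B \<ge> 1" using lp_le_bound_nonneg[OF kernel] by (simp add: B_def)
  define \<eta> where "\<eta> = min T (1 / B\<^sup>2)"
  have \<eta>: "0 < \<eta>" "\<eta> \<le> T" "\<eta> \<le> 1" using T B by (auto simp: \<eta>_def)
  have "sqrt \<eta> \<le> sqrt (1 / B\<^sup>2)" by (intro real_sqrt_le_mono) (simp add: \<eta>_def)
  also have "\<dots> = 1 / B" using B by (simp add: real_sqrt_divide)
  finally have "sqrt \<eta> * (2 * (48 * (1 + \<kappa>) * \<rho>\<^sup>2)) \<le> 1 / B * B"
  proof (rule mult_mono)
    show "2 * (48 * (1 + \<kappa>) * \<rho>\<^sup>2) \<le> B" by (simp add: B_def algebra_simps)
  qed (use B lp_le_bound_nonneg[OF kernel] in auto)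
  then have small: "48 * (1 + \<kappa>) * sqrt \<eta> * \<rho>\<^sup>2 \<le> 1/2" using B by (simp add: algebra_simps)
  have "\<forall>n. \<forall>t\<in>{0..T}. t \<le> real k * \<eta> \<longrightarrow> f n t = g n t" for k
  proof (induction k)
    case 0
    have "f n 0 = g n 0" for n using f(1) g(1) T by (simp add: mild_def)
    then show ?case by (auto dest: antisym)
  next
    case (Suc k)
    show ?case
    proof (intro allI ballI impI)
      fix n t assume t: "t \<in> {0..T}" "t \<le> real (Suc k) * \<eta>"
      show "f n t = g n t"
      proof (cases "t \<le> real k * \<eta>")
        case True
        then show ?thesis using Suc t by blast
      next
        case False
        define \<tau> \<beta> where "\<tau> = real k * \<eta>" and "\<beta> = min T (\<tau> + \<eta>)"
        have \<tau>: "0 \<le> \<tau>" "\<tau> \<le> T" "\<beta> \<le> T" "\<beta> - \<tau> \<le> \<eta>" "t \<in> {\<tau>..\<beta>}"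
          using t False \<eta> by (auto simp: \<tau>_def \<beta>_def algebra_simps)
        have mild: "mild \<tau> \<beta> (\<lambda>n. h n \<tau>) h" if "mild 0 T c h" "path_le 0 T T h \<rho>" for h
          unfolding mild_def
        proof (intro allI ballI)
          fix n t assume "t \<in> {\<tau>..\<beta>}"
          then have "duhamel 0 h n t = duhamel 0 h n \<tau> + duhamel \<tau> h n t"
            using \<tau> by (intro duhamel_combine[OF T that(2)]) auto
          moreover have "h n t = c n + duhamel 0 h n t" "h n \<tau> = c n + duhamel 0 h n \<tau>"
            using \<open>t \<in> {\<tau>..\<beta>}\<close> \<tau> that(1) by (auto simp: mild_def)
          ultimately show "h n t = h n \<tau> + duhamel \<tau> h n t" by simp
        qed
        have path_le: "path_le \<tau> \<beta> \<eta> h \<rho>" if "path_le 0 T T h \<rho>" for h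
          using path_le_subinterval[OF path_le_shrink_scale[OF that \<eta>(1,2)]] \<tau> by simp
        have "f n \<tau> = g n \<tau>" for n using Suc \<tau> by (auto simp: \<tau>_def)
        then have "lp_le p (\<lambda>n. wt n * cmod (f n \<tau> - g n \<tau>)) 0" using lp_le_zero[OF p order_refl] by simp
        from mild_diff_le[OF \<eta>(1,3) \<tau>(4) small mild[OF f] path_le[OF f(2)] mild[OF g] path_le[OF g(2)] this \<tau>(5)]
        have "wt n * cmod (f n t - g n t) \<le> 0" using lp_le_pointwise[OF p] by fastforce
        then show ?thesis by (simp add: mult_le_0_iff)
      qed
    qed
  qed
  moreover obtain k where "t / \<eta> \<le> real k" using real_arch_simple by blast
  then have "t \<le> real k * \<eta>" using \<eta> by (simp add: field_simps)
  ultimately show ?thesis using t by blast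
qed

text \<open>Closure of the band-limited functions; for \<open>p = \<infinity>\<close> this is strictly smaller than the whole space.\<close>

definition approximable :: "real \<Rightarrow> real \<Rightarrow> real \<Rightarrow> (int \<Rightarrow> real \<Rightarrow> complex) \<Rightarrow> bool" where
  "approximable a b L f \<longleftrightarrow>
     (\<forall>e>0. \<exists>v N C. 0 \<le> N \<and> band_limited N v \<and> path_le a b L v C \<and> path_le a b L (\<lambda>n t. f n t - v n t) e)"

text \<open>The operator maps band-limited paths to band-limited paths, with three times the band,
  and is Lipschitz on balls; hence it preserves their closure.\<close>

lemma approximable_duhamel:
  assumes L: "0 < L" "L \<le> 1" "b - a \<le> L" and f: "approximable a b L f" "path_le a b L f \<rho>"
  shows "approximable a b L (duhamel a f)"
  unfolding approximable_def
proof (intro allI impI)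
  fix e :: real assume e: "e > 0"
  have \<rho>: "0 \<le> \<rho>" using path_le_nonneg[OF f(2)] .
  define q where "q = 48 * (1 + \<kappa>) * sqrt L * (\<rho> + 1)\<^sup>2"
  have q: "0 \<le> q" using lp_le_bound_nonneg[OF kernel] L by (simp add: q_def)
  \<comment> \<open>The cap 1 keeps the approximating path in the ball of radius
    \<open>\<rho> + 1\<close>, on which \<open>q\<close> is a Lipschitz constant.\<close>
  define e' where "e' = min 1 (e / (q + 1))"
  have e': "0 < e'" "e' \<le> 1" "q * e' \<le> e"
  proof -
    show "0 < e'" "e' \<le> 1" using e q by (auto simp: e'_def)
    have "q * e' \<le> (q + 1) * (e / (q + 1))" using q e by (intro mult_mono) (auto simp: e'_def)
    then show "q * e' \<le> e" using q by simp
  qed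
  then obtain v N C where v: "0 \<le> N" "band_limited N v" "path_le a b L (\<lambda>n t. f n t - v n t) e'"
    using f(1) unfolding approximable_def by blast
  have "path_le a b L v (\<rho> + e')" using path_le_diff[OF f(2) v(3)] by simp
  then have v': "path_le a b L v (\<rho> + 1)" using e' path_le_mono by auto
  have f': "path_le a b L f (\<rho> + 1)" using f(2) path_le_mono by auto
  have "path_le a b L (\<lambda>n t. duhamel a f n t - duhamel a v n t) e"
    using path_le_mono[OF path_le_duhamel_diff[OF L f' v' v(3)]] e' by (simp add: q_def)
  then show "\<exists>w M C. 0 \<le> M \<and> band_limited M w \<and> path_le a b L w C \<and> path_le a b L (\<lambda>n t. duhamel a f n t - w n t) e"
    using band_limited_duhamel[OF v(2,1)] path_le_duhamel[OF L v'] v(1)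
    by (intro exI[of _ "duhamel a v"] exI[of _ "3 * N"] exI conjI) auto
qed

lemma approximable_add:
  assumes "approximable a b L f" "approximable a b L g"
  shows "approximable a b L (\<lambda>n t. f n t + g n t)"
  unfolding approximable_def
proof (intro allI impI)
  fix e :: real assume e: "e > 0"
  obtain v N C where v: "0 \<le> N" "band_limited N v" "path_le a b L v C" "path_le a b L (\<lambda>n t. f n t - v n t) (e / 2)"
    using assms(1) e unfolding approximable_def by (meson half_gt_zero)
  obtain w M D where w: "0 \<le> M" "band_limited M w" "path_le a b L w D" "path_le a b L (\<lambda>n t. g n t - w n t) (e / 2)"
    using assms(2) e unfolding approximable_def by (meson half_gt_zero)
  have "path_le a b L (\<lambda>n t. f n t + g n t - (v n t + w n t)) e"
    using path_le_add[OF v(4) w(4)] by (simp add: algebra_simps)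
  then show "\<exists>u N C. 0 \<le> N \<and> band_limited N u \<and> path_le a b L u C \<and> path_le a b L (\<lambda>n t. f n t + g n t - u n t) e"
    using band_limited_add[OF v(2) w(2)] path_le_add[OF v(3) w(3)] v(1)
    by (intro exI[of _ "\<lambda>n t. v n t + w n t"] exI[of _ "max N M"] exI conjI) auto
qed

lemma approximable_limit:
  assumes "\<And>e. e > 0 \<Longrightarrow> \<exists>g. approximable a b L g \<and> path_le a b L (\<lambda>n t. f n t - g n t) e"
  shows "approximable a b L f"
  unfolding approximable_def
proof (intro allI impI)
  fix e :: real assume e: "e > 0"
  then obtain g where g: "approximable a b L g" "path_le a b L (\<lambda>n t. f n t - g n t) (e / 2)"
    using assms by (meson half_gt_zero)
  obtain v N C where v: "0 \<le> N" "band_limited N v" "path_le a b L v C" "path_le a b L (\<lambda>n t. g n t - v n t) (e / 2)"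
    using g(1) e unfolding approximable_def by (meson half_gt_zero)
  have "path_le a b L (\<lambda>n t. f n t - v n t) e" using path_le_add[OF g(2) v(4)] by simp
  then show "\<exists>v N C. 0 \<le> N \<and> band_limited N v \<and> path_le a b L v C \<and> path_le a b L (\<lambda>n t. f n t - v n t) e"
    using v by blast
qed

lemma lp_le_finite_support:
  assumes "finite F" "\<And>i. 0 \<le> X i" "\<And>i. i \<notin> F \<Longrightarrow> X i = 0"
  shows "lp_le p X (\<Sum>i\<in>F. X i)"
proof -
  have single: "lp_le p (\<lambda>i. if i = k then X k else 0) (X k)" for k
    using p
  proof (cases rule: ereal_exponent_cases)
    case 1
    then show ?thesis using assms(2) by (auto simp: lp_le_infinity)
  next
    case (2 P)
    have "(\<Sum>i\<in>G. (if i = k then X k else 0) powr P) \<le> X k powr P" if "finite G" for G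
      using that by (cases "k \<in> G") (auto simp: if_distrib[of "\<lambda>x. x powr P"] cong: if_cong)
    then show ?thesis using 2 assms(2) by (auto simp: lp_le_real)
  qed
  have "X = (\<lambda>i. \<Sum>k\<in>F. if i = k then X k else 0)"
    using assms by (auto simp: fun_eq_iff)
  then show ?thesis using lp_le_sum[OF p assms(1), of "\<lambda>k i. if i = k then X k else 0" X] single by simp
qed

text \<open>The phases are not equicontinuous in \<open>n\<close>. After approximation only finitely
  many frequencies move, where continuity is elementary; the error at the two times is not enlarged,
  since the phases have modulus 1. This accounts for the three parts of \<open>e\<close>.\<close>

lemma approximable_flow_continuous:
  assumes f: "approximable a b L f" and L: "0 < L" and t0: "t0 \<in> {a..b}" and e: "e > 0"
  shows "\<exists>d>0. \<forall>t\<in>{a..b}. \<bar>t - t0\<bar> < d \<longrightarrow>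
    lp_le p (\<lambda>n. wt n * cmod (cis (real_of_int n ^ 3 * t) * f n t - cis (real_of_int n ^ 3 * t0) * f n t0)) e"
proof -
  let ?u = "\<lambda>f n t. cis (real_of_int n ^ 3 * t) * f n t"
  obtain v N C where v: "0 \<le> N" "band_limited N v" "path_le a b L v C" "path_le a b L (\<lambda>n t. f n t - v n t) (e / 3)"
    using f e unfolding approximable_def by (meson zero_less_divide_iff zero_less_numeral)
  let ?S = "\<lambda>t. \<Sum>n\<in>{-N..N}. wt n * cmod (?u v n t - ?u v n t0)"
  have cv: "continuous_on {a..b} (v n)" for n by (rule path_le_continuous[OF v(3) L])
  have "continuous_on {a..b} (\<lambda>t. wt n * cmod (?u v n t - ?u v n t0))" for n
    using cv[of n] by (intro continuous_on_mult_left continuous_on_norm continuous_on_diff continuous_on_const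
        continuous_on_mult continuous_on_cis continuous_on_id)
  then have cS: "continuous_on {a..b} ?S" by (rule continuous_on_sum)
  have "e / 3 > 0" using e by simp
  then have "\<exists>d>0. \<forall>t\<in>{a..b}. dist t t0 < d \<longrightarrow> dist (?S t) (?S t0) < e / 3"
    using cS[unfolded continuous_on_iff] t0 by blast
  then obtain d where d: "d > 0" "\<And>t. t \<in> {a..b} \<Longrightarrow> \<bar>t - t0\<bar> < d \<Longrightarrow> \<bar>?S t\<bar> < e / 3"
    by (auto simp: dist_real_def)
  show ?thesis
  proof (intro exI[of _ d] conjI ballI impI d)
    fix t assume t: "t \<in> {a..b}" "\<bar>t - t0\<bar> < d"
    have "lp_le p (\<lambda>n. wt n * cmod (?u v n t - ?u v n t0)) (?S t)"
      by (rule lp_le_finite_support) (use v(2) in \<open>auto simp: band_limited_def\<close>)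
    from lp_le_add[OF p lp_le_add[OF p path_le_lp_le[OF v(4) t(1)] path_le_lp_le[OF v(4) t0]] this]
    show "lp_le p (\<lambda>n. wt n * cmod (?u f n t - ?u f n t0)) e"
    proof (rule lp_le_mono[OF p])
      fix n
      have "?u f n t - ?u f n t0 = cis (real_of_int n ^ 3 * t) * (f n t - v n t)
          - cis (real_of_int n ^ 3 * t0) * (f n t0 - v n t0) + (?u v n t - ?u v n t0)"
        by (simp add: algebra_simps)
      also have "cmod \<dots> \<le> cmod (f n t - v n t) + cmod (f n t0 - v n t0) + cmod (?u v n t - ?u v n t0)"
      proof -
        have "cmod (x - y + z) \<le> cmod x + cmod y + cmod z" for x y z
          using norm_triangle_ineq[of "x - y" z] norm_triangle_ineq4[of x y] by linarith
        from this[of "cis (real_of_int n ^ 3 * t) * (f n t - v n t)" "cis (real_of_int n ^ 3 * t0) * (f n t0 - v n t0)"]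
        show ?thesis by (simp add: norm_mult)
      qed
      finally show "wt n * cmod (?u f n t - ?u f n t0)
          \<le> wt n * cmod (f n t - v n t) + wt n * cmod (f n t0 - v n t0) + wt n * cmod (?u v n t - ?u v n t0)"
        unfolding distrib_left[symmetric] by (rule mult_left_mono) simp
    qed (use d(2)[OF t] in auto)
  qed
qed

text \<open>Approximability passes from the constant path through all Picard iterates and then to
  their limit. The bound needed for each iterate is taken from that of \<open>a\<close>.\<close>

lemma approximable_mild:
  assumes T: "0 < T" "T \<le> 1" and c: "approximable 0 T T (\<lambda>n t. c n)"
    and a: "\<And>m. path_le 0 T T (\<lambda>n t. a n t - picard c m n t) (R / 2 ^ m)" "path_le 0 T T a \<rho>"
  shows "approximable 0 T T a"
proof (rule approximable_limit)
  have pic: "approximable 0 T T (picard c m)" for m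
  proof (induction m)
    case (Suc m)
    have "path_le 0 T T (picard c m) (\<rho> + R / 2 ^ m)" using path_le_diff[OF a(2) a(1)[of m]] by simp
    then show ?case using T Suc by (auto intro!: approximable_add c approximable_duhamel)
  qed (simp add: c)
  fix e :: real assume "e > 0"
  have "(\<lambda>m. R * (1/2) ^ m) \<longlonglongrightarrow> R * 0" by (intro tendsto_intros LIMSEQ_realpow_zero) auto
  then have "\<forall>\<^sub>F m in sequentially. R * (1/2) ^ m < e" using \<open>e > 0\<close> by (intro order_tendstoD) auto
  then obtain m where "R / 2 ^ m < e" by (auto simp: eventually_sequentially power_one_over)
  then have "path_le 0 T T (\<lambda>n t. a n t - picard c m n t) e" using path_le_mono[OF a(1)] by simp
  then show "\<exists>g. approximable 0 T T g \<and> path_le 0 T T (\<lambda>n t. a n t - g n t) e" using pic by blast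
qed

lemma mild_cnj:
  assumes "\<And>m. path_le 0 T T (\<lambda>n t. a n t - picard c m n t) (R / 2 ^ m)" "real_coeffs c" "t \<in> {0..T}"
  shows "a (- n) t = cnj (a n t)"
proof -
  have "cmod (a (- n) t - cnj (a n t)) \<le> 2 * R * (1/2) ^ m" for m
  proof -
    have "a (- n) t - cnj (a n t) = (a (- n) t - picard c m (- n) t) - cnj (a n t - picard c m n t)"
      using picard_cnj[OF assms(2)] by simp
    also have "cmod \<dots> \<le> cmod (a (- n) t - picard c m (- n) t) + cmod (cnj (a n t - picard c m n t))"
      by (rule norm_triangle_ineq4)
    also have "\<dots> \<le> R / 2 ^ m + R / 2 ^ m"
      unfolding complex_mod_cnj by (intro add_mono path_le_norm_le[OF assms(1,3)])
    finally show ?thesis by (simp add: power_one_over)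
  qed
  moreover have "(\<lambda>m. 2 * R * (1/2) ^ m) \<longlonglongrightarrow> 2 * R * 0"
    by (intro tendsto_intros LIMSEQ_realpow_zero) auto
  ultimately have "cmod (a (- n) t - cnj (a n t)) \<le> 2 * R * 0"
    by (intro LIMSEQ_le_const) auto
  then show ?thesis by simp
qed

end

section \<open>Fourier coefficients of products\<close>

definition character :: "int \<Rightarrow> real \<Rightarrow> complex" where
  "character k x = exp (\<i> * of_int k * of_real x)"

definition fourier :: "(real \<Rightarrow> complex) \<Rightarrow> int \<Rightarrow> complex" where
  "fourier g n = integral {0..2*pi} (\<lambda>x. g x * character (- n) x) / of_real (2*pi)"

lemma fcoef_eq_fourier: "fcoef f = fourier (\<lambda>x. of_real (f x))"
  by (simp add: fun_eq_iff fcoef_def fourier_def character_def)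

lemma character_add: "character (j + k) x = character j x * character k x"
  by (simp add: character_def exp_add[symmetric] algebra_simps)

lemma character_0 [simp]: "character 0 x = 1"
  by (simp add: character_def)

lemma norm_character [simp]: "cmod (character k x) = 1"
  by (simp add: character_def)

lemma character_periodic [simp]: "character k (2 * pi) = 1" "character k 0 = 1"
proof -
  show "character k (2 * pi) = 1"
    using exp_integer_2pi[of "of_int k"] by (simp add: character_def algebra_simps)
qed (simp add: character_def)

lemma character_derivative:
  "(character k has_vector_derivative \<i> * of_int k * character k x) (at x within S)"
proof -
  have "((\<lambda>z. exp (\<i> * of_int k * z)) has_field_derivative \<i> * of_int k * exp (\<i> * of_int k * of_real x)) (at (of_real x))"
    by (auto intro!: derivative_eq_intros)
  from has_vector_derivative_real_field[OF this] show ?thesis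
    unfolding character_def by (simp add: has_vector_derivative_at_within)
qed

lemma continuous_on_character [continuous_intros]: "continuous_on S (character k)"
  using character_derivative by (rule continuous_on_vector_derivative)

lemma continuous_on_character' [continuous_intros]:
  "continuous_on S f \<Longrightarrow> continuous_on S (\<lambda>x. character k (f x))"
  by (rule continuous_on_compose2[OF continuous_on_character]) auto

lemma fourier_integrable:
  "continuous_on {0..2*pi} g \<Longrightarrow> (\<lambda>x. g x * character k x) integrable_on {0..2*pi}"
  by (intro integrable_continuous_real continuous_intros)

lemma norm_fourier_le:
  assumes "continuous_on {0..2*pi} g" "\<And>x. x \<in> {0..2*pi} \<Longrightarrow> cmod (g x) \<le> B"
  shows "cmod (fourier g n) \<le> B"
proof -
  have "cmod (integral {0..2*pi} (\<lambda>x. g x * character (- n) x)) \<le> B * (2 * pi - 0)"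
    using assms by (intro integral_bound continuous_intros) (auto simp: norm_mult)
  then show ?thesis by (simp add: fourier_def norm_divide field_simps)
qed

lemma fourier_add:
  assumes "continuous_on {0..2*pi} f" "continuous_on {0..2*pi} g"
  shows "fourier (\<lambda>x. f x + g x) n = fourier f n + fourier g n"
  using Henstock_Kurzweil_Integration.integral_add[OF fourier_integrable[OF assms(1)] fourier_integrable[OF assms(2)]]
  by (simp add: fourier_def distrib_right add_divide_distrib)

lemma fourier_cmult: "fourier (\<lambda>x. c * f x) n = c * fourier f n"
  by (simp add: fourier_def mult.assoc)

lemma fourier_diff:
  assumes "continuous_on {0..2*pi} f" "continuous_on {0..2*pi} g"
  shows "fourier (\<lambda>x. f x - g x) n = fourier f n - fourier g n"
  using Henstock_Kurzweil_Integration.integral_diff[OF fourier_integrable[OF assms(1)] fourier_integrable[OF assms(2)]]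
  by (simp add: fourier_def left_diff_distrib diff_divide_distrib)

lemma fourier_minus: "fourier (\<lambda>x. - f x) n = - fourier f n"
  using fourier_cmult[of "-1" f] by simp

lemma fourier_modulate: "fourier (\<lambda>x. character k x * h x) n = fourier h (n - k)"
proof -
  have "(\<lambda>x. character k x * h x * character (- n) x) = (\<lambda>x. h x * character (- (n - k)) x)"
    using character_add[of k "- n"] by (simp add: fun_eq_iff)
  then show ?thesis by (simp only: fourier_def)
qed

lemma fourier_cong: "(\<And>x. x \<in> {0..2*pi} \<Longrightarrow> f x = g x) \<Longrightarrow> fourier f n = fourier g n"
  unfolding fourier_def by (intro arg_cong2[where f = "(/)"] Henstock_Kurzweil_Integration.integral_cong) auto

lemma fourier_derivative:
  assumes g: "\<And>x. (g has_vector_derivative g' x) (at x)" and g': "continuous_on {0..2*pi} g'"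
    and per: "g (2 * pi) = g 0"
  shows "fourier g' n = \<i> * of_int n * fourier g n"
proof -
  have cont: "continuous_on {0..2*pi} g"
    using g by (auto intro!: continuous_at_imp_continuous_on dest: has_vector_derivative_continuous)
  have "((\<lambda>x. g x * (\<i> * of_int (- n) * character (- n) x) + g' x * character (- n) x) has_integral
      g (2 * pi) * character (- n) (2 * pi) - g 0 * character (- n) 0) {0..2*pi}"
  proof (rule fundamental_theorem_of_calculus)
    fix x :: real assume "x \<in> {0..2*pi}"
    show "((\<lambda>x. g x * character (- n) x) has_vector_derivative
        g x * (\<i> * of_int (- n) * character (- n) x) + g' x * character (- n) x) (at x within {0..2*pi})"
      using has_vector_derivative_mult[OF has_vector_derivative_at_within[OF g] character_derivative] .
  qed simp
  then have 0: "integral {0..2*pi} (\<lambda>x. g x * (\<i> * of_int (- n) * character (- n) x) + g' x * character (- n) x) = 0"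
    using per by (simp add: integral_unique)
  have "integral {0..2*pi} (\<lambda>x. - (\<i> * of_int n) * (g x * character (- n) x) + g' x * character (- n) x)
      = - (\<i> * of_int n) * integral {0..2*pi} (\<lambda>x. g x * character (- n) x) + integral {0..2*pi} (\<lambda>x. g' x * character (- n) x)"
    using cont g' by (subst Henstock_Kurzweil_Integration.integral_add)
      (auto intro!: integrable_continuous_real continuous_intros)
  with 0 have "integral {0..2*pi} (\<lambda>x. g' x * character (- n) x) = \<i> * of_int n * integral {0..2*pi} (\<lambda>x. g x * character (- n) x)"
    by (simp add: algebra_simps)
  then show ?thesis by (simp add: fourier_def)
qed

lemma fourier_const: "fourier (\<lambda>x. c) n = (if n = 0 then c else 0)"
proof (cases "n = 0")
  case True
  then show ?thesis by (simp add: fourier_def scaleR_conv_of_real)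
next
  case False
  have "fourier (\<lambda>x. 0) n = \<i> * of_int n * fourier (\<lambda>x. c) n"
    by (rule fourier_derivative) auto
  moreover have "fourier (\<lambda>x. 0) n = 0" by (simp add: fourier_def)
  ultimately show ?thesis using False by simp
qed

lemma fourier_character: "fourier (\<lambda>x. c * character k x) n = (if n = k then c else 0)"
  using fourier_modulate[of k "\<lambda>_. c" n] by (simp add: fourier_const mult.commute)

section \<open>Trigonometric approximation and the convolution formula\<close>

inductive trig_poly :: "(real \<Rightarrow> complex) \<Rightarrow> bool" where
  character: "trig_poly (\<lambda>x. c * character k x)"
| add: "trig_poly f \<Longrightarrow> trig_poly g \<Longrightarrow> trig_poly (\<lambda>x. f x + g x)"

lemma trig_poly_continuous: "trig_poly f \<Longrightarrow> continuous_on S f"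
  by (induction rule: trig_poly.induct) (auto intro!: continuous_intros)

lemma trig_poly_mult:
  assumes "trig_poly f" "trig_poly g" shows "trig_poly (\<lambda>x. f x * g x)"
  using assms
proof (induction arbitrary: g rule: trig_poly.induct)
  case (character c k)
  from character show ?case
  proof (induction rule: trig_poly.induct)
    case (character d l)
    have "(\<lambda>x. c * character k x * (d * character l x)) = (\<lambda>x. (c * d) * character (k + l) x)"
      by (simp add: fun_eq_iff character_add)
    then show ?case using trig_poly.character[of "c * d" "k + l"] by (simp only:)
  next
    case (add f g)
    then show ?case using trig_poly.add[OF add.IH] by (simp add: distrib_left)
  qed
next
  case (add f1 f2)
  then show ?case using trig_poly.add[OF add.IH(1)[OF add.prems] add.IH(2)[OF add.prems]] by (simp add: distrib_right)
qed

text \<open>On the circle a real-linear functional is \<open>f 1\<close> times the cosine plus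
  \<open>f \<i>\<close> times the sine, a combination of the characters 1 and -1; products of
  characters are again characters.\<close>

lemma trig_poly_polynomial:
  fixes q :: "complex \<Rightarrow> real"
  assumes "real_polynomial_function q"
  shows "trig_poly (\<lambda>x. of_real (q (cis x)))"
  using assms
proof (induction rule: real_polynomial_function.induct)
  case (linear f)
  interpret bounded_linear f by fact
  have "complex_of_real (f (cis x)) = (of_real (f 1) / 2 - \<i> * of_real (f \<i>) / 2) * character 1 x
      + (of_real (f 1) / 2 + \<i> * of_real (f \<i>) / 2) * character (-1) x" for x
  proof -
    have "cis x = cos x *\<^sub>R 1 + sin x *\<^sub>R \<i>" by (simp add: complex_eq_iff)
    then have 1: "f (cis x) = cos x * f 1 + sin x * f \<i>" by (simp add: add scaleR)
    have c: "character 1 x = Complex (cos x) (sin x)" "character (-1) x = Complex (cos x) (- sin x)"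
      by (auto simp: character_def complex_eq_iff Re_exp Im_exp)
    show ?thesis unfolding 1 c by (simp add: complex_eq_iff algebra_simps)
  qed
  then show ?case using trig_poly.add[OF trig_poly.character trig_poly.character] by simp
next
  case (const c)
  show ?case using trig_poly.character[of "of_real c" 0] by simp
next
  case (add f g)
  then show ?case using trig_poly.add by simp
next
  case (mult f g)
  then show ?case using trig_poly_mult by simp
qed

text \<open>The argument function jumps at 1, so \<open>G\<close> is not continuous by composition.
  It is continuous because \<open>cis\<close> maps the compact interval onto the circle as a
  quotient map and \<open>g\<close> takes equal values at the identified end points.\<close>

lemma continuous_on_circle:
  fixes g :: "real \<Rightarrow> real"
  assumes g: "continuous_on {0..2*pi} g" "g (2 * pi) = g 0"
  obtains G where "continuous_on (sphere 0 1) G" "\<And>x. x \<in> {0..2*pi} \<Longrightarrow> G (cis x) = g x"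
proof
  define G where "G z = g (Arg2pi z)" for z
  show Gc: "G (cis x) = g x" if "x \<in> {0..2*pi}" for x
  proof (cases "x = 2 * pi")
    case True
    moreover have "Arg2pi 1 = 0" by (rule Arg2pi_unique[of 1]) auto
    ultimately show ?thesis using g(2) by (simp add: G_def)
  next
    case False
    have "Arg2pi (cis x) = x"
      by (rule Arg2pi_unique[of 1]) (use that False in \<open>auto simp: cis_conv_exp\<close>)
    then show ?thesis by (simp add: G_def)
  qed
  have img: "cis ` {0..2*pi} = sphere 0 1"
  proof (intro equalityI subsetI)
    fix z :: complex assume "z \<in> sphere 0 1"
    then have "z = cis (Arg2pi z)" using Arg2pi_eq[of z] by (simp add: cis_conv_exp)
    moreover have "Arg2pi z \<in> {0..2*pi}" using Arg2pi[of z] by auto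
    ultimately show "z \<in> cis ` {0..2*pi}" by blast
  qed auto
  have "quotient_map (top_of_set {0..2*pi}) (top_of_set (sphere 0 1)) cis"
    by (rule T1_Spaces.continuous_imp_quotient_map)
      (auto simp: img compact_space_subtopology Hausdorff_space_subtopology intro!: continuous_on_cis continuous_on_id)
  moreover have "continuous_map (top_of_set {0..2*pi}) euclideanreal (G \<circ> cis)"
    using continuous_on_eq[OF g(1), of "G \<circ> cis"] Gc by simp
  ultimately have "continuous_map (top_of_set (sphere 0 1)) euclideanreal G"
    by (rule continuous_compose_quotient_map)
  then show "continuous_on (sphere 0 1) G" by simp
qed

lemma trig_poly_approximation:
  fixes g :: "real \<Rightarrow> real"
  assumes g: "continuous_on {0..2*pi} g" "g (2 * pi) = g 0" and e: "e > 0"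
  obtains P where "trig_poly P" "\<And>x. x \<in> {0..2*pi} \<Longrightarrow> cmod (of_real (g x) - P x) \<le> e"
proof -
  obtain G where G: "continuous_on (sphere 0 1) G" "\<And>x. x \<in> {0..2*pi} \<Longrightarrow> G (cis x) = g x"
    using continuous_on_circle[OF g] by blast
  obtain q where q: "real_polynomial_function q" "\<And>z. z \<in> sphere (0::complex) 1 \<Longrightarrow> \<bar>G z - q z\<bar> < e"
    using Stone_Weierstrass_real_polynomial_function[OF compact_sphere G(1) e] by blast
  show ?thesis
  proof
    show "trig_poly (\<lambda>x. of_real (q (cis x)))" by (rule trig_poly_polynomial[OF q(1)])
    fix x :: real assume "x \<in> {0..2*pi}"
    then have "\<bar>g x - q (cis x)\<bar> < e" using q(2)[of "cis x"] G(2) by simp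
    moreover have "cmod (of_real (g x) - of_real (q (cis x))) = \<bar>g x - q (cis x)\<bar>"
      by (metis norm_of_real of_real_diff)
    ultimately show "cmod (of_real (g x) - of_real (q (cis x))) \<le> e" by simp
  qed
qed

lemma fourier_bounded:
  assumes "continuous_on {0..2*pi} f"
  obtains B where "\<And>n. cmod (fourier f n) \<le> B"
proof -
  have "compact (f ` {0..2*pi})" using assms by (intro compact_continuous_image) auto
  then obtain B where "\<And>x. x \<in> {0..2*pi} \<Longrightarrow> cmod (f x) \<le> B"
    by (meson bounded_iff compact_imp_bounded imageI)
  then show ?thesis using norm_fourier_le[OF assms] that by blast
qed

lemma summable_on_int_shift:
  assumes "(\<lambda>k. c k) summable_on (UNIV :: int set)"
  shows "(\<lambda>k. c (n - k)) summable_on (UNIV :: int set)"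
proof -
  have "bij_betw (\<lambda>k. n - k) UNIV (UNIV :: int set)"
    by (rule bij_betwI[where g = "\<lambda>k. n - k"]) auto
  from summable_on_reindex_bij_betw[OF this, of c] assms show ?thesis by simp
qed

lemma abs_summable_convolution:
  fixes b c :: "int \<Rightarrow> complex"
  assumes b: "\<And>k. cmod (b k) \<le> B" and c: "(\<lambda>k. cmod (c k)) summable_on UNIV"
  shows "(\<lambda>k. cmod (b k * c (n - k))) summable_on UNIV"
proof (rule summable_on_comparison_test)
  show "(\<lambda>k. B * cmod (c (n - k))) summable_on UNIV"
    using summable_on_int_shift[OF c] by (rule summable_on_cmult_right)
qed (auto simp: norm_mult intro: mult_right_mono b)

lemma fourier_convolution_trig_poly:
  assumes "trig_poly f" and h: "continuous_on {0..2*pi} h" and hs: "(\<lambda>k. cmod (fourier h k)) summable_on UNIV"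
  shows "fourier (\<lambda>x. f x * h x) n = (\<Sum>\<^sub>\<infinity>k. fourier f k * fourier h (n - k))"
  using assms(1)
proof (induction rule: trig_poly.induct)
  case (character c k)
  have "fourier (\<lambda>x. c * character k x * h x) n = c * fourier h (n - k)"
    using fourier_cmult[of c "\<lambda>x. character k x * h x" n] by (simp add: fourier_modulate mult.assoc)
  moreover have "(\<Sum>\<^sub>\<infinity>m. fourier (\<lambda>x. c * character k x) m * fourier h (n - m)) = (\<Sum>\<^sub>\<infinity>m\<in>{k}. c * fourier h (n - k))"
    by (rule infsum_cong_neutral) (auto simp: fourier_character)
  ultimately show ?case by simp
next
  case (add f g)
  note cont = trig_poly_continuous[OF add.hyps(1)] trig_poly_continuous[OF add.hyps(2)]
  have sm: "(\<lambda>k. fourier f k * fourier h (n - k)) summable_on UNIV" if fc: "continuous_on {0..2*pi} f" for f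
  proof -
    obtain B where "\<And>k. cmod (fourier f k) \<le> B" using fourier_bounded[OF fc] by blast
    then show ?thesis
      by (rule Infinite_Sum.abs_summable_summable[OF abs_summable_convolution[OF _ hs]])
  qed
  have "fourier (\<lambda>x. (f x + g x) * h x) n = fourier (\<lambda>x. f x * h x) n + fourier (\<lambda>x. g x * h x) n"
    unfolding distrib_right by (intro fourier_add continuous_intros cont h)
  also have "\<dots> = (\<Sum>\<^sub>\<infinity>k. fourier f k * fourier h (n - k) + fourier g k * fourier h (n - k))"
    unfolding add.IH by (rule infsum_add[OF sm[OF cont(1)] sm[OF cont(2)], symmetric])
  also have "\<dots> = (\<Sum>\<^sub>\<infinity>k. fourier (\<lambda>x. f x + g x) k * fourier h (n - k))"
    using cont by (simp add: fourier_add distrib_right)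
  finally show ?case .
qed

text \<open>No inversion of Fourier series is needed: when the coefficients of \<open>h\<close> are
  absolutely summable, both sides are Lipschitz in the supremum norm of \<open>g\<close>, and they
  agree for trigonometric polynomials, which approximate \<open>g\<close> uniformly.\<close>

lemma fourier_convolution:
  fixes g :: "real \<Rightarrow> real"
  assumes g: "continuous_on {0..2*pi} g" "g (2 * pi) = g 0"
    and h: "continuous_on {0..2*pi} h" and hs: "(\<lambda>k. cmod (fourier h k)) summable_on UNIV"
  shows "fourier (\<lambda>x. of_real (g x) * h x) n = (\<Sum>\<^sub>\<infinity>k. fourier (\<lambda>x. of_real (g x)) k * fourier h (n - k))"
proof -
  let ?g = "\<lambda>x. complex_of_real (g x)"
  let ?S = "\<lambda>f. \<Sum>\<^sub>\<infinity>k. fourier f k * fourier h (n - k)"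
  have gc: "continuous_on {0..2*pi} ?g" by (intro continuous_intros g)
  have "compact (h ` {0..2*pi})" using h by (intro compact_continuous_image) auto
  then obtain B where B: "\<And>x. x \<in> {0..2*pi} \<Longrightarrow> cmod (h x) \<le> B"
    by (meson bounded_iff compact_imp_bounded imageI)
  define H where "H = (\<Sum>\<^sub>\<infinity>k. cmod (fourier h (n - k)))"
  have H: "0 \<le> H" unfolding H_def by (intro infsum_nonneg) auto
  have B0: "0 \<le> B" using B[of 0] norm_ge_zero[of "h 0"] by (simp del: norm_ge_zero)
  have le: "cmod (fourier (\<lambda>x. ?g x * h x) n - ?S ?g) \<le> e * (B + H)" if e: "e > 0" for e
  proof -
    obtain P where P: "trig_poly P" "\<And>x. x \<in> {0..2*pi} \<Longrightarrow> cmod (?g x - P x) \<le> e"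
      using trig_poly_approximation[OF g e] by blast
    have Pc: "continuous_on {0..2*pi} P" by (rule trig_poly_continuous[OF P(1)])
    have d: "fourier ?g k - fourier P k = fourier (\<lambda>x. ?g x - P x) k" for k
      using fourier_diff[OF gc Pc] by simp
    have dc: "cmod (fourier (\<lambda>x. ?g x - P x) k) \<le> e" for k
      by (intro norm_fourier_le continuous_intros gc Pc P(2))
    have sm: "(\<lambda>k. fourier f k * fourier h (n - k)) summable_on UNIV" if fc: "continuous_on {0..2*pi} f" for f
    proof -
      obtain B where "\<And>k. cmod (fourier f k) \<le> B" using fourier_bounded[OF fc] by blast
      then show ?thesis
        by (rule Infinite_Sum.abs_summable_summable[OF abs_summable_convolution[OF _ hs]])
    qed
    have "fourier (\<lambda>x. ?g x * h x) n - fourier (\<lambda>x. P x * h x) n = fourier (\<lambda>x. (?g x - P x) * h x) n"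
      using fourier_diff[of "\<lambda>x. ?g x * h x" "\<lambda>x. P x * h x" n] gc Pc h
      by (simp add: left_diff_distrib continuous_intros)
    also have "cmod \<dots> \<le> e * B"
      using P(2) B e by (intro norm_fourier_le continuous_intros gc Pc h) (auto simp: norm_mult intro!: mult_mono)
    finally have 1: "cmod (fourier (\<lambda>x. ?g x * h x) n - fourier (\<lambda>x. P x * h x) n) \<le> e * B" .
    have "?S ?g - ?S P = (\<Sum>\<^sub>\<infinity>k. fourier (\<lambda>x. ?g x - P x) k * fourier h (n - k))"
      unfolding d[symmetric] left_diff_distrib by (rule infsum_diff[OF sm[OF gc] sm[OF Pc], symmetric])
    also have "cmod \<dots> \<le> (\<Sum>\<^sub>\<infinity>k. e * cmod (fourier h (n - k)))"
      by (rule norm_infsum_le[OF has_sum_infsum has_sum_infsum])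
        (use sm[of "\<lambda>x. ?g x - P x"] gc Pc summable_on_int_shift[OF hs] dc
          in \<open>auto simp: norm_mult continuous_intros intro!: mult_right_mono summable_on_cmult_right\<close>)
    also have "\<dots> = e * H" unfolding H_def by (rule infsum_cmult_right')
    finally have 2: "cmod (?S ?g - ?S P) \<le> e * H" .
    have "fourier (\<lambda>x. P x * h x) n = ?S P" by (rule fourier_convolution_trig_poly[OF P(1) h hs])
    then have "fourier (\<lambda>x. ?g x * h x) n - ?S ?g
        = (fourier (\<lambda>x. ?g x * h x) n - fourier (\<lambda>x. P x * h x) n) - (?S ?g - ?S P)" by simp
    also have "cmod \<dots> \<le> e * B + e * H" using norm_triangle_ineq4 1 2 by (meson add_mono order_trans)
    finally show ?thesis by (simp add: distrib_left)
  qed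
  have "cmod (fourier (\<lambda>x. ?g x * h x) n - ?S ?g) \<le> 0 + e" if "e > 0" for e
  proof -
    have "cmod (fourier (\<lambda>x. ?g x * h x) n - ?S ?g) \<le> e / (B + H + 1) * (B + H)"
      using B0 H that by (intro le) auto
    also have "\<dots> \<le> e / (B + H + 1) * (B + H + 1)" using B0 H that by (intro mult_left_mono) auto
    also have "\<dots> = e" using B0 H by simp
    finally show ?thesis by simp
  qed
  then have "cmod (fourier (\<lambda>x. ?g x * h x) n - ?S ?g) \<le> 0" by (rule field_le_epsilon)
  then show ?thesis by simp
qed

lemma integral_infsum:
  fixes f :: "'i \<Rightarrow> real \<Rightarrow> complex"
  assumes cont: "\<And>i. i \<in> I \<Longrightarrow> continuous_on {a..b} (f i)"
    and bound: "\<And>i t. i \<in> I \<Longrightarrow> t \<in> {a..b} \<Longrightarrow> cmod (f i t) \<le> M i" and M: "M summable_on I"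
  shows "((\<lambda>t. \<Sum>\<^sub>\<infinity>i\<in>I. f i t) has_integral (\<Sum>\<^sub>\<infinity>i\<in>I. integral {a..b} (f i))) {a..b}"
proof -
  let ?F = "finite_subsets_at_top I"
  \<comment> \<open>The intersection with \<open>I\<close> makes all partial sums continuous, not
    only those with index set inside \<open>I\<close>, as the theorem on integrals of uniform limits
    demands.\<close>
  let ?f = "\<lambda>X t. \<Sum>i\<in>X \<inter> I. f i t"
  have "uniform_limit {a..b} (\<lambda>X t. \<Sum>i\<in>X. f i t) (\<lambda>t. \<Sum>\<^sub>\<infinity>i\<in>I. f i t) ?F"
    by (rule Weierstrass_m_test_general[OF bound M])
  then have u: "uniform_limit {a..b} ?f (\<lambda>t. \<Sum>\<^sub>\<infinity>i\<in>I. f i t) ?F"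
    by (rule uniform_limit_cong[THEN iffD1, rotated 2])
      (auto intro!: eventually_finite_subsets_at_top_weakI simp: Int_absorb2)
  obtain S J where SJ: "\<And>X. (?f X has_integral S X) {a..b}" "((\<lambda>t. \<Sum>\<^sub>\<infinity>i\<in>I. f i t) has_integral J) {a..b}" "(S \<longlongrightarrow> J) ?F"
    by (rule uniform_limit_integral[OF u]) (auto intro!: continuous_intros cont)
  have "(sum (\<lambda>i. integral {a..b} (f i)) \<longlongrightarrow> J) ?F"
  proof (rule Lim_transform_eventually[OF SJ(3)], rule eventually_finite_subsets_at_top_weakI)
    fix X assume X: "finite X" "X \<subseteq> I"
    have "(?f X has_integral (\<Sum>i\<in>X \<inter> I. integral {a..b} (f i))) {a..b}"
      using X by (intro has_integral_sum integrable_integral integrable_continuous_real cont) auto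
    then show "S X = (\<Sum>i\<in>X. integral {a..b} (f i))"
      using SJ(1)[of X] X by (metis Int_absorb2 has_integral_unique)
  qed
  then have "((\<lambda>i. integral {a..b} (f i)) has_sum J) I" by (simp add: has_sum_def)
  then show ?thesis using SJ(2) infsumI by metis
qed

section \<open>Smooth periodic functions\<close>

lemma Ck_imp_continuous: "Ck k f \<Longrightarrow> continuous_on UNIV f"
  by (cases k) (auto intro!: differentiable_imp_continuous_on simp: differentiable_on_def differentiable_at_withinI)

lemma smooth_continuous: "smooth f \<Longrightarrow> continuous_on S f"
  using Ck_imp_continuous continuous_on_subset by (metis smooth_def subset_UNIV)

lemma smooth_has_derivative: "smooth f \<Longrightarrow> (f has_derivative frechet_derivative f (at z)) (at z)"
  using frechet_derivative_works[of f "at z"] unfolding smooth_def by (metis Ck.simps(2))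

lemma smooth_frechet_derivative: "smooth f \<Longrightarrow> smooth (\<lambda>z. frechet_derivative f (at z) v)"
  unfolding smooth_def by (metis Ck.simps(2))

definition dx :: "(real \<times> real \<Rightarrow> real) \<Rightarrow> real \<times> real \<Rightarrow> real" where
  "dx f z = frechet_derivative f (at z) (1, 0)"

definition dt :: "(real \<times> real \<Rightarrow> real) \<Rightarrow> real \<times> real \<Rightarrow> real" where
  "dt f z = frechet_derivative f (at z) (0, 1)"

lemma smooth_dx: "smooth f \<Longrightarrow> smooth (dx f)" and smooth_dt: "smooth f \<Longrightarrow> smooth (dt f)"
  using smooth_frechet_derivative[of f] unfolding dx_def[abs_def] dt_def[abs_def] by auto

lemma dx_has_derivative:
  assumes "smooth f" shows "((\<lambda>x. f (x, t)) has_real_derivative dx f (x, t)) (at x)"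
proof -
  let ?D = "frechet_derivative f (at (x, t))"
  have D: "(f has_derivative ?D) (at (x, t))" by (rule smooth_has_derivative[OF assms])
  have "((\<lambda>x. (x, t)) has_derivative (\<lambda>h. (h, 0))) (at x)"
    by (auto intro!: derivative_eq_intros)
  from has_derivative_compose[OF this D] have "((\<lambda>x. f (x, t)) has_derivative (\<lambda>h. ?D (h, 0))) (at x)" .
  moreover have "?D (h, 0) = dx f (x, t) * h" for h
    using linear_scale[OF has_derivative_linear[OF D], of h "(1, 0)"] by (simp add: dx_def)
  ultimately show ?thesis by (simp add: has_field_derivative_def)
qed

lemma dt_has_derivative:
  assumes "smooth f" shows "((\<lambda>t. f (x, t)) has_real_derivative dt f (x, t)) (at t)"
proof -
  let ?D = "frechet_derivative f (at (x, t))"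
  have D: "(f has_derivative ?D) (at (x, t))" by (rule smooth_has_derivative[OF assms])
  have "((\<lambda>t. (x, t)) has_derivative (\<lambda>h. (0, h))) (at t)"
    by (auto intro!: derivative_eq_intros)
  from has_derivative_compose[OF this D] have "((\<lambda>t. f (x, t)) has_derivative (\<lambda>h. ?D (0, h))) (at t)" .
  moreover have "?D (0, h) = dt f (x, t) * h" for h
    using linear_scale[OF has_derivative_linear[OF D], of h "(0, 1)"] by (simp add: dt_def)
  ultimately show ?thesis by (simp add: has_field_derivative_def)
qed

definition periodic :: "(real \<times> real \<Rightarrow> real) \<Rightarrow> bool" where
  "periodic f \<longleftrightarrow> (\<forall>x t. f (x + 2*pi, t) = f (x, t))"

lemma periodic_dx:
  assumes "smooth f" "periodic f" shows "periodic (dx f)"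
  unfolding periodic_def
proof (intro allI)
  fix x t
  have "((\<lambda>x. f (x + 2*pi, t)) has_real_derivative dx f (x + 2*pi, t)) (at x)"
    using dx_has_derivative[OF assms(1), of t "x + 2*pi"] by (simp add: DERIV_shift)
  then have "((\<lambda>x. f (x, t)) has_real_derivative dx f (x + 2*pi, t)) (at x)"
    using assms(2) by (simp add: periodic_def)
  then show "dx f (x + 2*pi, t) = dx f (x, t)"
    using dx_has_derivative[OF assms(1), of t x] by (rule DERIV_unique)
qed

lemma periodic_dt:
  assumes "smooth f" "periodic f" shows "periodic (dt f)"
  unfolding periodic_def
proof (intro allI)
  fix x t
  have "((\<lambda>t. f (x, t)) has_real_derivative dt f (x + 2*pi, t)) (at t)"
    using dt_has_derivative[OF assms(1), of "x + 2*pi" t] assms(2) by (simp add: periodic_def)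
  then show "dt f (x + 2*pi, t) = dt f (x, t)"
    using dt_has_derivative[OF assms(1), of x t] by (rule DERIV_unique)
qed

lemma periodic_ends: "periodic f \<Longrightarrow> f (2*pi, t) = f (0, t)"
  unfolding periodic_def by (metis add_0)

definition coef :: "(real \<times> real \<Rightarrow> real) \<Rightarrow> int \<Rightarrow> real \<Rightarrow> complex" where
  "coef f n t = fourier (\<lambda>x. of_real (f (x, t))) n"

lemma smooth_slice_continuous: "smooth f \<Longrightarrow> continuous_on S (\<lambda>x. f (x, t))"
  by (rule continuous_on_compose2[OF smooth_continuous[of f UNIV]]) (auto intro!: continuous_intros)

lemma smooth_slice_continuous': "smooth f \<Longrightarrow> continuous_on S (\<lambda>x. complex_of_real (f (x, t)))"
  by (intro continuous_intros smooth_slice_continuous)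

lemma coef_dx:
  assumes "smooth f" "periodic f" shows "coef (dx f) n t = \<i> * of_int n * coef f n t"
  unfolding coef_def
proof (rule fourier_derivative)
  show "((\<lambda>x. complex_of_real (f (x, t))) has_vector_derivative complex_of_real (dx f (x, t))) (at x)" for x
    by (rule has_vector_derivative_of_real[OF dx_has_derivative[OF assms(1)]])
qed (use periodic_ends[OF assms(2)] smooth_slice_continuous'[OF smooth_dx[OF assms(1)]] in auto)

lemma coef_bounded:
  assumes "smooth f" obtains M where "0 \<le> M" "\<And>n t. t \<in> {0..T} \<Longrightarrow> cmod (coef f n t) \<le> M"
proof -
  have "compact (f ` ({0..2*pi} \<times> {0..T}))"
    using smooth_continuous[OF assms] by (intro compact_continuous_image compact_Times) auto
  then obtain B where B: "\<And>z. z \<in> {0..2*pi} \<times> {0..T} \<Longrightarrow> norm (f z) \<le> B"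
    by (meson bounded_iff compact_imp_bounded imageI)
  show ?thesis
  proof (rule that[of "max 0 B"])
    fix n t assume "t \<in> {0..T}"
    then show "cmod (coef f n t) \<le> max 0 B"
      unfolding coef_def using B by (intro norm_fourier_le smooth_slice_continuous' assms) (auto simp: le_max_iff_disj)
  qed simp
qed

lemma coef_decay_power:
  assumes "smooth f" "periodic f"
  shows "\<exists>M\<ge>0. \<forall>n. \<forall>t\<in>{0..T}. \<bar>real_of_int n\<bar> ^ k * cmod (coef f n t) \<le> M"
  using assms
proof (induction k arbitrary: f)
  case 0
  obtain M where "0 \<le> M" "\<And>n t. t \<in> {0..T} \<Longrightarrow> cmod (coef f n t) \<le> M"
    using coef_bounded[OF 0(1), of T] by blast
  then show ?case by auto
next
  case (Suc k)
  have "\<bar>real_of_int n\<bar> ^ Suc k * cmod (coef f n t) = \<bar>real_of_int n\<bar> ^ k * cmod (coef (dx f) n t)" for n t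
    using Suc.prems by (simp add: coef_dx norm_mult)
  then show ?case using Suc.IH[OF smooth_dx[OF Suc.prems(1)] periodic_dx[OF Suc.prems]] by (simp only:)
qed

lemma coef_decay:
  assumes "smooth f" "periodic f"
  obtains M where "0 \<le> M" "\<And>n t. t \<in> {0..T} \<Longrightarrow> cmod (coef f n t) \<le> M * jbr n powr - real k"
proof -
  obtain M0 where M0: "0 \<le> M0" "\<And>n t. t \<in> {0..T} \<Longrightarrow> cmod (coef f n t) \<le> M0"
    using coef_bounded[OF assms(1), of T] by blast
  obtain M1 where M1: "0 \<le> M1" "\<And>n t. t \<in> {0..T} \<Longrightarrow> \<bar>real_of_int n\<bar> ^ k * cmod (coef f n t) \<le> M1"
    using coef_decay_power[OF assms, of T k] by blast
  show ?thesis
  proof (rule that[of "M0 + 2 ^ k * M1"])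
    fix n t assume t: "t \<in> {0..T}"
    have "jbr n ^ k * cmod (coef f n t) \<le> M0 + 2 ^ k * M1"
    proof (cases "n = 0")
      \<comment> \<open>At \<open>n = 0\<close> the derivative bound \<open>M1\<close> carries no
        information, since |n|^k may vanish while the bracket is 1; the plain bound
        \<open>M0\<close> takes over.\<close>
      case True
      then show ?thesis using M0(2)[OF t, of 0] M1(1) by (simp add: jbr_def add_increasing2)
    next
      case False
      have "jbr n ^ k \<le> (2 * \<bar>real_of_int n\<bar>) ^ k" using jbr_le_twice[OF False] by (intro power_mono) auto
      then have "jbr n ^ k * cmod (coef f n t) \<le> 2 ^ k * (\<bar>real_of_int n\<bar> ^ k * cmod (coef f n t))"
        by (simp add: power_mult_distrib mult.assoc[symmetric] mult_right_mono)
      also have "\<dots> \<le> 2 ^ k * M1" using M1(2)[OF t] by (intro mult_left_mono) auto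
      finally show ?thesis using M0(1) by simp
    qed
    then show "cmod (coef f n t) \<le> (M0 + 2 ^ k * M1) * jbr n powr - real k"
      by (simp add: powr_minus powr_realpow field_simps)
  qed (use M0 M1 in auto)
qed

lemma jbr_summable: "(\<lambda>n. jbr n powr - 2) summable_on UNIV"
proof -
  obtain c where c: "\<And>F. finite F \<Longrightarrow> (\<Sum>u\<in>F. jbr u powr - 2) \<le> c" using summable_jbr[of 2] by auto
  then show ?thesis
    by (intro nonneg_bounded_partial_sums_imp_summable_on[where C = c] eventually_finite_subsets_at_top_weakI) auto
qed

lemma coef_summable:
  assumes "smooth f" "periodic f" "0 \<le> t" shows "(\<lambda>n. cmod (coef f n t)) summable_on UNIV"
proof -
  obtain M where M: "\<And>n \<tau>. \<tau> \<in> {0..t} \<Longrightarrow> cmod (coef f n \<tau>) \<le> M * jbr n powr - real 2"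
    using coef_decay[OF assms(1,2), of t 2] by blast
  show ?thesis
    by (rule summable_on_comparison_test[OF summable_on_cmult_right[OF jbr_summable, of M]]) (use M[of t] assms(3) in auto)
qed

lemma has_vector_derivative_coef:
  assumes "smooth f" shows "(coef f n has_vector_derivative coef (dt f) n t) (at t)"
proof -
  let ?g = "\<lambda>f t x. complex_of_real (f (x, t)) * character (- n) x"
  have g: "continuous_on S (\<lambda>(t, x). ?g f t x)" if "smooth f" for f S
    unfolding case_prod_beta
    by (intro continuous_intros continuous_on_compose2[OF smooth_continuous[OF that, of UNIV]]) auto
  have "((\<lambda>t. integral (cbox 0 (2*pi)) (?g f t)) has_vector_derivative integral (cbox 0 (2*pi)) (?g (dt f) t)) (at t within UNIV)"
  proof (rule leibniz_rule_vector_derivative)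
    fix t x
    have "((\<lambda>t. complex_of_real (f (x, t))) has_vector_derivative complex_of_real (dt f (x, t))) (at t)"
      by (rule has_vector_derivative_of_real[OF dt_has_derivative[OF assms]])
    then show "((\<lambda>t. ?g f t x) has_vector_derivative ?g (dt f) t x) (at t within UNIV)"
      by (rule has_vector_derivative_mult_left)
  next
    show "?g f t integrable_on cbox 0 (2*pi)" for t
      by (intro integrable_continuous continuous_intros smooth_slice_continuous' assms)
    show "continuous_on (UNIV \<times> cbox 0 (2*pi)) (\<lambda>(t, x). ?g (dt f) t x)" by (rule g[OF smooth_dt[OF assms]])
  qed auto
  from has_vector_derivative_divide[OF this, of "of_real (2*pi)"] show ?thesis
    by (simp add: coef_def[abs_def] fourier_def)
qed

section \<open>Absolutely convergent triple sums and their symmetrisation\<close>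

lemma summable_on_pair_product:
  fixes f :: "'i \<Rightarrow> real" and g :: "'j \<Rightarrow> real"
  assumes "f summable_on UNIV" "g summable_on UNIV" "\<And>i. 0 \<le> f i" "\<And>j. 0 \<le> g j"
  shows "(\<lambda>(i, j). f i * g j) summable_on UNIV"
proof (rule nonneg_bounded_partial_sums_imp_summable_on[where C = "infsum f UNIV * infsum g UNIV"])
  show "\<forall>\<^sub>F X in finite_subsets_at_top UNIV. (\<Sum>(i, j)\<in>X. f i * g j) \<le> infsum f UNIV * infsum g UNIV"
    by (intro eventually_finite_subsets_at_top_weakI sum_product_le finite_sum_le_infsum assms) auto
qed (use assms in auto)

definition triple :: "(int \<Rightarrow> complex) \<Rightarrow> int \<Rightarrow> int \<times> int \<Rightarrow> complex" where
  "triple b n = (\<lambda>(j, k). b j * b k * b (n - j - k))"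

context
  fixes b :: "int \<Rightarrow> complex"
  assumes b: "(\<lambda>j. (1 + \<bar>real_of_int j\<bar>) * cmod (b j)) summable_on UNIV"
begin

text \<open>The weight is distributed over the three factors. The factor with the dependent
  frequency \<open>n - j - k\<close> is bounded by the total sum \<open>C\<close>; the other two
  leave a product of convergent series.\<close>

lemma summable_weighted_triple:
  fixes w :: "int \<times> int \<Rightarrow> int"
  assumes w: "\<And>j k. \<bar>w (j, k)\<bar> \<le> (1 + \<bar>j\<bar>) * (1 + \<bar>k\<bar>) * (1 + \<bar>n - j - k\<bar>)"
  shows "(\<lambda>jk. of_int (w jk) * triple b n jk) summable_on S"
proof -
  let ?b = "\<lambda>j. (1 + \<bar>real_of_int j\<bar>) * cmod (b j)"
  define C where "C = infsum ?b UNIV"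
  have C: "?b j \<le> C" for j
    using finite_sum_le_infsum[OF b, of "{j}"] by (simp add: C_def)
  have "(\<lambda>jk. C * (case jk of (j, k) \<Rightarrow> ?b j * ?b k)) summable_on UNIV"
    by (intro summable_on_cmult_right summable_on_pair_product b) auto
  then have "(\<lambda>jk. norm (of_int (w jk) * triple b n jk)) summable_on UNIV"
  proof (rule summable_on_comparison_test)
    fix jk :: "int \<times> int"
    obtain j k where jk: "jk = (j, k)" by fastforce
    let ?l = "n - j - k"
    have "real_of_int \<bar>w (j, k)\<bar> \<le> real_of_int ((1 + \<bar>j\<bar>) * (1 + \<bar>k\<bar>) * (1 + \<bar>?l\<bar>))"
      using w by (simp only: of_int_le_iff)
    then have "norm (of_int (w jk) * triple b n jk)
        \<le> ((1 + \<bar>real_of_int j\<bar>) * (1 + \<bar>real_of_int k\<bar>) * (1 + \<bar>real_of_int ?l\<bar>)) * (cmod (b j) * cmod (b k) * cmod (b ?l))"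
      unfolding jk triple_def prod.case norm_mult norm_of_int by (intro mult_right_mono) auto
    also have "\<dots> = ?b ?l * (?b j * ?b k)" by (simp only: mult_ac)
    also have "\<dots> \<le> C * (?b j * ?b k)" by (rule mult_right_mono[OF C]) auto
    finally show "norm (of_int (w jk) * triple b n jk) \<le> C * (case jk of (j, k) \<Rightarrow> ?b j * ?b k)"
      by (simp add: jk)
  qed auto
  then have "(\<lambda>jk. of_int (w jk) * triple b n jk) summable_on UNIV"
    by (rule Infinite_Sum.abs_summable_summable)
  then show ?thesis by (rule summable_on_subset_banach) auto
qed

lemma weight_le:
  fixes x y z :: int assumes "0 \<le> x" "0 \<le> y" "0 \<le> z"
  shows "1 \<le> (1 + x) * (1 + y) * (1 + z)" "x \<le> (1 + x) * (1 + y) * (1 + z)"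
    "y \<le> (1 + x) * (1 + y) * (1 + z)" "z \<le> (1 + x) * (1 + y) * (1 + z)"
proof -
  have "(1 + x) * (1 + y) * (1 + z) = 1 + x + y + z + (x * y + x * z + y * z + x * y * z)"
    by (simp add: algebra_simps)
  moreover have "0 \<le> x * y + x * z + y * z + x * y * z" using assms by simp
  ultimately show "1 \<le> (1 + x) * (1 + y) * (1 + z)" "x \<le> (1 + x) * (1 + y) * (1 + z)"
    "y \<le> (1 + x) * (1 + y) * (1 + z)" "z \<le> (1 + x) * (1 + y) * (1 + z)" using assms by linarith+
qed

lemma summable_triple:
  shows "(\<lambda>(j, k). of_int (n - j - k) * triple b n (j, k)) summable_on S"
    and "(\<lambda>(j, k). of_int j * triple b n (j, k)) summable_on S"
    and "(\<lambda>(j, k). of_int k * triple b n (j, k)) summable_on S"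
    and "triple b n summable_on S"
proof -
  have "(\<lambda>(j, k). of_int (f j k) * triple b n (j, k)) = (\<lambda>jk. of_int (case jk of (j, k) \<Rightarrow> f j k) * triple b n jk)" for f
    by auto
  then have w: "(\<lambda>(j, k). of_int (f j k) * triple b n (j, k)) summable_on S"
    if "\<And>j k. \<bar>f j k\<bar> \<le> (1 + \<bar>j\<bar>) * (1 + \<bar>k\<bar>) * (1 + \<bar>n - j - k\<bar>)" for f
    using summable_weighted_triple[of "\<lambda>(j, k). f j k" n S] that by simp
  show "(\<lambda>(j, k). of_int (n - j - k) * triple b n (j, k)) summable_on S"
    "(\<lambda>(j, k). of_int j * triple b n (j, k)) summable_on S" "(\<lambda>(j, k). of_int k * triple b n (j, k)) summable_on S"
    by (intro w weight_le; simp)+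
  show "triple b n summable_on S" using summable_weighted_triple[of "\<lambda>_. 1" n S] weight_le by simp
qed

text \<open>Permutations of the three frequencies preserve the nonresonant set and the product, so
  the weight may be averaged over them; the frequencies add up to \<open>n\<close>.\<close>

lemma infsum_nonresonant_symmetrised:
  "(\<Sum>\<^sub>\<infinity>(j, k)\<in>nonresonant n. of_int (n - j - k) * triple b n (j, k)) = of_int n / 3 * (\<Sum>\<^sub>\<infinity>jk\<in>nonresonant n. triple b n jk)"
proof -
  let ?S = "\<lambda>f. \<Sum>\<^sub>\<infinity>(j, k)\<in>nonresonant n. of_int (f j k) * triple b n (j, k)"
  let ?l = "?S (\<lambda>j k. n - j - k)" and ?j = "?S (\<lambda>j k. j)" and ?k = "?S (\<lambda>j k. k)"
  have 1: "?l = ?j"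
    by (rule infsum_reindex_bij_witness[of _ "\<lambda>(l, j). (j, n - l - j)" "\<lambda>(j, k). (n - j - k, j)"])
      (auto simp: nonresonant_def triple_def algebra_simps)
  have 2: "?j = ?k"
    by (rule infsum_reindex_bij_witness[of _ "\<lambda>(k, j). (j, k)" "\<lambda>(j, k). (k, j)"])
      (auto simp: nonresonant_def triple_def algebra_simps)
  have "?l + ?j + ?k = (\<Sum>\<^sub>\<infinity>jk\<in>nonresonant n. of_int n * triple b n jk)"
  proof -
    have "?l + ?j = (\<Sum>\<^sub>\<infinity>jk\<in>nonresonant n. (case jk of (j, k) \<Rightarrow> of_int (n - j - k) * triple b n (j, k)) + (case jk of (j, k) \<Rightarrow> of_int j * triple b n (j, k)))"
      by (rule infsum_add[symmetric]; rule summable_triple)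
    moreover have "\<dots> + ?k = (\<Sum>\<^sub>\<infinity>jk\<in>nonresonant n. ((case jk of (j, k) \<Rightarrow> of_int (n - j - k) * triple b n (j, k)) + (case jk of (j, k) \<Rightarrow> of_int j * triple b n (j, k))) + (case jk of (j, k) \<Rightarrow> of_int k * triple b n (j, k)))"
      by (rule infsum_add[symmetric]; (rule summable_on_add)?; rule summable_triple)
    ultimately show ?thesis by (simp add: case_prod_beta distrib_right[symmetric])
  qed
  also have "\<dots> = of_int n * (\<Sum>\<^sub>\<infinity>jk\<in>nonresonant n. triple b n jk)" by (rule infsum_cmult_right')
  finally have "3 * ?l = of_int n * (\<Sum>\<^sub>\<infinity>jk\<in>nonresonant n. triple b n jk)" using 1 2 by simp
  then show ?thesis by (simp add: field_simps)
qed

lemma infsum_odd: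
  fixes f :: "'i \<Rightarrow> complex"
  assumes "\<And>x. x \<in> S \<Longrightarrow> \<phi> x \<in> S" "\<And>x. x \<in> S \<Longrightarrow> \<phi> (\<phi> x) = x" "\<And>x. x \<in> S \<Longrightarrow> f (\<phi> x) = - f x"
  shows "infsum f S = 0"
proof -
  have "(\<Sum>\<^sub>\<infinity>x\<in>S. - f x) = infsum f S"
    by (rule infsum_reindex_bij_witness[of _ \<phi> \<phi>]) (use assms in auto)
  then show ?thesis by (simp add: infsum_uminus equation_minus_iff[symmetric])
qed

text \<open>Of the terms excluded from the nonresonant sum all but \<open>(n, n, -n)\<close> cancel in pairs.\<close>

lemma infsum_resonant_split:
  "(\<Sum>\<^sub>\<infinity>(j, k)\<in>{(j, k). j + k \<noteq> 0}. of_int (n - j - k) * triple b n (j, k))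
   = of_int n / 3 * (\<Sum>\<^sub>\<infinity>jk\<in>nonresonant n. triple b n jk) - of_int n * (b n * b n * b (- n))"
proof -
  let ?f = "\<lambda>(j, k). of_int (n - j - k) * triple b n (j, k)"
  \<comment> \<open>In \<open>A\<close> the frequencies are (n, k, -k) with weight -k, odd in k.
    Both k = n and k = -n are left out: the first belongs to \<open>C\<close>, the second has
    \<open>j + k = 0\<close>, and leaving out both keeps \<open>A\<close> symmetric.
    \<open>B\<close> is its mirror image.\<close>
  define A B C where "A = {(j, k). j = n \<and> k \<noteq> n \<and> k \<noteq> - n}" and "B = {(j, k). k = n \<and> j \<noteq> n \<and> j \<noteq> - n}"
    and "C = {(j, k). j = n \<and> k = n \<and> n \<noteq> 0}"
  note sm = summable_triple(1)
  have "infsum ?f A = 0"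
    by (rule infsum_odd[where \<phi> = "\<lambda>(j, k). (j, - k)"]) (auto simp: A_def triple_def algebra_simps)
  moreover have "infsum ?f B = 0"
    by (rule infsum_odd[where \<phi> = "\<lambda>(j, k). (- j, k)"]) (auto simp: B_def triple_def algebra_simps)
  moreover have "infsum ?f C = - of_int n * (b n * b n * b (- n))"
  proof (cases "n = 0")
    case False
    then have "C = {(n, n)}" by (auto simp: C_def)
    then show ?thesis by (simp add: triple_def)
  qed (simp add: C_def)
  moreover have "{(j, k). j + k \<noteq> 0} = nonresonant n \<union> (A \<union> (B \<union> C))"
    by (auto simp: nonresonant_def A_def B_def C_def)
  moreover have "infsum ?f (nonresonant n \<union> (A \<union> (B \<union> C))) = infsum ?f (nonresonant n) + (infsum ?f A + (infsum ?f B + infsum ?f C))"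
    by (subst infsum_Un_disjoint, rule sm, rule sm, force simp: nonresonant_def A_def B_def C_def)+ (rule refl)
  ultimately show ?thesis using infsum_nonresonant_symmetrised by simp
qed

end

section \<open>Smooth solutions are mild solutions\<close>

lemma cis_derivative:
  "((\<lambda>t. cis (c * t)) has_vector_derivative \<i> * of_real c * cis (c * t)) (at t within S)"
proof -
  have "((\<lambda>z. exp (\<i> * of_real c * z)) has_field_derivative \<i> * of_real c * exp (\<i> * of_real c * of_real t)) (at (of_real t))"
    by (auto intro!: derivative_eq_intros)
  from has_vector_derivative_real_field[OF this] show ?thesis
    by (simp add: cis_conv_exp mult.assoc has_vector_derivative_at_within)
qed

locale smooth_solution =
  fixes u :: "real \<Rightarrow> real \<Rightarrow> real"
  assumes solution: "mmkdv_smooth_solution u"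
begin

definition U :: "real \<times> real \<Rightarrow> real" where
  "U = (\<lambda>(x, t). u x t)"

lemma U_eq [simp]: "U (x, t) = u x t"
  by (simp add: U_def)

lemma U: "smooth U" "periodic U"
  using solution by (auto simp: mmkdv_smooth_solution_def U_def periodic_def)

lemma U_deriv: "smooth (dx U)" "periodic (dx U)" "smooth (dt U)" "periodic (dt U)"
    "smooth (dx (dx U))" "periodic (dx (dx U))" "smooth (dx (dx (dx U)))" "periodic (dx (dx (dx U)))"
  by (intro smooth_dx smooth_dt periodic_dx periodic_dt U)+

definition mean :: "real \<Rightarrow> real" where
  "mean t = integral {0..2*pi} (\<lambda>y. (u y t)\<^sup>2) / (2*pi)"

lemma equation: "dt U (x, t) = - dx (dx (dx U)) (x, t) - ((U (x, t))\<^sup>2 - mean t) * dx U (x, t)"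
proof -
  have 1: "deriv (\<lambda>\<tau>. u x \<tau>) t = dt U (x, t)"
    using dt_has_derivative[OF U(1), of x t] by (intro DERIV_imp_deriv) simp
  have "deriv (\<lambda>y. f (y, t)) = (\<lambda>y. dx f (y, t))" if "smooth f" for f
    using dx_has_derivative[OF that] by (auto simp: fun_eq_iff intro!: DERIV_imp_deriv)
  from this[OF U(1)] this[OF U_deriv(1)] this[OF U_deriv(5)]
  have 2: "deriv (\<lambda>y. u y t) x = dx U (x, t)" "(deriv ^^ 3) (\<lambda>y. u y t) x = dx (dx (dx U)) (x, t)"
    by (simp_all add: numeral_3_eq_3)
  have "deriv (\<lambda>\<tau>. u x \<tau>) t + (deriv ^^ 3) (\<lambda>y. u y t) x + ((u x t)\<^sup>2 - mean t) * deriv (\<lambda>y. u y t) x = 0"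
    using solution unfolding mmkdv_smooth_solution_def mean_def by blast
  then show ?thesis unfolding 1 2 U_eq by simp
qed

lemma slice_continuous: "continuous_on S (\<lambda>x. u x t)"
  using smooth_slice_continuous[OF U(1), of S t] by simp

definition square_coef :: "int \<Rightarrow> real \<Rightarrow> complex" where
  "square_coef m t = fourier (\<lambda>x. of_real ((u x t)\<^sup>2)) m"

lemma mean_eq: "complex_of_real (mean t) = square_coef 0 t"
proof -
  have "((\<lambda>x. (u x t)\<^sup>2) has_integral integral {0..2*pi} (\<lambda>x. (u x t)\<^sup>2)) {0..2*pi}"
    by (intro integrable_integral integrable_continuous_real continuous_intros slice_continuous)
  from has_integral_of_real[OF this, where 'b = complex] have
    "integral {0..2*pi} (\<lambda>x. complex_of_real ((u x t)\<^sup>2)) = of_real (integral {0..2*pi} (\<lambda>x. (u x t)\<^sup>2))"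
    by (rule integral_unique)
  then show ?thesis by (simp add: square_coef_def fourier_def mean_def)
qed

definition nonlinearity :: "int \<Rightarrow> real \<Rightarrow> complex" where
  "nonlinearity n t = fourier (\<lambda>x. of_real (((u x t)\<^sup>2 - mean t) * dx U (x, t))) n"

lemma coef_dt: "coef (dt U) n t = - coef (dx (dx (dx U))) n t - nonlinearity n t"
proof -
  have "coef (dt U) n t = fourier (\<lambda>x. - complex_of_real (dx (dx (dx U)) (x, t)) - of_real (((u x t)\<^sup>2 - mean t) * dx U (x, t))) n"
    unfolding coef_def by (rule fourier_cong) (simp add: equation)
  also have "\<dots> = fourier (\<lambda>x. - complex_of_real (dx (dx (dx U)) (x, t))) n - nonlinearity n t"
    unfolding nonlinearity_def
    by (intro fourier_diff continuous_intros smooth_slice_continuous smooth_slice_continuous' slice_continuous U_deriv)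
  also have "\<dots> = - coef (dx (dx (dx U))) n t - nonlinearity n t" by (simp add: fourier_minus coef_def)
  finally show ?thesis .
qed

abbreviation uhat :: "int \<Rightarrow> real \<Rightarrow> complex" where
  "uhat \<equiv> coef U"

lemma uhat_def: "uhat n t = fourier (\<lambda>x. of_real (u x t)) n"
  by (simp add: coef_def)

lemma uhat_weighted_summable:
  assumes "0 \<le> t" shows "(\<lambda>j. (1 + \<bar>real_of_int j\<bar>) * cmod (uhat j t)) summable_on UNIV"
proof -
  have "(1 + \<bar>real_of_int j\<bar>) * cmod (uhat j t) = cmod (uhat j t) + cmod (coef (dx U) j t)" for j
    using coef_dx[OF U, of j t] by (simp add: norm_mult algebra_simps)
  then show ?thesis using coef_summable[OF U assms] coef_summable[OF U_deriv(1,2) assms]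
    by (simp add: summable_on_add)
qed

lemma square_coef_eq:
  assumes "0 \<le> t" shows "square_coef m t = (\<Sum>\<^sub>\<infinity>j. uhat j t * uhat (m - j) t)"
proof -
  have "fourier (\<lambda>x. of_real (u x t) * of_real (u x t)) m
      = (\<Sum>\<^sub>\<infinity>j. fourier (\<lambda>x. of_real (u x t)) j * fourier (\<lambda>x. of_real (u x t)) (m - j))"
    using periodic_ends[OF U(2), of t] coef_summable[OF U assms]
    by (intro fourier_convolution continuous_intros slice_continuous) (auto simp: uhat_def)
  then show ?thesis by (simp add: square_coef_def uhat_def power2_eq_square)
qed

text \<open>This is the effect of the renormalisation: the mean of the square is its zeroth
  coefficient, so subtracting it deletes exactly the terms with \<open>m = 0\<close>.\<close>

lemma nonlinearity_convolution:
  assumes t: "0 \<le> t"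
  shows "nonlinearity n t = (\<Sum>\<^sub>\<infinity>m\<in>-{0}. square_coef m t * coef (dx U) (n - m) t)"
proof -
  have sq: "continuous_on {0..2*pi} (\<lambda>x. (u x t)\<^sup>2)" by (intro continuous_intros slice_continuous)
  have sq': "continuous_on {0..2*pi} (\<lambda>x. complex_of_real ((u x t)\<^sup>2))" by (intro continuous_intros sq)
  note d = smooth_slice_continuous'[OF U_deriv(1)]
  have "nonlinearity n t = fourier (\<lambda>x. of_real ((u x t)\<^sup>2) * of_real (dx U (x, t)) - of_real (mean t) * of_real (dx U (x, t))) n"
    unfolding nonlinearity_def by (rule fourier_cong) (simp add: left_diff_distrib)
  also have "\<dots> = fourier (\<lambda>x. of_real ((u x t)\<^sup>2) * of_real (dx U (x, t))) n - square_coef 0 t * coef (dx U) n t"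
    unfolding mean_eq[symmetric] coef_def fourier_cmult[symmetric]
    by (intro fourier_diff continuous_on_mult continuous_on_const sq' d)
  also have "fourier (\<lambda>x. of_real ((u x t)\<^sup>2) * of_real (dx U (x, t))) n
      = (\<Sum>\<^sub>\<infinity>m. fourier (\<lambda>x. of_real ((u x t)\<^sup>2)) m * fourier (\<lambda>x. of_real (dx U (x, t))) (n - m))"
    using periodic_ends[OF U(2), of t] coef_summable[OF U_deriv(1,2) t]
    by (intro fourier_convolution sq d) (auto simp: coef_def)
  also have "\<dots> = (\<Sum>\<^sub>\<infinity>m\<in>insert 0 (- {0}). square_coef m t * coef (dx U) (n - m) t)"
    proof -
    have "insert (0::int) (- {0}) = UNIV" by auto
    then show ?thesis by (simp add: square_coef_def coef_def)
  qed
  also have "\<dots> = square_coef 0 t * coef (dx U) n t + (\<Sum>\<^sub>\<infinity>m\<in>- {0}. square_coef m t * coef (dx U) (n - m) t)"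
  proof -
    obtain B where "\<And>k. cmod (square_coef k t) \<le> B"
      unfolding square_coef_def using fourier_bounded[OF sq'] by blast
    then have "(\<lambda>m. square_coef m t * coef (dx U) (n - m) t) summable_on UNIV"
      by (rule Infinite_Sum.abs_summable_summable[OF abs_summable_convolution[OF _ coef_summable[OF U_deriv(1,2) t]]])
    then have "(\<lambda>m. square_coef m t * coef (dx U) (n - m) t) summable_on - {0}"
      by (rule summable_on_subset_banach) auto
    then show ?thesis by (subst infsum_insert) auto
  qed
  finally show ?thesis by simp
qed

text \<open>With the square expanded, the iterated sum over \<open>m\<close> and \<open>j\<close> is
  rewritten in the frequencies \<open>j\<close> and \<open>k = m - j\<close>; absolute convergence,
  from the weighted summability of the coefficients, permits this. The condition
  \<open>m \<noteq> 0\<close> becomes \<open>j + k \<noteq> 0\<close>, where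
  \<open>infsum_resonant_split\<close> applies.\<close>

lemma nonlinearity_eq:
  assumes t: "0 \<le> t"
  shows "nonlinearity n t = \<i> * of_int n / 3 * (\<Sum>\<^sub>\<infinity>jk\<in>nonresonant n. triple (\<lambda>j. uhat j t) n jk)
    - \<i> * of_int n * (uhat n t * uhat n t * uhat (- n) t)"
proof -
  let ?b = "\<lambda>j. uhat j t"
  let ?F = "\<lambda>(j, k). of_int (n - j - k) * triple ?b n (j, k)"
  let ?\<phi> = "\<lambda>(m, j). (j, m - j)"
  let ?f = "\<lambda>mj. \<i> * ?F (?\<phi> mj)"
  note sm = summable_triple(1)[OF uhat_weighted_summable[OF t]]
  have bij: "bij_betw ?\<phi> ((- {0}) \<times> UNIV) {(j, k). j + k \<noteq> (0::int)}"
    by (rule bij_betwI[where g = "\<lambda>(j, k). (j + k, j)"]) auto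
  have smf: "?f summable_on ((- {0}) \<times> UNIV)"
    by (rule summable_on_reindex_bij_betw[OF bij, of "\<lambda>jk. \<i> * ?F jk", THEN iffD2])
      (rule summable_on_cmult_right[OF sm])
  have "nonlinearity n t = (\<Sum>\<^sub>\<infinity>m\<in>-{0}. (\<Sum>\<^sub>\<infinity>j. uhat j t * uhat (m - j) t) * (\<i> * of_int (n - m) * uhat (n - m) t))"
    by (simp add: nonlinearity_convolution[OF t] square_coef_eq[OF t] coef_dx[OF U])
  also have "\<dots> = (\<Sum>\<^sub>\<infinity>m\<in>-{0}. \<Sum>\<^sub>\<infinity>j. ?f (m, j))"
    unfolding infsum_cmult_left'[symmetric] by (intro infsum_cong) (simp add: triple_def mult_ac)
  also have "\<dots> = infsum ?f ((- {0}) \<times> UNIV)" by (rule infsum_Sigma_banach[OF smf])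
  also have "\<dots> = (\<Sum>\<^sub>\<infinity>jk\<in>{(j, k). j + k \<noteq> 0}. \<i> * ?F jk)"
    by (rule infsum_reindex_bij_betw[OF bij])
  also have "\<dots> = \<i> * infsum ?F {(j, k). j + k \<noteq> 0}" by (rule infsum_cmult_right')
  also have "\<dots> = \<i> * (of_int n / 3 * (\<Sum>\<^sub>\<infinity>jk\<in>nonresonant n. triple ?b n jk) - of_int n * (?b n * ?b n * ?b (- n)))"
    using infsum_resonant_split[OF uhat_weighted_summable[OF t], of n] by simp
  finally show ?thesis by (simp add: right_diff_distrib mult.assoc)
qed

text \<open>The linear equation multiplies the n-th coefficient by \<open>cis\<close> of n^3 t; the
  opposite phase removes this evolution.\<close>

definition profile :: "int \<Rightarrow> real \<Rightarrow> complex" where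
  "profile n t = cis (- (real_of_int n ^ 3) * t) * uhat n t"

lemma uhat_profile: "uhat n t = cis (real_of_int n ^ 3 * t) * profile n t"
proof -
  have "cis (c * t) * (cis (- c * t) * z) = z" for c z
    by (simp only: mult.assoc[symmetric] cis_mult) simp
  then show ?thesis by (simp only: profile_def)
qed

lemma profile_derivative:
  "(profile n has_vector_derivative - (cis (- (real_of_int n ^ 3) * t) * nonlinearity n t)) (at t within S)"
proof -
  let ?c = "- (real_of_int n ^ 3)"
  have "(profile n has_vector_derivative cis (?c * t) * coef (dt U) n t + \<i> * of_real ?c * cis (?c * t) * uhat n t) (at t within S)"
    unfolding profile_def[abs_def]
    by (rule has_vector_derivative_mult[OF cis_derivative has_vector_derivative_at_within[OF has_vector_derivative_coef[OF U(1)]]])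
  moreover have "coef (dx (dx (dx U))) n t = - \<i> * of_int n ^ 3 * uhat n t"
  proof -
    have "(\<i> * m) * ((\<i> * m) * ((\<i> * m) * z)) = (\<i> * \<i>) * (\<i> * (m * m * m) * z)" for m z :: complex
      by (simp only: mult_ac)
    then show ?thesis using U U_deriv by (simp only: coef_dx) (simp add: power3_eq_cube)
  qed
  ultimately show ?thesis by (simp add: coef_dt algebra_simps)
qed

lemma triple_profile:
  "cis (- (real_of_int n ^ 3) * t) * triple (\<lambda>j. uhat j t) n (j, k)
   = exp (\<i> * of_real (resonance n j k * t)) * (profile j t * profile k t * profile (n - j - k) t)"
proof -
  let ?l = "n - j - k"
  have "- (real_of_int n ^ 3) * t + (real_of_int j ^ 3 * t + (real_of_int k ^ 3 * t + real_of_int ?l ^ 3 * t)) = resonance n j k * t"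
    by (simp add: resonance_def algebra_simps power3_eq_cube)
  then have "cis (resonance n j k * t) = cis (- (real_of_int n ^ 3) * t) * (cis (real_of_int j ^ 3 * t) * (cis (real_of_int k ^ 3 * t) * cis (real_of_int ?l ^ 3 * t)))"
    by (simp only: cis_mult)
  then show ?thesis
    unfolding triple_def prod.case cis_conv_exp[symmetric] uhat_profile by (simp only: mult_ac)
qed

lemma resonant_profile:
  "cis (- (real_of_int n ^ 3) * t) * (uhat n t * uhat n t * uhat (- n) t) = profile n t * profile n t * profile (- n) t"
proof -
  have "cis (- (real_of_int n ^ 3) * t) * (cis (real_of_int n ^ 3 * t) * (cis (real_of_int n ^ 3 * t) * cis (real_of_int (- n) ^ 3 * t))) = 1"
    unfolding cis_mult by simp
  moreover have "cis (- (real_of_int n ^ 3) * t) * (uhat n t * uhat n t * uhat (- n) t)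
    = (cis (- (real_of_int n ^ 3) * t) * (cis (real_of_int n ^ 3 * t) * (cis (real_of_int n ^ 3 * t) * cis (real_of_int (- n) ^ 3 * t))))
      * (profile n t * profile n t * profile (- n) t)"
    unfolding uhat_profile by (simp only: mult_ac)
  ultimately show ?thesis by simp
qed

lemma profile_derivative':
  assumes "0 \<le> t"
  shows "(profile n has_vector_derivative \<i> * of_int n * (profile n t * profile n t * profile (- n) t)
    - \<i> * of_int n / 3 * (\<Sum>\<^sub>\<infinity>jk\<in>nonresonant n. case jk of (j, k) \<Rightarrow> exp (\<i> * of_real (resonance n j k * t)) *
        (profile j t * profile k t * profile (n - j - k) t))) (at t within S)"
proof -
  let ?c = "cis (- (real_of_int n ^ 3) * t)"
  have "(\<Sum>\<^sub>\<infinity>jk\<in>nonresonant n. case jk of (j, k) \<Rightarrow> exp (\<i> * of_real (resonance n j k * t)) *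
        (profile j t * profile k t * profile (n - j - k) t)) = ?c * (\<Sum>\<^sub>\<infinity>jk\<in>nonresonant n. triple (\<lambda>j. uhat j t) n jk)"
    unfolding infsum_cmult_right'[symmetric] by (intro infsum_cong) (auto simp only: triple_profile split: prod.split)
  then show ?thesis
    using profile_derivative[of n t S] unfolding resonant_profile[symmetric] nonlinearity_eq[OF assms]
    by (simp add: algebra_simps)
qed

lemma norm_profile: "cmod (profile n t) = cmod (uhat n t)"
  by (simp add: profile_def norm_mult)

lemma profile_continuous: "continuous_on S (profile n)"
  using profile_derivative by (rule continuous_on_vector_derivative)

text \<open>The derivative of the profile has the frequency sum inside the time integral,
  \<open>duhamel\<close> has it outside. For smooth solutions the decay of the coefficients gives a
  majorant uniform in time, so the two may be exchanged.\<close>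

lemma mild_profile:
  shows "mild 0 T (\<lambda>n. uhat n 0) profile"
  unfolding mild_def
proof (intro allI ballI)
  fix n t assume t: "t \<in> {0..T}"
  let ?g = "\<lambda>(j, k) \<tau>. exp (\<i> * of_real (resonance n j k * \<tau>)) * (profile j \<tau> * profile k \<tau> * profile (n - j - k) \<tau>)"
  obtain M where M: "0 \<le> M" "\<And>n \<tau>. \<tau> \<in> {0..t} \<Longrightarrow> cmod (uhat n \<tau>) \<le> M * jbr n powr - real 2"
    using coef_decay[OF U, of t 2] by blast
  have M1: "cmod (profile n \<tau>) \<le> M * jbr n powr - 2" if "\<tau> \<in> {0..t}" for n \<tau>
    using M(2)[OF that, of n] by (simp add: norm_profile)
  have M2: "cmod (profile n \<tau>) \<le> M" if "\<tau> \<in> {0..t}" for n \<tau>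
  proof -
    have "jbr n powr - 2 \<le> jbr n powr 0" using jbr_ge_1 by (intro powr_mono) auto
    then show ?thesis using M1[OF that, of n] M(1) mult_left_mono[of "jbr n powr - 2" 1 M] by simp
  qed
  have 1: "((\<lambda>\<tau>. profile n \<tau> * profile n \<tau> * profile (- n) \<tau>) has_integral resonant_part 0 profile n t) {0..t}"
    unfolding resonant_part_def by (intro integrable_integral integrable_continuous_real continuous_intros profile_continuous)
  have 2: "((\<lambda>\<tau>. \<Sum>\<^sub>\<infinity>jk\<in>nonresonant n. ?g jk \<tau>) has_integral (\<Sum>\<^sub>\<infinity>jk\<in>nonresonant n. integral {0..t} (?g jk))) {0..t}"
  proof (rule integral_infsum)
    show "continuous_on {0..t} (?g jk)" for jk
      unfolding case_prod_beta by (intro continuous_intros profile_continuous)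
    show "cmod (?g jk \<tau>) \<le> M * (case jk of (j, k) \<Rightarrow> (M * jbr j powr - 2) * (M * jbr k powr - 2))"
      if "\<tau> \<in> {0..t}" for jk \<tau>
    proof -
      have "cmod (profile (n - fst jk - snd jk) \<tau>) * (cmod (profile (fst jk) \<tau>) * cmod (profile (snd jk) \<tau>))
          \<le> M * ((M * jbr (fst jk) powr - 2) * (M * jbr (snd jk) powr - 2))"
        using M1[OF that] M2[OF that] M(1) by (intro mult_mono) auto
      then show ?thesis by (simp add: case_prod_beta norm_mult mult_ac)
    qed
    have "(\<lambda>(j, k). (M * jbr j powr - 2) * (M * jbr k powr - 2)) summable_on UNIV"
      using M(1) by (intro summable_on_pair_product summable_on_cmult_right jbr_summable) auto
    then show "(\<lambda>jk. M * (case jk of (j, k) \<Rightarrow> (M * jbr j powr - 2) * (M * jbr k powr - 2))) summable_on nonresonant n"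
      by (intro summable_on_cmult_right) (rule summable_on_subset_banach, auto)
  qed
  have "((\<lambda>\<tau>. \<i> * of_int n * (profile n \<tau> * profile n \<tau> * profile (- n) \<tau>)
      - \<i> * of_int n / 3 * (\<Sum>\<^sub>\<infinity>jk\<in>nonresonant n. ?g jk \<tau>)) has_integral duhamel 0 profile n t) {0..t}"
    unfolding duhamel_def interaction_def
    using has_integral_diff[OF has_integral_mult_right[OF 1, of "\<i> * of_int n"] has_integral_mult_right[OF 2, of "\<i> * of_int n / 3"]]
    by (simp add: case_prod_beta)
  moreover have "((\<lambda>\<tau>. \<i> * of_int n * (profile n \<tau> * profile n \<tau> * profile (- n) \<tau>)
      - \<i> * of_int n / 3 * (\<Sum>\<^sub>\<infinity>jk\<in>nonresonant n. ?g jk \<tau>)) has_integral profile n t - profile n 0) {0..t}"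
    using t profile_derivative'[of _ n "{0..t}"]
    by (intro fundamental_theorem_of_calculus) (auto simp: case_prod_beta)
  ultimately have "profile n t - profile n 0 = duhamel 0 profile n t" by (rule has_integral_unique[symmetric])
  then show "profile n t = uhat n 0 + duhamel 0 profile n t" by (simp add: profile_def algebra_simps)
qed

text \<open>The decay of the nonlinearity is read off the equation: it is minus the sum of the time
  derivative and the third space derivative, whose coefficients decay by smoothness, so cubic sums
  are avoided.\<close>

lemma hoelder_le_profile:
  assumes T: "0 < T" "T \<le> 1"
  obtains M where "0 \<le> M" "\<And>n. hoelder_le 0 T T (profile n) (M * jbr n powr - real k)"
proof -
  obtain M0 where M0: "0 \<le> M0" "\<And>n t. t \<in> {0..T} \<Longrightarrow> cmod (uhat n t) \<le> M0 * jbr n powr - real k"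
    using coef_decay[OF U, of T k] by blast
  obtain M1 where M1: "0 \<le> M1" "\<And>n t. t \<in> {0..T} \<Longrightarrow> cmod (coef (dt U) n t) \<le> M1 * jbr n powr - real k"
    using coef_decay[OF U_deriv(3,4), of T k] by blast
  obtain M3 where M3: "0 \<le> M3" "\<And>n t. t \<in> {0..T} \<Longrightarrow> cmod (coef (dx (dx (dx U))) n t) \<le> M3 * jbr n powr - real k"
    using coef_decay[OF U_deriv(7,8), of T k] by blast
  show ?thesis
  proof (rule that[of "M0 + M1 + M3"])
    show "0 \<le> M0 + M1 + M3" using M0 M1 M3 by simp
    fix n
    let ?w = "jbr n powr - real k"
    have D: "cmod (- (cis (- (real_of_int n ^ 3) * t) * nonlinearity n t)) \<le> (M1 + M3) * ?w" if "t \<in> {0..T}" for t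
    proof -
      have "nonlinearity n t = - coef (dx (dx (dx U))) n t - coef (dt U) n t" by (simp add: coef_dt)
      then have "cmod (nonlinearity n t) \<le> cmod (coef (dx (dx (dx U))) n t) + cmod (coef (dt U) n t)"
        by (metis norm_minus_cancel norm_triangle_ineq4)
      then show ?thesis using M1(2)[OF that, of n] M3(2)[OF that, of n] by (simp add: norm_mult distrib_right)
    qed
    show "hoelder_le 0 T T (profile n) ((M0 + M1 + M3) * ?w)"
    proof (rule hbI)
      show "0 \<le> (M0 + M1 + M3) * ?w" using M0 M1 M3 by simp
      show "cmod (profile n t) \<le> (M0 + M1 + M3) * ?w" if "t \<in> {0..T}" for t
      proof -
        have "cmod (profile n t) \<le> M0 * ?w" using M0(2)[OF that] by (simp add: norm_profile)
        also have "\<dots> \<le> (M0 + M1 + M3) * ?w" using M1 M3 by (intro mult_right_mono) auto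
        finally show ?thesis .
      qed
      fix t t' assume t: "0 \<le> t'" "t' \<le> t" "t \<le> T"
      have "((\<lambda>\<tau>. - (cis (- (real_of_int n ^ 3) * \<tau>) * nonlinearity n \<tau>)) has_integral profile n t - profile n t') {t'..t}"
        by (intro fundamental_theorem_of_calculus t profile_derivative)
      from has_integral_bound_real[where B = "(M1 + M3) * ?w" and S = "{}", OF _ _ this]
      have "cmod (profile n t - profile n t') \<le> (M1 + M3) * ?w * (t - t')" using D t M1 M3 by simp
      also have "(M1 + M3) * ?w * (t - t') \<le> (M0 + M1 + M3) * ?w * sqrt ((t - t') / T)"
      proof (intro mult_mono)
        have d: "0 \<le> t - t'" "t - t' \<le> 1" "T * (t - t') \<le> 1" 
          using t T mult_mono[of T 1 "t - t'" 1] by auto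
        have "(t - t')\<^sup>2 \<le> (t - t') / T"
          using d T mult_right_mono[OF d(3), of "t - t'"] by (simp add: field_simps power2_eq_square)
        then show "t - t' \<le> sqrt ((t - t') / T)" by (rule real_le_rsqrt)
      qed (use M0 M1 M3 t in auto)
      finally show "cmod (profile n t - profile n t') \<le> (M0 + M1 + M3) * ?w * sqrt ((t - t') / T)" .
    qed
  qed
qed

end

section \<open>Profiles of smooth solutions belong to the path spaces\<close>

context mkdv_kernel
begin

text \<open>The margin 2 beyond \<open>s\<close> leaves a family decaying like
  \<open>jbr n powr - 2\<close>, which lies in l^p for every p \<ge> 1.\<close>

lemma path_le_decay:
  assumes "0 \<le> M" "\<And>n. hoelder_le a b L (f n) (M * jbr n powr - real k)" "s + 2 \<le> real k" "0 \<le> L"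
  obtains C where "path_le a b L f C"
proof -
  have "p * ereal 2 > 1" using p by (cases p) auto
  then obtain c where c: "lp_le p (\<lambda>n. jbr n powr - 2) c" using lp_le_jbr[OF p, of 2] by auto
  have "path_le a b L f (M * c)" unfolding path_le_def
  proof (intro exI conjI allI)
    show "lp_le p (\<lambda>n. M * jbr n powr - 2) (M * c)" by (rule lp_le_scale[OF p c assms(1)])
    show "hoelder_le a b L (f n) (M * jbr n powr - 2 / wt n)" for n
    proof (rule hoelder_le_mono[OF assms(2) _ assms(4)])
      have "jbr n powr - real k \<le> jbr n powr (- 2 - s)" using assms(3) jbr_ge_1 by (intro powr_mono) auto
      also have "\<dots> = jbr n powr - 2 / wt n" by (rule powr_diff)
      finally show "M * jbr n powr - real k \<le> M * jbr n powr - 2 / wt n"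
        using assms(1) mult_left_mono by fastforce
    qed
  qed
  then show ?thesis using that by blast
qed

lemma path_le_profile:
  assumes "mmkdv_smooth_solution u" "0 < T" "T \<le> 1"
  obtains C where "path_le 0 T T (smooth_solution.profile u) C"
proof -
  interpret smooth_solution u by unfold_locales fact
  obtain k :: nat where k: "s + 2 \<le> real k" using real_arch_simple by blast
  obtain M where "0 \<le> M" "\<And>n. hoelder_le 0 T T (profile n) (M * jbr n powr - real k)" using hoelder_le_profile[OF assms(2,3)] by blast
  then show ?thesis using path_le_decay[OF _ _ k] assms(2) that by (metis less_imp_le)
qed

end

section \<open>Well-posedness\<close>

lemma lp_le_imp_FL:
  assumes "1 \<le> p" "lp_le p (\<lambda>n. jbr n powr s * cmod (c n)) C"
  shows "in_FL s p c" "FL_norm s p c \<le> C"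
proof -
  have "in_FL s p c \<and> FL_norm s p c \<le> C"
    using assms(1)
  proof (cases rule: ereal_exponent_cases)
    case 1
    then show ?thesis using assms(2)
      by (auto simp: in_FL_def FL_norm_def lp_le_infinity intro!: cSUP_least bdd_aboveI2[where M = C])
  next
    case (2 P)
    let ?f = "\<lambda>n. (jbr n powr s * cmod (c n)) powr P"
    have C: "0 \<le> C" "\<And>F. finite F \<Longrightarrow> sum ?f F \<le> C powr P" using assms(2) 2 by (auto simp: lp_le_real)
    have sm: "?f summable_on UNIV"
      by (intro nonneg_bounded_partial_sums_imp_summable_on[where C = "C powr P"] eventually_finite_subsets_at_top_weakI) (auto intro: C)
    have "infsum ?f UNIV \<le> C powr P" by (rule infsum_le_finite_sums[OF sm]) (rule C)
    then have "infsum ?f UNIV powr (1 / P) \<le> (C powr P) powr (1 / P)"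
      using 2 by (intro powr_mono2) (auto intro!: infsum_nonneg)
    then show ?thesis using sm 2 C by (simp add: in_FL_def FL_norm_def powr_powr)
  qed
  then show "in_FL s p c" "FL_norm s p c \<le> C" by auto
qed

lemma FL_imp_lp_le:
  assumes "1 \<le> p" "in_FL s p c"
  shows "lp_le p (\<lambda>n. jbr n powr s * cmod (c n)) (FL_norm s p c)"
  using assms(1)
proof (cases rule: ereal_exponent_cases)
  case 1
  then have bdd: "bdd_above (range (\<lambda>n. jbr n powr s * cmod (c n)))" using assms(2) by (simp add: in_FL_def)
  have le: "jbr n powr s * cmod (c n) \<le> (SUP n. jbr n powr s * cmod (c n))" for n by (rule cSUP_upper[OF _ bdd]) simp
  have "0 \<le> jbr 0 powr s * cmod (c 0)" by simp
  then have "0 \<le> (SUP n. jbr n powr s * cmod (c n))" using le[of 0] by linarith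
  then show ?thesis using 1 le by (simp add: lp_le_infinity FL_norm_def)
next
  case (2 P)
  let ?f = "\<lambda>n. (jbr n powr s * cmod (c n)) powr P"
  have sm: "?f summable_on UNIV" using assms(2) 2 by (simp add: in_FL_def)
  have "(infsum ?f UNIV powr (1 / P)) powr P = infsum ?f UNIV"
    using 2 by (simp add: powr_powr infsum_nonneg)
  then show ?thesis using 2 finite_sum_le_infsum[OF sm] by (auto simp: lp_le_real FL_norm_def)
qed

text \<open>For \<open>p = \<infinity>\<close> the linear flow is not strongly continuous on the whole space. The data are therefore first
  mapped to the closure of the trigonometric polynomials by a Lipschitz retraction: every coefficient is shrunk
  by the distance of the sequence to that closure.\<close>

definition shrink :: "real \<Rightarrow> real \<Rightarrow> real" where
  "shrink d x = x - max (- d) (min d x)"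

lemma shrink_le: "0 \<le> d \<Longrightarrow> \<bar>shrink d x\<bar> \<le> \<bar>x\<bar>" "0 \<le> d \<Longrightarrow> \<bar>shrink d x\<bar> \<le> max 0 (\<bar>x\<bar> - d)"
  by (auto simp: shrink_def max_def min_def)

lemma shrink_lipschitz:
  assumes "0 \<le> d" "0 \<le> d'" shows "\<bar>shrink d x - shrink d' y\<bar> \<le> \<bar>x - y\<bar> + \<bar>d - d'\<bar>"
proof -
  have "\<bar>shrink d x - shrink d y\<bar> \<le> \<bar>x - y\<bar>" using assms by (auto simp: shrink_def max_def min_def)
  moreover have "\<bar>shrink d y - shrink d' y\<bar> \<le> \<bar>d - d'\<bar>" using assms by (auto simp: shrink_def max_def min_def)
  ultimately show ?thesis by linarith
qed

lemma shrink_minus: "0 \<le> d \<Longrightarrow> shrink d (- x) = - shrink d x"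
  by (auto simp: shrink_def max_def min_def)

lemma shrink_0 [simp]: "shrink 0 x = x"
  by (auto simp: shrink_def max_def min_def)

section \<open>Retraction of the data onto sequences with vanishing tails\<close>

context mkdv_kernel
begin

abbreviation FL_le :: "(int \<Rightarrow> complex) \<Rightarrow> real \<Rightarrow> bool" where
  "FL_le c C \<equiv> lp_le p (\<lambda>n. wt n * cmod (c n)) C"

definition vanishing :: "(int \<Rightarrow> complex) \<Rightarrow> bool" where
  "vanishing c \<longleftrightarrow> (\<forall>e>0. \<exists>N\<ge>0. FL_le (\<lambda>n. if \<bar>n\<bar> \<le> N then 0 else c n) e)"

lemma approximable_const:
  assumes "vanishing c" "FL_le c C" "0 \<le> L"
  shows "approximable a b L (\<lambda>n t. c n)"
  unfolding approximable_def
proof (intro allI impI)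
  fix e :: real assume "e > 0"
  then obtain N where N: "0 \<le> N" "FL_le (\<lambda>n. if \<bar>n\<bar> \<le> N then 0 else c n) e"
    using assms(1) by (auto simp: vanishing_def)
  let ?v = "\<lambda>n. if \<bar>n\<bar> \<le> N then c n else 0"
  have "FL_le ?v C" by (rule lp_le_mono[OF p assms(2)]) auto
  moreover have "FL_le (\<lambda>n. c n - ?v n) e" by (rule lp_le_mono[OF p N(2)]) auto
  ultimately show "\<exists>v N C. 0 \<le> N \<and> band_limited N v \<and> path_le a b L v C \<and> path_le a b L (\<lambda>n t. c n - v n t) e"
    using N assms(3) path_le_const[of L "\<lambda>n. c n - ?v n" e a b] path_le_const[of L ?v C a b]
    by (intro exI[of _ "\<lambda>n t. ?v n"] exI[of _ N] exI[of _ C]) (auto simp: band_limited_def)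
qed

lemma vanishing_finite_exponent:
  assumes "p \<noteq> \<infinity>" "FL_le c C" shows "vanishing c"
  unfolding vanishing_def
proof (intro allI impI)
  fix e :: real assume e: "e > 0"
  obtain P where P: "p = ereal P" "1 \<le> P" using p assms(1) by (cases p) auto
  let ?f = "\<lambda>n. (wt n * cmod (c n)) powr P"
  have "?f summable_on UNIV" using lp_le_imp_FL(1)[OF p assms(2)] P by (simp add: in_FL_def)
  then have hs: "(?f has_sum infsum ?f UNIV) UNIV" by simp
  have "e powr P > 0" using e by simp
  from has_sum_finite_approximation[OF hs this]
  obtain F where F: "finite F" "dist (sum ?f F) (infsum ?f UNIV) \<le> e powr P" by auto
  define N where "N = (if F = {} then 0 else Max (abs ` F))"
  have N: "\<bar>n\<bar> \<le> N" if "n \<in> F" for n using that F(1) by (auto simp: N_def)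
  have N0: "0 \<le> N"
  proof (cases "F = {}")
    case True
    then show ?thesis unfolding N_def by simp
  next
    case False
    then obtain n where "n \<in> F" by blast
    then show ?thesis using N[of n] by linarith
  qed
  show "\<exists>N\<ge>0. FL_le (\<lambda>n. if \<bar>n\<bar> \<le> N then 0 else c n) e"
  proof (rule exI[of _ N], intro conjI N0)
    show "FL_le (\<lambda>n. if \<bar>n\<bar> \<le> N then 0 else c n) e"
      unfolding P lp_le_real
    proof (intro conjI allI impI)
      fix G :: "int set" assume G: "finite G"
      have "(\<Sum>n\<in>G. (wt n * cmod (if \<bar>n\<bar> \<le> N then 0 else c n)) powr P) \<le> (\<Sum>n\<in>G. if n \<in> F then 0 else ?f n)"
        using N by (intro sum_mono) auto
      moreover have "\<dots> = sum ?f (G - F)"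
        by (rule sum.mono_neutral_cong_right) (use G in auto)
      moreover have "sum ?f (G - F) + sum ?f F = sum ?f (G \<union> F)"
      proof -
        have "(G - F) \<inter> F = {}" by blast
        from sum.union_disjoint[OF _ F(1) this, of ?f] G show ?thesis by (simp add: Un_Diff_cancel2)
      qed
      moreover have "sum ?f (G \<union> F) \<le> infsum ?f UNIV"
        using G F hs by (intro finite_sum_le_infsum) (auto simp: summable_on_def)
      ultimately show "(\<Sum>n\<in>G. (wt n * cmod (if \<bar>n\<bar> \<le> N then 0 else c n)) powr P) \<le> e powr P"
        using F(2) unfolding dist_real_def by linarith
    qed (use e in auto)
  qed
qed

definition tail_bounds :: "(int \<Rightarrow> complex) \<Rightarrow> real set" where
  "tail_bounds c = {e. 0 \<le> e \<and> (\<exists>N\<ge>0. \<forall>n. N < \<bar>n\<bar> \<longrightarrow> wt n * cmod (c n) \<le> e)}"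

text \<open>For bounded weighted coefficients this is the limit superior of
  \<open>wt n * cmod (c n)\<close>, which for p = \<infinity> is the distance to the sequences with
  vanishing tails.\<close>

definition defect :: "(int \<Rightarrow> complex) \<Rightarrow> real" where
  "defect c = Inf (tail_bounds c)"

text \<open>Soft thresholding of real and imaginary parts. The distance is measured in the weighted
  norm, so the threshold at frequency \<open>n\<close> is divided by the weight; it is even in
  \<open>n\<close> and \<open>shrink\<close> is odd, which preserves the reality condition.\<close>

definition retract :: "(int \<Rightarrow> complex) \<Rightarrow> int \<Rightarrow> complex" where
  "retract c n = (if p = \<infinity> then Complex (shrink (defect c / wt n) (Re (c n))) (shrink (defect c / wt n) (Im (c n))) else c n)"

lemma tail_bounds_bdd: "bdd_below (tail_bounds c)"
  by (rule bdd_belowI[of _ 0]) (auto simp: tail_bounds_def)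

lemma tail_bounds_FL_le: "FL_le c C \<Longrightarrow> C \<in> tail_bounds c"
  using lp_le_pointwise[OF p] lp_le_bound_nonneg by (fastforce simp: tail_bounds_def)

lemma defect_nonneg:
  assumes "FL_le c C" shows "0 \<le> defect c"
  unfolding defect_def by (rule cInf_greatest) (use tail_bounds_FL_le[OF assms] in \<open>auto simp: tail_bounds_def\<close>)

lemma defect_le_add:
  assumes "FL_le c C" "FL_le d D" "FL_le (\<lambda>n. c n - d n) \<delta>"
  shows "defect c \<le> defect d + \<delta>"
proof -
  have "defect c - \<delta> \<le> defect d"
    unfolding defect_def[of d]
  proof (rule cInf_greatest)
    show "tail_bounds d \<noteq> {}" using tail_bounds_FL_le[OF assms(2)] by blast
    fix e assume e: "e \<in> tail_bounds d"
    then obtain N where N: "0 \<le> N" "\<And>n. N < \<bar>n\<bar> \<Longrightarrow> wt n * cmod (d n) \<le> e" by (auto simp: tail_bounds_def)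
    have "wt n * cmod (c n) \<le> e + \<delta>" if "N < \<bar>n\<bar>" for n
    proof -
      have "wt n * cmod (c n) \<le> wt n * (cmod (d n) + cmod (c n - d n))"
        by (intro mult_left_mono norm_triangle_sub) auto
      then show ?thesis using N(2)[OF that] lp_le_pointwise[OF p assms(3), of n] by (simp add: distrib_left)
    qed
    then have "e + \<delta> \<in> tail_bounds c" using N(1) e lp_le_bound_nonneg[OF assms(3)] by (auto simp: tail_bounds_def)
    then have "defect c \<le> e + \<delta>" unfolding defect_def by (rule cInf_lower[OF _ tail_bounds_bdd])
    then show "defect c - \<delta> \<le> e" by simp
  qed
  then show ?thesis by simp
qed

lemma FL_le_diff_commute: "FL_le (\<lambda>n. c n - d n) \<delta> \<Longrightarrow> FL_le (\<lambda>n. d n - c n) \<delta>"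
  by (simp add: norm_minus_commute)

lemma norm_retract_le: "FL_le c C \<Longrightarrow> cmod (retract c n) \<le> cmod (c n)"
proof -
  assume "FL_le c C"
  then have "0 \<le> defect c / wt n" using defect_nonneg by simp
  then have "(shrink (defect c / wt n) x)\<^sup>2 \<le> x\<^sup>2" for x
    using shrink_le(1) by (simp add: abs_le_square_iff)
  then show ?thesis by (simp add: retract_def cmod_def add_mono)
qed

lemma FL_le_retract: "FL_le c C \<Longrightarrow> FL_le (retract c) C"
  by (rule lp_le_mono[OF p]) (auto intro: mult_left_mono norm_retract_le)

lemma real_coeffs_retract:
  assumes "FL_le c C" "real_coeffs c" shows "real_coeffs (retract c)"
  using assms(2) shrink_minus[of "defect c / wt _"] defect_nonneg[OF assms(1)]
  by (auto simp: real_coeffs_def retract_def complex_eq_iff)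

text \<open>For p = \<infinity>: far out the weighted coefficients exceed the defect by at most
  \<open>e / 2\<close>, and thresholding subtracts the defect, so each of the two parts is left with
  at most \<open>e / 2\<close>. For finite p every element of the space has vanishing tails.\<close>

lemma vanishing_retract:
  assumes c: "FL_le c C" shows "vanishing (retract c)"
proof (cases "p = \<infinity>")
  case False
  then show ?thesis using vanishing_finite_exponent FL_le_retract[OF c] by blast
next
  case True
  note D = defect_nonneg[OF c]
  show ?thesis unfolding vanishing_def
  proof (intro allI impI)
    fix e :: real assume e: "e > 0"
    have "Inf (tail_bounds c) < defect c + e / 2" using e by (simp add: defect_def)
    then obtain b where b: "b \<in> tail_bounds c" "b < defect c + e / 2"
      using cInf_lessD tail_bounds_FL_le[OF c] by blast
    then obtain N where N: "0 \<le> N" "\<And>n. N < \<bar>n\<bar> \<Longrightarrow> wt n * cmod (c n) \<le> b" by (auto simp: tail_bounds_def)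
    have "wt n * cmod (retract c n) \<le> e" if n: "N < \<bar>n\<bar>" for n
    proof -
      have x: "wt n * \<bar>shrink (defect c / wt n) x\<bar> \<le> e / 2" if "\<bar>x\<bar> \<le> cmod (c n)" for x
      proof -
        have "wt n * \<bar>shrink (defect c / wt n) x\<bar> \<le> wt n * max 0 (\<bar>x\<bar> - defect c / wt n)"
          using D by (intro mult_left_mono shrink_le) auto
        also have "\<dots> = max 0 (wt n * \<bar>x\<bar> - defect c)"
          by (auto simp: max_def right_diff_distrib field_simps)
        also have "\<dots> \<le> e / 2"
        proof (rule max.boundedI)
          have "wt n * \<bar>x\<bar> \<le> wt n * cmod (c n)" by (rule mult_left_mono[OF that]) simp
          then show "wt n * \<bar>x\<bar> - defect c \<le> e / 2" using N(2)[OF n] b(2) by linarith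
        qed (use e in simp)
        finally show ?thesis .
      qed
      have "wt n * cmod (retract c n) \<le> wt n * (\<bar>Re (retract c n)\<bar> + \<bar>Im (retract c n)\<bar>)"
        by (intro mult_left_mono cmod_le) auto
      also have "\<dots> \<le> e / 2 + e / 2"
        unfolding distrib_left retract_def if_P[OF True] complex.sel
        by (intro add_mono x abs_Re_le_cmod abs_Im_le_cmod)
      finally show ?thesis by simp
    qed
    then have "FL_le (\<lambda>n. if \<bar>n\<bar> \<le> N then 0 else retract c n) e"
      using True e by (auto simp: lp_le_infinity)
    then show "\<exists>N\<ge>0. FL_le (\<lambda>n. if \<bar>n\<bar> \<le> N then 0 else retract c n) e" using N(1) by blast
  qed
qed

text \<open>Vanishing tails make the defect 0. This is why the construction agrees with the solution
  map on smooth data.\<close>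

lemma retract_vanishing:
  assumes "FL_le c C" "vanishing c" shows "retract c = c"
proof (cases "p = \<infinity>")
  case True
  have "defect c \<le> 0 + e" if e: "e > 0" for e
  proof -
    obtain N where N: "N \<ge> 0" "FL_le (\<lambda>n. if \<bar>n\<bar> \<le> N then 0 else c n) e" using assms(2) e by (auto simp: vanishing_def)
    have "wt n * cmod (c n) \<le> e" if "N < \<bar>n\<bar>" for n
      using lp_le_pointwise[OF p N(2), of n] that by simp
    then have "e \<in> tail_bounds c" using N(1) e by (auto simp: tail_bounds_def)
    then show ?thesis using cInf_lower[OF _ tail_bounds_bdd] by (simp add: defect_def)
  qed
  then have "defect c \<le> 0" by (rule field_le_epsilon)
  then have "defect c = 0" using defect_nonneg[OF assms(1)] by simp
  then show ?thesis by (simp add: fun_eq_iff retract_def)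
qed (simp add: fun_eq_iff retract_def)

text \<open>Distance functions are Lipschitz with constant 1, so the coefficient and its threshold
  each contribute \<delta>; real and imaginary parts double this to 4.\<close>

lemma retract_lipschitz:
  assumes "FL_le c C" "FL_le d D" "FL_le (\<lambda>n. c n - d n) \<delta>"
  shows "FL_le (\<lambda>n. retract c n - retract d n) (4 * \<delta>)"
proof (cases "p = \<infinity>")
  case False
  then show ?thesis using assms(3) lp_le_bound_nonneg[OF assms(3)] by (simp add: retract_def) (rule lp_le_mono[OF p assms(3)], auto)
next
  case True
  have dd: "\<bar>defect c - defect d\<bar> \<le> \<delta>"
    using defect_le_add[OF assms] defect_le_add[OF assms(2,1) FL_le_diff_commute[OF assms(3)]] by auto
  have "wt n * cmod (retract c n - retract d n) \<le> 4 * \<delta>" for n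
  proof -
    have x: "wt n * \<bar>shrink (defect c / wt n) x - shrink (defect d / wt n) y\<bar> \<le> 2 * \<delta>" if "\<bar>x - y\<bar> \<le> cmod (c n - d n)" for x y
    proof -
      have "wt n * \<bar>shrink (defect c / wt n) x - shrink (defect d / wt n) y\<bar>
          \<le> wt n * (cmod (c n - d n) + \<bar>defect c / wt n - defect d / wt n\<bar>)"
        using defect_nonneg[OF assms(1)] defect_nonneg[OF assms(2)] that
        by (intro mult_left_mono order_trans[OF shrink_lipschitz] add_mono) auto
      also have "\<dots> = wt n * cmod (c n - d n) + \<bar>defect c - defect d\<bar>"
        by (simp add: distrib_left diff_divide_distrib[symmetric] abs_div_pos[symmetric])
      finally show ?thesis using dd lp_le_pointwise[OF p assms(3), of n] by simp
    qed
    have "wt n * cmod (retract c n - retract d n) \<le> wt n * (\<bar>Re (retract c n - retract d n)\<bar> + \<bar>Im (retract c n - retract d n)\<bar>)"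
      by (intro mult_left_mono cmod_le) auto
    also have "\<dots> \<le> 2 * \<delta> + 2 * \<delta>"
      unfolding distrib_left retract_def if_P[OF True] minus_complex.sel complex.sel
      using abs_Re_le_cmod[of "c n - d n"] abs_Im_le_cmod[of "c n - d n"] by (intro add_mono x) simp_all
    finally show ?thesis by simp
  qed
  then show ?thesis using True lp_le_bound_nonneg[OF assms(3)] by (auto simp: lp_le_infinity)
qed

lemma vanishing_decay:
  assumes M: "0 \<le> M" "\<And>n. wt n * cmod (c n) \<le> M * jbr n powr - 2" and c: "FL_le c C"
  shows "vanishing c"
proof (cases "p = \<infinity>")
  case False
  then show ?thesis using vanishing_finite_exponent c by blast
next
  case True
  show ?thesis unfolding vanishing_def
  proof (intro allI impI)
    fix e :: real assume e: "e > 0"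
    obtain N :: nat where N: "M / e \<le> real N" using real_arch_simple by blast
    have "wt n * cmod (c n) \<le> e" if n: "int N < \<bar>n\<bar>" for n
    proof -
      have "real N \<le> \<bar>real_of_int n\<bar>" using n by linarith
      then have "M / e \<le> jbr n" using N abs_le_jbr[of n] by linarith
      then have "M / jbr n \<le> e" using e by (simp add: field_simps)
      moreover have "M * jbr n powr - 2 \<le> M * jbr n powr - 1"
        using M(1) jbr_ge_1 by (intro mult_left_mono powr_mono) auto
      moreover have "jbr n powr - 1 = 1 / jbr n" by (simp add: powr_minus_divide)
      ultimately show ?thesis using M(2)[of n] by simp
    qed
    then have "FL_le (\<lambda>n. if \<bar>n\<bar> \<le> int N then 0 else c n) e"
      unfolding True lp_le_infinity using e by auto
    then show "\<exists>N\<ge>0. FL_le (\<lambda>n. if \<bar>n\<bar> \<le> N then 0 else c n) e" by (intro exI[of _ "int N"]) simp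
  qed
qed

lemma vanishing_uhat:
  assumes "smooth_solution u" "FL_le (\<lambda>n. smooth_solution.uhat u n 0) C"
  shows "vanishing (\<lambda>n. smooth_solution.uhat u n 0)"
proof -
  interpret smooth_solution u by fact
  obtain k :: nat where k: "s + 2 \<le> real k" using real_arch_simple by blast
  obtain M where M: "0 \<le> M" "\<And>n t. t \<in> {0..0} \<Longrightarrow> cmod (uhat n t) \<le> M * jbr n powr - real k"
    using coef_decay[OF U, of 0 k] by blast
  show ?thesis
  proof (rule vanishing_decay[OF M(1) _ assms(2)])
    fix n
    have "wt n * cmod (uhat n 0) \<le> wt n * (M * jbr n powr - real k)" using M(2) by (intro mult_left_mono) auto
    also have "\<dots> = M * jbr n powr (s - real k)" by (simp add: powr_add[symmetric] mult.left_commute)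
    also have "\<dots> \<le> M * jbr n powr - 2" using M(1) k jbr_ge_1 by (intro mult_left_mono powr_mono) auto
    finally show "wt n * cmod (uhat n 0) \<le> M * jbr n powr - 2" .
  qed
qed

lemma exists_time:
  assumes "0 < R"
  obtains T where "0 < T" "T \<le> 1" "48 * (1 + \<kappa>) * sqrt T * (2 * R)\<^sup>2 \<le> 1/4"
proof
  define B where "B = 4 * (48 * (1 + \<kappa>) * (2 * R)\<^sup>2) + 1"
  have B: "B \<ge> 1" using lp_le_bound_nonneg[OF kernel] by (simp add: B_def)
  show "0 < 1 / B\<^sup>2" "1 / B\<^sup>2 \<le> 1" using B by auto
  have "4 * (48 * (1 + \<kappa>) * sqrt (1 / B\<^sup>2) * (2 * R)\<^sup>2) = (B - 1) / B"
    using B by (simp add: real_sqrt_divide B_def)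
  also have "\<dots> \<le> 1" using B by simp
  finally show "48 * (1 + \<kappa>) * sqrt (1 / B\<^sup>2) * (2 * R)\<^sup>2 \<le> 1/4" by simp
qed

end

theorem theorem1p1:
  fixes s :: real and p :: ereal
  assumes "s \<ge> 1/2" and "1 \<le> p"
    and "conj_exp p * ereal (s + 1/4) > 1"
  shows "\<forall>R>0. \<exists>T>0. \<exists>\<Phi> :: (int \<Rightarrow> complex) \<Rightarrow> real \<Rightarrow> (int \<Rightarrow> complex).
      \<comment> \<open>values in C([0,T], FL^{s,p})\<close>
      (\<forall>a\<in>FLr s p. FL_norm s p a < R \<longrightarrow>
          (\<forall>t\<in>{0..T}. \<Phi> a t \<in> FLr s p) \<and>
          (\<forall>t0\<in>{0..T}. \<forall>e>0. \<exists>d>0. \<forall>t\<in>{0..T}. \<bar>t - t0\<bar> < d \<longrightarrow>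
              FL_norm s p (\<Phi> a t - \<Phi> a t0) < e)) \<and>
      \<comment> \<open>uniform continuity from B(0,R) to C([0,T], FL^{s,p})\<close>
      (\<forall>e>0. \<exists>d>0. \<forall>a\<in>FLr s p. \<forall>b\<in>FLr s p.
          FL_norm s p a < R \<longrightarrow> FL_norm s p b < R \<longrightarrow> FL_norm s p (a - b) < d \<longrightarrow>
          (\<forall>t\<in>{0..T}. FL_norm s p (\<Phi> a t - \<Phi> b t) < e)) \<and>
      \<comment> \<open>\<Phi> extends the smooth solution map W\<close>
      (\<forall>u0 u. smooth_data u0 \<longrightarrow> FL_norm s p (fcoef u0) < R \<longrightarrow>
          mmkdv_smooth_solution u \<longrightarrow> (\<forall>x. u x 0 = u0 x) \<longrightarrow>
          (\<forall>t\<in>{0..T}. \<Phi> (fcoef u0) t = fcoef (\<lambda>x. u x t)))"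
proof (intro allI impI)
  fix R :: real assume R: "R > 0"
  obtain \<kappa> where "\<And>n. lp_le (conj_exp p) (kernel s n) \<kappa>" using lp_le_kernel[OF assms] by blast
  then interpret mkdv_kernel s p \<kappa> using assms by unfold_locales
  obtain T where T: "0 < T" "T \<le> 1" "48 * (1 + \<kappa>) * sqrt T * (2 * R)\<^sup>2 \<le> 1/4"
    using exists_time[OF R] by blast
  have T0: "T - 0 \<le> T" by simp
  have T': "48 * (1 + \<kappa>) * sqrt T * (2 * R)\<^sup>2 \<le> 1/2" using T(3) by simp
  \<comment> \<open>The choice also fixes the convergence of the Picard iterates, from which
    symmetry and approximability of the solution are obtained. Such a path exists for data of norm
    at most \<open>R\<close>.\<close>
  define sol where "sol c = (SOME a. mild 0 T c a \<and> path_le 0 T T a (2 * R) \<and>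
    (\<forall>m. path_le 0 T T (\<lambda>n t. a n t - picard c m n t) (R / 2 ^ m)))" for c
  have sol: "mild 0 T c (sol c)" "path_le 0 T T (sol c) (2 * R)"
      "\<And>m. path_le 0 T T (\<lambda>n t. sol c n t - picard c m n t) (R / 2 ^ m)" if "FL_le c R" for c
    using someI_ex[OF exists_mild[OF T(1,2) R T(3) that]] unfolding sol_def by blast+
  \<comment> \<open>The factor \<open>cis\<close> puts the linear flow back.\<close>
  define \<Phi> where "\<Phi> a t n = cis (real_of_int n ^ 3 * t) * sol (retract a) n t" for a t n
  have FL_le: "FL_le a R" if "a \<in> FLr s p" "FL_norm s p a < R" for a
    using lp_le_mono[OF p FL_imp_lp_le[OF p, of s a], of "\<lambda>n. wt n * cmod (a n)" R] that by (auto simp: FLr_def)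
  have norm_lt: "FL_norm s p c < e" if "FL_le c e'" "e' < e" for c e e'
    using lp_le_imp_FL(2)[OF p that(1)] that(2) by linarith
  show "\<exists>T>0. \<exists>\<Phi> :: (int \<Rightarrow> complex) \<Rightarrow> real \<Rightarrow> (int \<Rightarrow> complex).
      (\<forall>a\<in>FLr s p. FL_norm s p a < R \<longrightarrow>
          (\<forall>t\<in>{0..T}. \<Phi> a t \<in> FLr s p) \<and>
          (\<forall>t0\<in>{0..T}. \<forall>e>0. \<exists>d>0. \<forall>t\<in>{0..T}. \<bar>t - t0\<bar> < d \<longrightarrow>
              FL_norm s p (\<Phi> a t - \<Phi> a t0) < e)) \<and>
      (\<forall>e>0. \<exists>d>0. \<forall>a\<in>FLr s p. \<forall>b\<in>FLr s p.
          FL_norm s p a < R \<longrightarrow> FL_norm s p b < R \<longrightarrow> FL_norm s p (a - b) < d \<longrightarrow>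
          (\<forall>t\<in>{0..T}. FL_norm s p (\<Phi> a t - \<Phi> b t) < e)) \<and>
      (\<forall>u0 u. smooth_data u0 \<longrightarrow> FL_norm s p (fcoef u0) < R \<longrightarrow>
          mmkdv_smooth_solution u \<longrightarrow> (\<forall>x. u x 0 = u0 x) \<longrightarrow>
          (\<forall>t\<in>{0..T}. \<Phi> (fcoef u0) t = fcoef (\<lambda>x. u x t)))"
  proof (rule exI[of _ T], intro conjI T(1), rule exI[of _ \<Phi>], intro conjI ballI allI impI)
    fix a assume a: "a \<in> FLr s p" "FL_norm s p a < R"
    note ra = FL_le_retract[OF FL_le[OF a]]
    fix t assume t: "t \<in> {0..T}"
    have rr: "real_coeffs (retract a)"
      using real_coeffs_retract[OF FL_le[OF a]] a(1) by (simp add: FLr_def)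
    have "real_coeffs (\<Phi> a t)"
      unfolding real_coeffs_def \<Phi>_def using mild_cnj[OF sol(3)[OF ra] rr t] by (simp add: cis_cnj)
    moreover have "FL_le (\<Phi> a t) (2 * R)"
      using path_le_lp_le[OF sol(2)[OF ra] t] by (simp add: \<Phi>_def norm_mult)
    ultimately show "\<Phi> a t \<in> FLr s p" using lp_le_imp_FL(1)[OF p] by (simp add: FLr_def)
  next
    fix a t0 e assume a: "a \<in> FLr s p" "FL_norm s p a < R" and t0: "t0 \<in> {0..T}" and e: "(e::real) > 0"
    note ra = FL_le_retract[OF FL_le[OF a]]
    have "approximable 0 T T (\<lambda>n t. retract a n)"
      using T by (intro approximable_const[OF vanishing_retract[OF FL_le[OF a]] ra]) auto
    then have "approximable 0 T T (sol (retract a))"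
      by (rule approximable_mild[OF T(1,2) _ sol(3)[OF ra] sol(2)[OF ra]])
    from approximable_flow_continuous[OF this T(1) t0, of "e / 2"] e
    obtain d where d: "d > 0" "\<And>t. t \<in> {0..T} \<Longrightarrow> \<bar>t - t0\<bar> < d \<Longrightarrow> FL_le (\<Phi> a t - \<Phi> a t0) (e / 2)"
      by (auto simp: \<Phi>_def)
    show "\<exists>d>0. \<forall>t\<in>{0..T}. \<bar>t - t0\<bar> < d \<longrightarrow> FL_norm s p (\<Phi> a t - \<Phi> a t0) < e"
      using d norm_lt[of _ "e / 2" e] e by (intro exI[of _ d]) auto
  next
    fix e :: real assume e: "e > 0"
    show "\<exists>d>0. \<forall>a\<in>FLr s p. \<forall>b\<in>FLr s p.
          FL_norm s p a < R \<longrightarrow> FL_norm s p b < R \<longrightarrow> FL_norm s p (a - b) < d \<longrightarrow>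
          (\<forall>t\<in>{0..T}. FL_norm s p (\<Phi> a t - \<Phi> b t) < e)"
    \<comment> \<open>The Lipschitz constant is 8: 4 from \<open>retract_lipschitz\<close> times 2
      from \<open>mild_diff_le\<close>.\<close>
    proof (intro exI[of _ "e / 8"] conjI ballI impI)
      show "e / 8 > 0" using e by simp
      fix a b t assume a: "a \<in> FLr s p" "FL_norm s p a < R" and b: "b \<in> FLr s p" "FL_norm s p b < R"
        and ab: "FL_norm s p (a - b) < e / 8" and t: "t \<in> {0..T}"
      note ra = FL_le_retract[OF FL_le[OF a]] and rb = FL_le_retract[OF FL_le[OF b]]
      \<comment> \<open>A crude bound first places the difference in the space; otherwise
        \<open>FL_norm\<close> might be a default value and bound nothing.\<close>
      have "FL_le (\<lambda>n. a n - b n) (R + R)"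
        by (rule lp_le_mono[OF p lp_le_add[OF p FL_le[OF a] FL_le[OF b]]])
          (auto simp: distrib_left[symmetric] intro!: mult_left_mono norm_triangle_ineq4)
      then have "in_FL s p (a - b)" using lp_le_imp_FL(1)[OF p] by (simp add: fun_diff_def)
      from FL_imp_lp_le[OF p this] have "FL_le (\<lambda>n. a n - b n) (FL_norm s p (a - b))" by simp
      from mild_diff_le[OF T(1,2) T0 T' sol(1,2)[OF ra] sol(1,2)[OF rb] retract_lipschitz[OF FL_le[OF a] FL_le[OF b] this] t]
      have "FL_le (\<lambda>n. sol (retract a) n t - sol (retract b) n t) (8 * FL_norm s p (a - b))" by simp
      moreover have "cmod ((\<Phi> a t - \<Phi> b t) n) = cmod (sol (retract a) n t - sol (retract b) n t)" for n
        by (simp add: \<Phi>_def right_diff_distrib[symmetric] norm_mult)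
      ultimately have "FL_le (\<Phi> a t - \<Phi> b t) (8 * FL_norm s p (a - b))" by simp
      then show "FL_norm s p (\<Phi> a t - \<Phi> b t) < e" by (rule norm_lt) (use ab in simp)
    qed
  next
    fix u0 u t
    assume small: "FL_norm s p (fcoef u0) < R" and u: "mmkdv_smooth_solution u" and u0: "\<forall>x. u x 0 = u0 x" and t: "t \<in> {0..T}"
    interpret smooth_solution u by unfold_locales (rule u)
    let ?c = "fcoef u0"
    have c: "?c = (\<lambda>n. uhat n 0)" using u0 by (simp add: fun_eq_iff fcoef_eq_fourier uhat_def)
    obtain C where C: "path_le 0 T T profile C" using path_le_profile[OF u T(1,2)] by blast
    have "profile n 0 = ?c n" for n by (simp add: c profile_def)
    \<comment> \<open>Membership of the data has to come from smoothness. Only then does the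
      assumption on \<open>FL_norm\<close> bound the coefficients by \<open>R\<close>.\<close>
    then have "FL_le ?c C" using path_le_lp_le[OF C, of 0] T(1) by simp
    note L = FL_imp_lp_le[OF p lp_le_imp_FL(1)[OF p this]]
    have cR: "FL_le ?c R" by (rule lp_le_mono[OF p L lp_le_nonneg[OF L] order_refl less_imp_le[OF small]])
    have "vanishing ?c" using vanishing_uhat[OF smooth_solution_axioms] cR unfolding c .
    then have r: "retract ?c = ?c" by (rule retract_vanishing[OF cR])
    \<comment> \<open>The smooth profile has some bound \<open>C\<close>, possibly larger than
      \<open>2 * R\<close>; uniqueness is applied in the larger of the two balls.\<close>
    have "sol ?c n t = profile n t" for n
    proof (rule mild_unique[OF T(1,2) sol(1)[OF cR] path_le_mono[OF sol(2)[OF cR]] _ path_le_mono[OF C] t])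
      show "mild 0 T ?c profile" unfolding c by (rule mild_profile)
      show "2 * R \<le> max (2 * R) C" "C \<le> max (2 * R) C" by auto
    qed
    then have "\<Phi> ?c t n = uhat n t" for n unfolding \<Phi>_def r uhat_profile[of n t] by (simp only:)
    then show "\<Phi> ?c t = fcoef (\<lambda>x. u x t)" unfolding fcoef_eq_fourier uhat_def[symmetric] by (rule ext)
  qed
qed

end
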